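(* Let $u\in\mathbf{L}^\infty([0,T]\times\Omega;\mathbb{R})$. Then $u$ is an RE-solution to the initial-boundary value problem (IBVP) if and only if $u$ is an MV-solution to the IBVP.
   Context: **Setting.** $N\ge 1$; $\Omega\subset\mathbb{R}^N$ is a bounded open set with smooth boundary $\partial\Omega$; $T>0$; $\mathbb{R}_+=[0,+\infty[$; $]a,b[$ denotes an open interval; $\mathrm{d}\xi$ is surface measure on $\partial\Omega$. The IBVP is $$\partial_t u+\nabla\cdot f(t,x,u)=F(t,x,u)\ \text{ in }\Omega,\qquad u(0,x)=u_o(x)\ (x\in\Omega),\qquad u(t,\xi)=u_b(t,\xi)\ (\xi\in\partial\Omega),$$ considered on the time interval $[0,T]$. Here $\nabla\cdot f(t,x,u(t,x))=\mathrm{div} f(t,x,u(t,x))+\partial_u f(t,x,u(t,x))\cdot\nabla u(t,x)$, i.e. $\mathrm{div}$ is the divergence with respect to the explicit variable $x$ only, with the remaining arguments frozen (also for entropy fluxes $Q$). **Standing assumptions.** $u_o\in \mathbf{L}^\infty(\Omega;\mathbb{R})$; $u_b\in\mathbf{L}^\infty([0,T]\times\partial\Omega;\mathbb{R})$; $f\in\mathbf{C}^2([0,T]\times\overline\Omega\times\mathbb{R};\mathbb{R}^N)$ with $\partial_u f\in\mathbf{L}^\infty_{\mathrm{loc}}([0,T]\times\Omega\times\mathbb{R};\mathbb{R}^N)$ and $\nabla_x\partial_u f\in\mathbf{L}^\infty([0,T]\times\Omega\times\mathbb{R};\mathbb{R}^{N\times N})$; $F\in\mathbf{C}^2([0,T]\times\overline\Omega\times\mathbb{R};\mathbb{R})$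 with $\partial_u F\in\mathbf{L}^\infty([0,T]\times\Omega\times\mathbb{R};\mathbb{R})$. **Notation.** $\partial_i$ is the partial derivative with respect to the $i$-th argument (so $\partial_3 f=\partial_u f$). $\mathrm{sgn}^+(s)=1$ if $s>0$, $0$ if $s\le0$; $\mathrm{sgn}^-(s)=0$ if $s\ge 0$, $-1$ if $s<0$; $s^+=\max\{s,0\}$, $s^-=\max\{-s,0\}$. For a given $u\in\mathbf{L}^\infty([0,T]\times\Omega;\mathbb{R})$ set $\mathcal{U}=[-U,U]$ with $U=\|u\|_{\mathbf{L}^\infty([0,T]\times\Omega;\mathbb{R})}$, and $L=\|\partial_u f\|_{\mathbf{L}^\infty([0,T]\times\Omega\times\mathcal{U};\mathbb{R}^N)}$. "Test function" means $\phi\in\mathbf{C}^1_c(]-\infty,T[\times\mathbb{R}^N;\mathbb{R}_+)$. **Boundary entropy-entropy flux pair (with respect to $f$).** A pair $(H,Q)\in\mathbf{C}^2(\mathbb{R}^2;\mathbb{R})\times\mathbf{C}^2([0,T]\times\overline\Omega\times\mathbb{R}^2;\mathbb{R}^N)$ such that: (i) $z\mapsto H(z,w)$ is convex for every $w\in\mathbb{R}$; (ii) $\partial_3 Q(t,x,z,w)=\partial_1 H(z,w)\,\partial_3 f(t,x,z)$ for all $t\in[0,T]$, $x\in\overline\Omega$, $z,w\in\mathbb{R}$; (iii) $H(w,w)=0$, $Q(t,x,w,w)=0$, $\partial_1H(w,w)=0$ for all $t\in[0,T]$, $x\in\overline\Omega$, $w\in\mathbb{R}$. **RE-solution.** $u\in\mathbf{L}^\infty([0,T]\times\Omega;\mathbb{R})$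 such that for every boundary entropy-entropy flux pair $(H,Q)$, every $k\in\mathbb{R}$ and every test function $\phi$, $$\begin{aligned}&\int_0^T\!\!\int_\Omega\big[H(u,k)\,\partial_t\phi+Q(t,x,u,k)\cdot\nabla\phi\big]\mathrm{d}x\,\mathrm{d}t+\int_0^T\!\!\int_\Omega\partial_1H(u,k)\big[F(t,x,u)-\mathrm{div} f(t,x,u)\big]\phi\,\mathrm{d}x\,\mathrm{d}t\\&+\int_0^T\!\!\int_\Omega\mathrm{div}\,Q(t,x,u,k)\,\phi\,\mathrm{d}x\,\mathrm{d}t+\int_\Omega H(u_o(x),k)\,\phi(0,x)\,\mathrm{d}x+L\int_0^T\!\!\int_{\partial\Omega}H(u_b(t,\xi),k)\,\phi(t,\xi)\,\mathrm{d}\xi\,\mathrm{d}t\ge0,\end{aligned}$$ where $u=u(t,x)$, $\phi=\phi(t,x)$ in the integrals over $\Omega$. **MV-solution.** $u\in\mathbf{L}^\infty([0,T]\times\Omega;\mathbb{R})$ such that for every $k\in\mathbb{R}$, every test function $\phi$, and for both choices of sign $\pm$, $$\begin{aligned}&\int_0^T\!\!\int_\Omega(u-k)^\pm\partial_t\phi\,\mathrm{d}x\,\mathrm{d}t+\int_0^T\!\!\int_\Omega\mathrm{sgn}^\pm(u-k)\,(f(t,x,u)-f(t,x,k))\cdot\nabla\phi\,\mathrm{d}x\,\mathrm{d}t\\&+\int_0^T\!\!\int_\Omega\mathrm{sgn}^\pm(u-k)\big[F(t,x,u)-\mathrm{div} f(t,x,k)\big]\phi\,\mathrm{d}x\,\mathrm{d}t+\int_\Omega(u_o(x)-k)^\pm\phi(0,x)\,\mathrm{d}x\\&+L\int_0^T\!\!\int_{\partial\Omega}(u_b(t,\xi)-k)^\pm\phi(t,\xi)\,\mathrm{d}\xi\,\mathrm{d}t\ge0.\end{aligned}$$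 *)

theory Defs
  imports "HOL-Analysis.Analysis"
begin

section \<open>Functions of class \<open>C\<^sup>k\<close>\<close>

primrec Ck_open :: "nat \<Rightarrow> 'a::euclidean_space set \<Rightarrow> ('a \<Rightarrow> 'b::real_normed_vector) \<Rightarrow> bool" where
  "Ck_open 0 V g \<longleftrightarrow> continuous_on V g"
| "Ck_open (Suc k) V g \<longleftrightarrow>
     (\<exists>g'. (\<forall>p\<in>V. (g has_derivative g' p) (at p)) \<and> (\<forall>v. Ck_open k V (\<lambda>p. g' p v)))"

text \<open>
  On a set that need not be open, such as \<open>[0,T]\<close> times the closure of a domain, \<open>C\<^sup>k\<close> means
  being the restriction of a \<open>C\<^sup>k\<close> function defined on an open neighbourhood. If \<open>S\<close> is open, this
  is \<open>C\<^sup>k\<close> in the usual sense.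
\<close>

definition Ck_on :: "nat \<Rightarrow> 'a::euclidean_space set \<Rightarrow> ('a \<Rightarrow> 'b::real_normed_vector) \<Rightarrow> bool" where
  "Ck_on k S g \<longleftrightarrow> (\<exists>V h. open V \<and> S \<subseteq> V \<and> Ck_open k V h \<and> (\<forall>p\<in>S. h p = g p))"

text \<open>
  Near each boundary point the domain is the part lying on one side of a smooth graph, after
  choosing a coordinate axis \<open>i\<close> and an orientation \<open>s\<close>. A function of the remaining
  coordinates is encoded as a function on the whole space that ignores the \<open>i\<close>-th coordinate.
\<close>

definition smooth_boundary :: "(real^'n) set \<Rightarrow> bool" where
  "smooth_boundary \<Omega> \<longleftrightarrow>
     (\<forall>p\<in>frontier \<Omega>. \<exists>r>0. \<exists>i. \<exists>s\<in>{-1, 1}. \<exists>\<gamma> :: real^'n \<Rightarrow> real.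
        (\<forall>k. Ck_on k UNIV \<gamma>) \<and>
        (\<forall>x y. (\<forall>j. j \<noteq> i \<longrightarrow> x $ j = y $ j) \<longrightarrow> \<gamma> x = \<gamma> y) \<and>
        \<Omega> \<inter> ball p r = {x \<in> ball p r. s * x $ i > \<gamma> x})"

section \<open>Differential operators\<close>

definition grad :: "(real^'n \<Rightarrow> real) \<Rightarrow> real^'n \<Rightarrow> real^'n" where
  "grad g x = (\<chi> i. frechet_derivative g (at x) (axis i 1))"

definition divergence :: "(real^'n \<Rightarrow> real^'n) \<Rightarrow> real^'n \<Rightarrow> real" where
  "divergence g x = (\<Sum>i\<in>UNIV. frechet_derivative g (at x) (axis i 1) $ i)"

definition d3 :: "(real \<Rightarrow> real^'n \<Rightarrow> real \<Rightarrow> 'b::real_normed_vector) \<Rightarrow> real \<Rightarrow> real^'n \<Rightarrow> real \<Rightarrow> 'b" where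
  "d3 g t x v = vector_derivative (\<lambda>s. g t x s) (at v)"

section \<open>Essentially bounded functions\<close>

text \<open>Elements of \<open>L\<^sup>\<infinity>\<close> are represented by measurable functions; values off the space of \<open>M\<close>
  are irrelevant.\<close>

definition in_Linf :: "'a measure \<Rightarrow> ('a \<Rightarrow> 'b::real_normed_vector) \<Rightarrow> bool" where
  "in_Linf M g \<longleftrightarrow> g \<in> borel_measurable M \<and> (\<exists>C. AE p in M. norm (g p) \<le> C)"

definition Linf_norm :: "'a measure \<Rightarrow> ('a \<Rightarrow> 'b::real_normed_vector) \<Rightarrow> real" where
  "Linf_norm M g = Inf {C. 0 \<le> C \<and> (AE p in M. norm (g p) \<le> C)}"

section \<open>Surface measure\<close>

text \<open>
  Surface measure on the boundary is the Hausdorff measure of dimension \<open>N - 1\<close>, normalised so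
  that in dimension \<open>m\<close> a ball of diameter \<open>d\<close> has weight \<open>\<omega>\<^sub>m (d / 2)\<^sup>m\<close>. As the exponent is a
  natural number and \<open>0\<^sup>0 = 1\<close>, the case \<open>m = 0\<close> is the counting measure; the empty set must then
  be given weight \<open>0\<close> explicitly.
\<close>

definition hausdorff_weight :: "nat \<Rightarrow> 'a::metric_space set \<Rightarrow> ennreal" where
  "hausdorff_weight m C =
     (if C = {} then 0 else ennreal (unit_ball_vol (real m) * (diameter C / 2) ^ m))"

definition hausdorff_premeasure :: "nat \<Rightarrow> real \<Rightarrow> 'a::metric_space set \<Rightarrow> ennreal" where
  "hausdorff_premeasure m \<delta> A =
     Inf {(\<Sum>n. hausdorff_weight m (C n)) | C :: nat \<Rightarrow> 'a set.
            A \<subseteq> (\<Union>n. C n) \<and> (\<forall>n. bounded (C n) \<and> diameter (C n) \<le> \<delta>)}"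

definition hausdorff_outer :: "nat \<Rightarrow> 'a::metric_space set \<Rightarrow> ennreal" where
  "hausdorff_outer m A = (SUP \<delta>\<in>{0<..}. hausdorff_premeasure m \<delta> A)"

definition hausdorff_measure :: "nat \<Rightarrow> 'a::metric_space measure" where
  "hausdorff_measure m = measure_of UNIV (sets borel) (hausdorff_outer m)"

definition surface_measure :: "(real^'n) set \<Rightarrow> (real^'n) measure" where
  "surface_measure \<Omega> = restrict_space (hausdorff_measure (CARD('n) - 1)) (frontier \<Omega>)"

abbreviation interior_measure :: "real \<Rightarrow> (real^'n) set \<Rightarrow> (real \<times> (real^'n)) measure" where
  "interior_measure T \<Omega> \<equiv> lebesgue_on ({0..T} \<times> \<Omega>)"

definition lateral_measure :: "real \<Rightarrow> (real^'n) set \<Rightarrow> (real \<times> (real^'n)) measure" where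
  "lateral_measure T \<Omega> = completion (restrict_space lborel {0..T} \<Otimes>\<^sub>M surface_measure \<Omega>)"

section \<open>Solutions\<close>

text \<open>Test functions are extended by \<open>0\<close> to times \<open>t \<ge> T\<close>.\<close>

definition test_function :: "real \<Rightarrow> (real \<times> (real^'n) \<Rightarrow> real) \<Rightarrow> bool" where
  "test_function T \<phi> \<longleftrightarrow>
     Ck_on 1 ({..<T} \<times> UNIV) \<phi> \<and> (\<forall>p. 0 \<le> \<phi> p) \<and>
     (\<exists>K. compact K \<and> K \<subseteq> {..<T} \<times> UNIV \<and> (\<forall>p. p \<notin> K \<longrightarrow> \<phi> p = 0))"

text \<open>
  \<open>\<partial>\<^sub>u f\<close> is continuous, so its \<open>L\<^sup>\<infinity>\<close> norm is its supremum. The supremum is also the intended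
  quantity when \<open>U = 0\<close>, where \<open>{-U..U}\<close> is a null set and an essential supremum would vanish.
\<close>

definition lip_const ::
  "real \<Rightarrow> (real^'n) set \<Rightarrow> (real \<Rightarrow> real^'n \<Rightarrow> real \<Rightarrow> real^'n) \<Rightarrow> (real \<times> (real^'n) \<Rightarrow> real) \<Rightarrow> real" where
  "lip_const T \<Omega> f u =
     (let U = Linf_norm (interior_measure T \<Omega>) u
      in SUP (t, x, v) \<in> {0..T} \<times> \<Omega> \<times> {-U..U}. norm (d3 f t x v))"

definition boundary_entropy_pair ::
  "real \<Rightarrow> (real^'n) set \<Rightarrow> (real \<Rightarrow> real^'n \<Rightarrow> real \<Rightarrow> real^'n) \<Rightarrow>
   (real \<Rightarrow> real \<Rightarrow> real) \<Rightarrow> (real \<Rightarrow> real^'n \<Rightarrow> real \<Rightarrow> real \<Rightarrow> real^'n) \<Rightarrow> bool" where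
  "boundary_entropy_pair T \<Omega> f H Q \<longleftrightarrow>
     Ck_on 2 UNIV (\<lambda>(z, w). H z w) \<and>
     Ck_on 2 ({0..T} \<times> closure \<Omega> \<times> UNIV \<times> UNIV) (\<lambda>(t, x, z, w). Q t x z w) \<and>
     (\<forall>w. convex_on UNIV (\<lambda>z. H z w)) \<and>
     (\<forall>t\<in>{0..T}. \<forall>x\<in>closure \<Omega>. \<forall>z w.
        vector_derivative (\<lambda>s. Q t x s w) (at z) = deriv (\<lambda>s. H s w) z *\<^sub>R d3 f t x z) \<and>
     (\<forall>t\<in>{0..T}. \<forall>x\<in>closure \<Omega>. \<forall>w.
        H w w = 0 \<and> Q t x w w = 0 \<and> deriv (\<lambda>s. H s w) w = 0)"

definition RE_solution ::
  "real \<Rightarrow> (real^'n) set \<Rightarrow> (real \<Rightarrow> real^'n \<Rightarrow> real \<Rightarrow> real^'n) \<Rightarrow> (real \<Rightarrow> real^'n \<Rightarrow> real \<Rightarrow> real) \<Rightarrow>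
   (real^'n \<Rightarrow> real) \<Rightarrow> (real \<times> (real^'n) \<Rightarrow> real) \<Rightarrow> (real \<times> (real^'n) \<Rightarrow> real) \<Rightarrow> bool" where
  "RE_solution T \<Omega> f F uo ub u \<longleftrightarrow>
     in_Linf (interior_measure T \<Omega>) u \<and>
     (\<forall>H Q k \<phi>. boundary_entropy_pair T \<Omega> f H Q \<longrightarrow> test_function T \<phi> \<longrightarrow>
        (LINT (t, x)|interior_measure T \<Omega>.
            H (u (t, x)) k * deriv (\<lambda>s. \<phi> (s, x)) t
          + Q t x (u (t, x)) k \<bullet> grad (\<lambda>y. \<phi> (t, y)) x)
      + (LINT (t, x)|interior_measure T \<Omega>.
            deriv (\<lambda>s. H s k) (u (t, x))
          * (F t x (u (t, x)) - divergence (\<lambda>y. f t y (u (t, x))) x) * \<phi> (t, x))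
      + (LINT (t, x)|interior_measure T \<Omega>.
            divergence (\<lambda>y. Q t y (u (t, x)) k) x * \<phi> (t, x))
      + (LINT x|lebesgue_on \<Omega>. H (uo x) k * \<phi> (0, x))
      + lip_const T \<Omega> f u
          * (LINT (t, \<xi>)|lateral_measure T \<Omega>. H (ub (t, \<xi>)) k * \<phi> (t, \<xi>)) \<ge> 0)"

definition pos_part :: "real \<Rightarrow> real" where
  "pos_part s = max s 0"

definition neg_part :: "real \<Rightarrow> real" where
  "neg_part s = max (- s) 0"

definition sgn_plus :: "real \<Rightarrow> real" where
  "sgn_plus s = (if s > 0 then 1 else 0)"

definition sgn_minus :: "real \<Rightarrow> real" where
  "sgn_minus s = (if s < 0 then - 1 else 0)"

definition MV_solution ::
  "real \<Rightarrow> (real^'n) set \<Rightarrow> (real \<Rightarrow> real^'n \<Rightarrow> real \<Rightarrow> real^'n) \<Rightarrow> (real \<Rightarrow> real^'n \<Rightarrow> real \<Rightarrow> real) \<Rightarrow>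
   (real^'n \<Rightarrow> real) \<Rightarrow> (real \<times> (real^'n) \<Rightarrow> real) \<Rightarrow> (real \<times> (real^'n) \<Rightarrow> real) \<Rightarrow> bool" where
  "MV_solution T \<Omega> f F uo ub u \<longleftrightarrow>
     in_Linf (interior_measure T \<Omega>) u \<and>
     (\<forall>k \<phi>. test_function T \<phi> \<longrightarrow>
       (\<forall>(part, sg) \<in> {(pos_part, sgn_plus), (neg_part, sgn_minus)}.
        (LINT (t, x)|interior_measure T \<Omega>. part (u (t, x) - k) * deriv (\<lambda>s. \<phi> (s, x)) t)
      + (LINT (t, x)|interior_measure T \<Omega>.
            sg (u (t, x) - k) * ((f t x (u (t, x)) - f t x k) \<bullet> grad (\<lambda>y. \<phi> (t, y)) x))
      + (LINT (t, x)|interior_measure T \<Omega>.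
            sg (u (t, x) - k) * (F t x (u (t, x)) - divergence (\<lambda>y. f t y k) x) * \<phi> (t, x))
      + (LINT x|lebesgue_on \<Omega>. part (uo x - k) * \<phi> (0, x))
      + lip_const T \<Omega> f u
          * (LINT (t, \<xi>)|lateral_measure T \<Omega>. part (ub (t, \<xi>) - k) * \<phi> (t, \<xi>)) \<ge> 0))"

end

(*
A boundary entropy H(., k) is the superposition, with density H''(c, k) dc >= 0, of the
semi-entropies (. - c)^+ for c > k and (. - c)^- for c < k. Integrating by parts in c, the
corresponding superposition of the fluxes and of the source terms in the MV-inequalities gives
exactly Q, H' (F - div f) and div Q. By Fubini, the left-hand side of the RE-inequality at level k
is therefore the integral against H''(c, k) of the left-hand sides of the MV-inequalities at the
levels c, with sign + above k and - below.

One implication is then the nonnegativity of H''. For the other, every nonnegative C^2 function of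
z - k is the second derivative of an admissible H; densities concentrated next to k, on one side of
it, produce levels c arbitrarily close to k at which the MV left-hand side is nonnegative, and
dominated convergence carries this over to k.

Fubini's theorem on the lateral boundary requires its measure to be finite. As the boundary is
compact and locally a Lipschitz graph, its Hausdorff outer measure is finite.
*)
theory Submission imports Defs begin

section \<open>Calculus of \<open>C\<^sup>k\<close> functions\<close>

text \<open>In the RE-notion \<open>Q\<close> is tied to \<open>f\<close> only through its state
  derivative and its zero on the diagonal. From these two facts \<open>Q\<close> is recovered as an
  integral involving \<open>f\<close> and \<open>H''\<close>, and only this formula gives access to
  its divergence in \<open>x\<close>, by differentiation under the integral sign. Conversely, a pair
  built from a density needs a flux that is C^2 on a neighbourhood of the closed domain, where only
  an extension of \<open>f\<close> is available. Both tasks are handled by writing integrals along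
  the oriented segment from \<open>k\<close> to \<open>z\<close> over the fixed interval [0, 1].

  The pointwise identities require data with values in [-R, R] everywhere; the data are therefore
  truncated at a height that alters them on null sets only, while \<open>L\<close> remains the
  constant of the original \<open>u\<close>.

  The return to the level \<open>k\<close> has to be one-sided, because {u = k} may have positive
  measure: \<open>sgn_plus (z - c)\<close> tends to \<open>sgn_plus (z - k)\<close> as c decreases
  to k even when z = k, whereas from below the limit at z = k would be 1. The minus sign mirrors
  this.\<close>

lemma Ck_open_imp_continuous_on:
  assumes "Ck_open k V g"
  shows "continuous_on V g"
proof (cases k)
  case (Suc m)
  with assms obtain g' where "\<forall>p\<in>V. (g has_derivative g' p) (at p)" by auto
  then show ?thesis
    by (intro has_derivative_continuous_on[where f' = g']) (simp add: has_derivative_at_withinI)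
qed (use assms in simp)

lemma Ck_open_SucD: "Ck_open (Suc k) V g \<Longrightarrow> Ck_open k V g"
proof (induction k arbitrary: g)
  case 0
  then show ?case by (metis Ck_open.simps(1) Ck_open_imp_continuous_on)
next
  case (Suc k)
  then obtain g' where "\<forall>p\<in>V. (g has_derivative g' p) (at p)" "\<forall>v. Ck_open (Suc k) V (\<lambda>p. g' p v)"
    by (subst (asm) Ck_open.simps(2)) blast
  then show ?case using Suc.IH by auto
qed

lemma Ck_open_subset: "Ck_open k V g \<Longrightarrow> W \<subseteq> V \<Longrightarrow> Ck_open k W g"
proof (induction k arbitrary: g)
  case 0
  then show ?case by (auto intro: continuous_on_subset)
next
  case (Suc k)
  then show ?case by (simp, meson in_mono)
qed

lemma Ck_open_cong:
  assumes "open V" "\<And>p. p \<in> V \<Longrightarrow> g p = h p" "Ck_open k V g"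
  shows "Ck_open k V h"
proof (cases k)
  case 0
  then show ?thesis using assms by (simp cong: continuous_on_cong)
next
  case (Suc m)
  with assms obtain g' where g': "\<forall>p\<in>V. (g has_derivative g' p) (at p)" "\<forall>v. Ck_open m V (\<lambda>p. g' p v)"
    by auto
  have "\<forall>p\<in>V. (h has_derivative g' p) (at p)"
    using g'(1) assms(1,2) has_derivative_transform_within_open by blast
  with g'(2) Suc show ?thesis by auto
qed

lemma Ck_open_const [simp]: "Ck_open k V (\<lambda>p. c)"
proof (induction k arbitrary: c)
  case (Suc k)
  have "\<forall>p\<in>V. ((\<lambda>p. c) has_derivative (\<lambda>v. 0)) (at p)" by auto
  then show ?case using Suc[of 0] unfolding Ck_open.simps by (intro exI[of _ "\<lambda>p v. 0"]) auto
qed simp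

lemma Ck_open_bounded_linear: "bounded_linear L \<Longrightarrow> Ck_open k V L"
proof (cases k)
  case 0
  then show "bounded_linear L \<Longrightarrow> ?thesis" by (simp add: linear_continuous_on)
next
  case (Suc m)
  show "bounded_linear L \<Longrightarrow> ?thesis"
    unfolding Suc Ck_open.simps
    by (rule exI[of _ "\<lambda>p. L"]) (auto intro: bounded_linear_imp_has_derivative)
qed

lemma Ck_open_linear_compose:
  assumes "bounded_linear L"
  shows "Ck_open k V g \<Longrightarrow> Ck_open k V (\<lambda>p. L (g p))"
proof (induction k arbitrary: g)
  case 0
  then show ?case using assms by (simp add: bounded_linear.continuous_on)
next
  case (Suc k)
  then obtain g' where g': "\<forall>p\<in>V. (g has_derivative g' p) (at p)" "\<forall>v. Ck_open k V (\<lambda>p. g' p v)"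
    by auto
  then show ?case unfolding Ck_open.simps using Suc.IH
    by (intro exI[of _ "\<lambda>p v. L (g' p v)"]) (auto intro: bounded_linear.has_derivative[OF assms])
qed

lemma Ck_open_add: "Ck_open k V g \<Longrightarrow> Ck_open k V h \<Longrightarrow> Ck_open k V (\<lambda>p. g p + h p)"
proof (induction k arbitrary: g h)
  case 0
  then show ?case by (simp add: continuous_on_add)
next
  case (Suc k)
  then obtain g' h' where
      g': "\<forall>p\<in>V. (g has_derivative g' p) (at p)" "\<forall>v. Ck_open k V (\<lambda>p. g' p v)" and
      h': "\<forall>p\<in>V. (h has_derivative h' p) (at p)" "\<forall>v. Ck_open k V (\<lambda>p. h' p v)"
    by auto
  then show ?case unfolding Ck_open.simps using Suc.IH
    by (intro exI[of _ "\<lambda>p v. g' p v + h' p v"]) (auto intro: has_derivative_add)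
qed

lemma Ck_open_diff: "Ck_open k V g \<Longrightarrow> Ck_open k V h \<Longrightarrow> Ck_open k V (\<lambda>p. g p - h p)"
  using Ck_open_add[of k V g "\<lambda>p. - h p"]
    Ck_open_linear_compose[OF bounded_linear_minus[OF bounded_linear_ident], of k V h] by simp

lemma Ck_open_sum:
  "finite I \<Longrightarrow> (\<And>i. i \<in> I \<Longrightarrow> Ck_open k V (g i)) \<Longrightarrow> Ck_open k V (\<lambda>p. \<Sum>i\<in>I. g i p)"
  by (induction I rule: finite_induct) (auto intro: Ck_open_add)

lemma Ck_open_scaleR:
  fixes a :: "'a::euclidean_space \<Rightarrow> real"
  shows "Ck_open k V a \<Longrightarrow> Ck_open k V g \<Longrightarrow> Ck_open k V (\<lambda>p. a p *\<^sub>R g p)"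
proof (induction k arbitrary: a g)
  case 0
  then show ?case by (simp add: continuous_on_scaleR)
next
  case (Suc k)
  then obtain a' g' where
      a': "\<forall>p\<in>V. (a has_derivative a' p) (at p)" "\<forall>v. Ck_open k V (\<lambda>p. a' p v)" and
      g': "\<forall>p\<in>V. (g has_derivative g' p) (at p)" "\<forall>v. Ck_open k V (\<lambda>p. g' p v)"
    by auto
  have "Ck_open k V a" "Ck_open k V g" using Suc.prems Ck_open_SucD by auto
  with a' g' show ?case unfolding Ck_open.simps
    by (intro exI[of _ "\<lambda>p v. a p *\<^sub>R g' p v + a' p v *\<^sub>R g p"])
      (auto intro!: has_derivative_scaleR Ck_open_add Suc.IH)
qed

lemma Ck_open_mult:
  fixes a :: "'a::euclidean_space \<Rightarrow> real"
  shows "Ck_open k V a \<Longrightarrow> Ck_open k V g \<Longrightarrow> Ck_open k V (\<lambda>p. a p * g p)"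
  using Ck_open_scaleR[of k V a g] by simp

lemma Ck_open_Pair: "Ck_open k V g \<Longrightarrow> Ck_open k V h \<Longrightarrow> Ck_open k V (\<lambda>p. (g p, h p))"
proof (induction k arbitrary: g h)
  case 0
  then show ?case by (simp add: continuous_on_Pair)
next
  case (Suc k)
  then obtain g' h' where
      g': "\<forall>p\<in>V. (g has_derivative g' p) (at p)" "\<forall>v. Ck_open k V (\<lambda>p. g' p v)" and
      h': "\<forall>p\<in>V. (h has_derivative h' p) (at p)" "\<forall>v. Ck_open k V (\<lambda>p. h' p v)"
    by auto
  then show ?case unfolding Ck_open.simps using Suc.IH
    by (intro exI[of _ "\<lambda>p v. (g' p v, h' p v)"]) (auto intro: has_derivative_Pair)
qed

lemma Ck_open_compose:
  fixes g :: "'b::euclidean_space \<Rightarrow> 'c::real_normed_vector" and h :: "'a::euclidean_space \<Rightarrow> 'b"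
  shows "Ck_open k W g \<Longrightarrow> Ck_open k V h \<Longrightarrow> h ` V \<subseteq> W \<Longrightarrow> Ck_open k V (\<lambda>p. g (h p))"
proof (induction k arbitrary: g)
  case 0
  then show ?case by (auto intro: continuous_on_compose2)
next
  case (Suc k)
  then obtain g' h' where
      g': "\<forall>p\<in>W. (g has_derivative g' p) (at p)" "\<forall>v. Ck_open k W (\<lambda>p. g' p v)" and
      h': "\<forall>p\<in>V. (h has_derivative h' p) (at p)" "\<forall>v. Ck_open k V (\<lambda>p. h' p v)"
    by auto
  have hk: "Ck_open k V h" using Suc.prems(2) by (rule Ck_open_SucD)
  \<comment> \<open>The induction hypothesis covers \<open>g'\<close> only in a fixed direction, so
    the moving direction \<open>h' p v\<close> is expanded in the basis.\<close>
  let ?D = "\<lambda>p v. \<Sum>b\<in>Basis. (h' p v \<bullet> b) *\<^sub>R g' (h p) b"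
  have "((\<lambda>p. g (h p)) has_derivative ?D p) (at p)" if "p \<in> V" for p
  proof -
    have hp: "h p \<in> W" using Suc.prems(3) that by auto
    have "((\<lambda>p. g (h p)) has_derivative (\<lambda>v. g' (h p) (h' p v))) (at p)"
      using has_derivative_compose[of h "h' p" p UNIV g "g' (h p)"] g'(1) h'(1) hp that by auto
    moreover have "g' (h p) (h' p v) = ?D p v" for v
    proof -
      have l: "linear (g' (h p))" using g'(1) hp has_derivative_linear by blast
      have "g' (h p) (h' p v) = g' (h p) (\<Sum>b\<in>Basis. (h' p v \<bullet> b) *\<^sub>R b)"
        by (simp add: euclidean_representation)
      then show ?thesis by (simp add: linear_sum[OF l] linear_scale[OF l])
    qed
    ultimately show ?thesis by simp
  qed
  moreover have "Ck_open k V (\<lambda>p. ?D p v)" for v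
    using h'(2) g'(2) hk Suc.prems(3)
    by (intro Ck_open_sum Ck_open_scaleR Suc.IH
        Ck_open_linear_compose[where g = "\<lambda>p. h' p v" for v, OF bounded_linear_inner_left]) auto
  ultimately show ?case unfolding Ck_open.simps by (intro exI[of _ ?D]) auto
qed

text \<open>Serves two purposes: integrals over [0, 1] inherit the smoothness of their integrands,
  and the \<open>x\<close>-divergence of an entropy flux can be computed. Continuity of the
  derivative is asked direction by direction, which is the form that \<open>Ck_open\<close>
  supplies.\<close>

lemma has_derivative_param_integral:
  fixes G :: "'a::euclidean_space \<Rightarrow> real \<Rightarrow> 'b::euclidean_space"
  assumes der: "\<And>p r. p \<in> V \<Longrightarrow> r \<in> {0..1} \<Longrightarrow> ((\<lambda>p. G p r) has_derivative G' p r) (at p)"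
    and cont: "\<And>v. continuous_on (V \<times> {0..1}) (\<lambda>(p, r). G' p r v)"
    and contG: "\<And>p. p \<in> V \<Longrightarrow> continuous_on {0..1} (G p)"
    and V: "open V" "p \<in> V"
  shows "((\<lambda>p. integral {0..1} (G p)) has_derivative
          (\<lambda>v. integral {0..1} (\<lambda>r. G' p r v))) (at p)"
proof -
  obtain e where e: "e > 0" "ball p e \<subseteq> V" using V openE by blast
  let ?U = "ball p e"
  \<comment> \<open>\<open>leibniz_rule\<close> asks for a derivative that is continuous as a map
    into bounded linear operators; in finite dimension continuity in each basis direction is
    enough.\<close>
  define fx where "fx y r = Blinfun (G' y r)" for y r
  have fx: "blinfun_apply (fx y r) = G' y r" if "y \<in> V" "r \<in> {0..1}" for y r
    unfolding fx_def using has_derivative_bounded_linear[OF der[OF that]]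
    by (simp add: bounded_linear_Blinfun_apply)
  have cfx: "continuous_on (?U \<times> cbox 0 1) (\<lambda>(y, r). fx y r)"
  proof (rule continuous_on_blinfun_componentwise)
    fix i :: 'a
    have "continuous_on (?U \<times> cbox 0 1) (\<lambda>(y, r). G' y r i)"
      by (rule continuous_on_subset[OF cont]) (use e in auto)
    then show "continuous_on (?U \<times> cbox 0 1) (\<lambda>q. blinfun_apply (case q of (y, r) \<Rightarrow> fx y r) i)"
      by (rule continuous_on_eq) (use e fx in \<open>auto simp: subset_eq\<close>)
  qed
  have "((\<lambda>y. integral (cbox 0 1) (G y)) has_derivative
      blinfun_apply (integral (cbox 0 1) (fx p))) (at p within ?U)"
  proof (rule leibniz_rule)
    show "((\<lambda>y. G y r) has_derivative blinfun_apply (fx y r)) (at y within ?U)"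
      if "y \<in> ?U" "r \<in> cbox 0 1" for y r
      using der[of y r] fx[of y r] subsetD[OF e(2), of y] that by (auto intro: has_derivative_at_withinI)
    show "G y integrable_on cbox 0 1" if "y \<in> ?U" for y
      using contG[OF subsetD[OF e(2) that]] by (simp add: integrable_continuous_real)
  qed (use cfx e in auto)
  moreover have "blinfun_apply (integral (cbox 0 1) (fx p)) = (\<lambda>v. integral {0..1} (\<lambda>r. G' p r v))"
  proof
    fix v
    have "fx p integrable_on cbox 0 1"
    proof (rule integrable_continuous)
      have "continuous_on (cbox 0 (1::real)) (\<lambda>r. case (p, r) of (y, r) \<Rightarrow> fx y r)"
        by (rule continuous_on_compose2[OF cfx]) (use e in \<open>auto intro!: continuous_intros\<close>)
      then show "continuous_on (cbox 0 1) (fx p)" by simp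
    qed
    from integral_linear[OF this blinfun.bounded_linear_left[of v]]
    have "blinfun_apply (integral (cbox 0 1) (fx p)) v = integral (cbox 0 1) (\<lambda>r. blinfun_apply (fx p r) v)"
      by (simp add: o_def)
    also have "\<dots> = integral {0..1} (\<lambda>r. G' p r v)"
      using fx V by (auto intro!: integral_cong)
    finally show "blinfun_apply (integral (cbox 0 1) (fx p)) v = integral {0..1} (\<lambda>r. G' p r v)" .
  qed
  ultimately have "((\<lambda>y. integral {0..1} (G y)) has_derivative
      (\<lambda>v. integral {0..1} (\<lambda>r. G' p r v))) (at p within ?U)"
    by simp
  then show ?thesis using e by (simp add: at_within_open[OF centre_in_ball[THEN iffD2] open_ball])
qed

text \<open>The derivative of the integral in direction \<open>v\<close> is again such an integral,
  of \<open>G'\<close> in direction \<open>(v, 0)\<close>, so the induction on \<open>k\<close>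
  closes. The fixed range [0, 1] keeps boundary terms out.\<close>

lemma Ck_open_param_integral:
  fixes G :: "'a::euclidean_space \<times> real \<Rightarrow> 'b::euclidean_space"
  shows "Ck_open k W G \<Longrightarrow> open V \<Longrightarrow> V \<times> {0..1} \<subseteq> W \<Longrightarrow>
    Ck_open k V (\<lambda>p. integral {0..1} (\<lambda>r. G (p, r)))"
proof (induction k arbitrary: G)
  case 0
  then have "continuous_on (V \<times> cbox 0 1) (\<lambda>(p, r). G (p, r))"
    by (auto intro: continuous_on_subset)
  from integral_continuous_on_param[OF this] show ?case by simp
next
  case (Suc k)
  then obtain G' where
      G': "\<forall>p\<in>W. (G has_derivative G' p) (at p)" "\<forall>v. Ck_open k W (\<lambda>p. G' p v)"
    by auto
  have contG: "continuous_on (V \<times> {0..1}) G"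
    using Suc.prems Ck_open_imp_continuous_on continuous_on_subset by blast
  have cont: "continuous_on (V \<times> {0..1}) (\<lambda>q. G' q v)" for v
    using G'(2) Ck_open_imp_continuous_on continuous_on_subset Suc.prems(3) by blast
  show ?case unfolding Ck_open.simps
  proof (intro exI[of _ "\<lambda>p v. integral {0..1} (\<lambda>r. G' (p, r) (v, 0))"] conjI ballI allI)
    fix p assume "p \<in> V"
    show "((\<lambda>p. integral {0..1} (\<lambda>r. G (p, r))) has_derivative
          (\<lambda>v. integral {0..1} (\<lambda>r. G' (p, r) (v, 0)))) (at p)"
    proof (rule has_derivative_param_integral[OF _ _ _ \<open>open V\<close> \<open>p \<in> V\<close>, where G' = "\<lambda>p r v. G' (p, r) (v, 0)"])
      show "((\<lambda>p. G (p, r)) has_derivative (\<lambda>v. G' (p, r) (v, 0))) (at p)" if "p \<in> V" "r \<in> {0..1}" for p r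
        by (rule has_derivative_compose[OF has_derivative_Pair[OF has_derivative_ident has_derivative_const]])
          (use G'(1) Suc.prems(3) that in blast)
      show "continuous_on (V \<times> {0..1}) (\<lambda>(p, r). G' (p, r) (v, 0))" for v
        using cont[of "(v, 0)"] by (simp add: case_prod_unfold)
      show "continuous_on {0..1} (\<lambda>r. G (p, r))" if "p \<in> V" for p
        by (rule continuous_on_compose2[OF contG]) (use that in \<open>auto intro!: continuous_intros\<close>)
    qed
  next
    fix v
    show "Ck_open k V (\<lambda>p. integral {0..1} (\<lambda>r. G' (p, r) (v, 0)))"
      using Suc.IH[of "\<lambda>q. G' q (v, 0)"] G'(2) Suc.prems by auto
  qed
qed

section \<open>Truncated powers\<close>

lemma Ck_open_real_fun:
  fixes g :: "real \<Rightarrow> real"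
  assumes "\<And>x. (g has_real_derivative g' x) (at x)" "Ck_open k UNIV g'"
  shows "Ck_open (Suc k) UNIV g"
  unfolding Ck_open.simps
  by (rule exI[of _ "\<lambda>x v. g' x * v"])
     (use assms in \<open>auto simp: has_field_derivative_def intro: Ck_open_mult\<close>)

text \<open>The exponent is at least 2, so both branches have derivative 0 at the origin and glue
  there.\<close>

lemma has_derivative_max_power:
  "((\<lambda>s::real. max 0 s ^ Suc (Suc m)) has_real_derivative (real (Suc (Suc m)) * max 0 s ^ Suc m)) (at s)"
proof -
  have 1: "((\<lambda>s::real. s ^ Suc (Suc m)) has_vector_derivative (real (Suc (Suc m)) * s ^ Suc m)) (at s within A)" for A
    using DERIV_pow[of "Suc (Suc m)" s A] by (simp add: has_real_derivative_iff_has_vector_derivative del: power_Suc)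
  have "((\<lambda>s::real. if s \<in> {0..} then s ^ Suc (Suc m) else 0) has_vector_derivative
      (if s \<in> {0..} then real (Suc (Suc m)) * s ^ Suc m else 0)) (at s within UNIV)"
  proof (rule has_vector_derivative_If_within_closures[where T = "{..0}"])
    show "UNIV = {0..} \<union> {..0::real}" by auto
  qed (use 1 in \<open>auto simp del: of_nat_Suc\<close>)
  moreover have "(\<lambda>s::real. if s \<in> {0..} then s ^ Suc (Suc m) else 0) = (\<lambda>s. max 0 s ^ Suc (Suc m))"
    by (auto simp: max_def fun_eq_iff)
  moreover have "(if s \<in> {0..} then real (Suc (Suc m)) * s ^ Suc m else 0) = real (Suc (Suc m)) * max 0 s ^ Suc m"
    by (auto simp: max_def)
  ultimately show ?thesis
    by (simp add: has_real_derivative_iff_has_vector_derivative del: power_Suc of_nat_Suc)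
qed

text \<open>The case \<open>m = 2\<close> is the C^2 cube from which the densities concentrated next
  to \<open>k\<close> are built.\<close>

lemma Ck_open_max_power: "Ck_open m UNIV (\<lambda>s::real. max 0 s ^ Suc m)"
proof (induction m)
  case 0
  show ?case by (auto intro!: continuous_intros)
next
  case (Suc m)
  then show ?case
    by (intro Ck_open_real_fun[OF has_derivative_max_power] Ck_open_mult) auto
qed

section \<open>Finiteness of surface measure\<close>

text \<open>One bound \<open>B\<close> serves every \<delta>, hence it survives the supremum over
  \<delta> in \<open>hausdorff_outer\<close>. Finite families instead of sequences make unions of
  coverings elementary.\<close>

definition finitely_covered :: "nat \<Rightarrow> real \<Rightarrow> 'a::metric_space set \<Rightarrow> bool" where
  "finitely_covered m B A \<longleftrightarrow> (\<forall>\<delta>>0. \<exists>\<C>. finite \<C> \<and> A \<subseteq> \<Union>\<C> \<and>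
     (\<forall>C\<in>\<C>. bounded C \<and> diameter C \<le> \<delta>) \<and> (\<Sum>C\<in>\<C>. hausdorff_weight m C) \<le> ennreal B)"

lemma hausdorff_outer_le:
  fixes A :: "'a::metric_space set"
  assumes "finitely_covered m B A"
  shows "hausdorff_outer m A \<le> ennreal B"
  unfolding hausdorff_outer_def
proof (rule SUP_least)
  fix \<delta> :: real assume "\<delta> \<in> {0<..}"
  then obtain \<C> where \<C>: "finite \<C>" "A \<subseteq> \<Union>\<C>" "\<And>C. C \<in> \<C> \<Longrightarrow> bounded C \<and> diameter C \<le> \<delta>"
      "(\<Sum>C\<in>\<C>. hausdorff_weight m C) \<le> ennreal B" and "\<delta> > 0"
    using assms unfolding finitely_covered_def by (metis greaterThan_iff)
  obtain h where h: "bij_betw h {0..<card \<C>} \<C>" using ex_bij_betw_nat_finite[OF \<C>(1)] by blast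
  \<comment> \<open>The finite family becomes a sequence by padding with the empty set, whose weight
    is 0 even for \<open>m = 0\<close>.\<close>
  define C where "C n = (if n < card \<C> then h n else {})" for n
  have "A \<subseteq> (\<Union>n. C n)"
  proof
    fix x assume "x \<in> A"
    then obtain c where "c \<in> \<C>" "x \<in> c" using \<C>(2) by auto
    moreover then obtain n where "n < card \<C>" "h n = c"
      using bij_betw_imp_surj_on[OF h] by (metis atLeastLessThan_iff imageE)
    ultimately show "x \<in> (\<Union>n. C n)" by (auto simp: C_def)
  qed
  moreover have "bounded (C n) \<and> diameter (C n) \<le> \<delta>" for n
    using \<C>(3)[of "h n"] bij_betwE[OF h] \<open>\<delta> > 0\<close> by (auto simp: C_def)
  ultimately have "hausdorff_premeasure m \<delta> A \<le> (\<Sum>n. hausdorff_weight m (C n))"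
    unfolding hausdorff_premeasure_def by (intro Inf_lower) auto
  also have "\<dots> = (\<Sum>n\<in>{0..<card \<C>}. hausdorff_weight m (C n))"
    by (rule suminf_finite) (auto simp: C_def hausdorff_weight_def)
  also have "\<dots> = (\<Sum>n\<in>{0..<card \<C>}. hausdorff_weight m (h n))"
    by (intro sum.cong) (auto simp: C_def)
  also have "\<dots> = (\<Sum>c\<in>\<C>. hausdorff_weight m c)"
    by (rule sum.reindex_bij_betw[OF h])
  finally show "hausdorff_premeasure m \<delta> A \<le> ennreal B" using \<C>(4) by order
qed

lemma finitely_covered_subset: "finitely_covered m B A \<Longrightarrow> A' \<subseteq> A \<Longrightarrow> finitely_covered m B A'"
  unfolding finitely_covered_def by (meson order_trans)

lemma finitely_covered_Un:
  assumes "finitely_covered m B A" "finitely_covered m B' A'" "0 \<le> B" "0 \<le> B'"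
  shows "finitely_covered m (B + B') (A \<union> A')"
  unfolding finitely_covered_def
proof (intro allI impI)
  fix \<delta> :: real assume "\<delta> > 0"
  obtain \<C> where \<C>: "finite \<C>" "A \<subseteq> \<Union>\<C>" "\<forall>C\<in>\<C>. bounded C \<and> diameter C \<le> \<delta>"
      "(\<Sum>C\<in>\<C>. hausdorff_weight m C) \<le> ennreal B"
    using assms(1) \<open>\<delta> > 0\<close> unfolding finitely_covered_def by meson
  obtain \<D> where \<D>: "finite \<D>" "A' \<subseteq> \<Union>\<D>" "\<forall>C\<in>\<D>. bounded C \<and> diameter C \<le> \<delta>"
      "(\<Sum>C\<in>\<D>. hausdorff_weight m C) \<le> ennreal B'"
    using assms(2) \<open>\<delta> > 0\<close> unfolding finitely_covered_def by meson
  have "(\<Sum>C\<in>\<C> \<union> \<D>. hausdorff_weight m C) \<le>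
      (\<Sum>C\<in>\<C> \<union> \<D>. hausdorff_weight m C) + (\<Sum>C\<in>\<C> \<inter> \<D>. hausdorff_weight m C)" by simp
  also have "\<dots> = (\<Sum>C\<in>\<C>. hausdorff_weight m C) + (\<Sum>C\<in>\<D>. hausdorff_weight m C)"
    using \<C>(1) \<D>(1) by (rule sum.union_inter)
  also have "\<dots> \<le> ennreal (B + B')"
    using \<C>(4) \<D>(4) assms(3,4) by (simp add: add_mono)
  finally show "\<exists>\<C>. finite \<C> \<and> A \<union> A' \<subseteq> \<Union>\<C> \<and> (\<forall>C\<in>\<C>. bounded C \<and> diameter C \<le> \<delta>) \<and>
      (\<Sum>C\<in>\<C>. hausdorff_weight m C) \<le> ennreal (B + B')"
    using \<C> \<D> by (intro exI[of _ "\<C> \<union> \<D>"]) auto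
qed

lemma finitely_covered_UN:
  assumes "finite I" "\<And>i. i \<in> I \<Longrightarrow> \<exists>B\<ge>0. finitely_covered m B (S i)"
  shows "\<exists>B\<ge>0. finitely_covered m B (\<Union>i\<in>I. S i)"
  using assms
proof (induction I rule: finite_induct)
  case empty
  have "finitely_covered m 0 {}" unfolding finitely_covered_def by (auto intro!: exI[of _ "{}"])
  then show ?case by auto
next
  case (insert i I)
  then obtain B B' where "B \<ge> 0" "finitely_covered m B (S i)" "B' \<ge> 0" "finitely_covered m B' (\<Union>i\<in>I. S i)"
    by (metis insertI1 insertI2)
  then show ?case using finitely_covered_Un[of m B "S i" B'] by (intro exI[of _ "B + B'"]) auto
qed

section \<open>Coverings of Lipschitz graphs\<close>

lemma sum_abs_split_coordinate:
  fixes x :: "real^'n"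
  shows "(\<Sum>j\<in>UNIV. \<bar>x $ j\<bar>) = \<bar>x $ i\<bar> + (\<Sum>j\<in>UNIV - {i}. \<bar>x $ j\<bar>)"
  by (simp add: sum.remove[of UNIV i])

text \<open>Cutting the parameter cube of side \<open>2 r\<close> into \<open>n\<^sup>N\<^sup>-\<^sup>1\<close> cells of side \<open>2 r / n\<close> cuts the graph
  into as many pieces of diameter \<open>O(1 / n)\<close>.\<close>

lemma finitely_covered_Lipschitz_graph:
  fixes S :: "(real^'n) set"
  assumes bd: "\<And>x j. x \<in> S \<Longrightarrow> \<bar>x $ j - p $ j\<bar> \<le> r" and "r > 0" "L \<ge> 0"
    and lip: "\<And>x y. x \<in> S \<Longrightarrow> y \<in> S \<Longrightarrow> \<bar>x $ i - y $ i\<bar> \<le> L * (\<Sum>j\<in>UNIV - {i}. \<bar>x $ j - y $ j\<bar>)"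
  shows "\<exists>B\<ge>0. finitely_covered (CARD('n) - 1) B S"
proof -
  define m where "m = CARD('n) - 1"
  \<comment> \<open>Bound the norm by the sum of the coordinates: the coordinate \<open>i\<close>
    costs at most \<open>L\<close> times the others, and each of the others, fewer than
    \<open>CARD('n')\<close>, contributes at most the cell side \<open>h\<close>. Hence a piece has
    diameter at most \<open>D * h\<close>.\<close>
  define D where "D = (1 + L) * CARD('n)"
  have D: "D > 0" using assms by (simp add: D_def)
  \<comment> \<open>There are at most \<open>(n + 1) ^ m\<close> pieces of diameter at most
    \<open>D * h = 2 * D * r / n\<close>, and \<open>(n + 1) * (D * h / 2) <= 2 * D * r\<close>
    because \<open>(n + 1) / n <= 2\<close>.\<close>
  define B where "B = unit_ball_vol (real m) * (2 * D * r) ^ m"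
  have "B \<ge> 0" using D assms by (simp add: B_def)
  have "finitely_covered m B S"
    unfolding finitely_covered_def
  proof (intro allI impI)
    fix \<delta> :: real assume "\<delta> > 0"
    obtain n0 where n0: "real n0 > D * (2 * r) / \<delta>" using reals_Archimedean2 by blast
    define n where "n = Suc n0"
    have n: "n > 0" "real n > D * (2 * r) / \<delta>" using n0 by (auto simp: n_def)
    define h where "h = 2 * r / n"
    have h: "h > 0" using n assms by (simp add: h_def)
    have Dh: "D * h \<le> \<delta>" using n \<open>\<delta> > 0\<close> by (simp add: h_def field_simps)
    define idx where "idx x j = nat \<lfloor>(x $ j - p $ j + r) / h\<rfloor>" for x :: "real^'n" and j
    define cell where "cell q = {x \<in> S. \<forall>j. j \<noteq> i \<longrightarrow> idx x j = q j}" for q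
    \<comment> \<open>Indices run up to \<open>n\<close> inclusive: a point on the far face, with
      \<open>x $ j - p $ j = r\<close>, has index \<open>n\<close>. Hence \<open>Suc n\<close>
      rather than \<open>n\<close> in the count.\<close>
    define P where "P = (UNIV - {i}) \<rightarrow>\<^sub>E {..n}"
    have cardP: "card P = Suc n ^ m" unfolding P_def by (subst card_PiE) (auto simp: m_def card_Diff_singleton)
    have finP: "finite P" unfolding P_def by (intro finite_PiE) auto
    have dist_le: "norm (x - y) \<le> D * h" if "x \<in> cell q" "y \<in> cell q" for x y q
    proof -
      have xy: "x \<in> S" "y \<in> S" using that by (auto simp: cell_def)
      have j: "\<bar>x $ j - y $ j\<bar> \<le> h" if "j \<noteq> i" for j
      proof -
        have pos: "(x $ j - p $ j + r) / h \<ge> 0" "(y $ j - p $ j + r) / h \<ge> 0"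
          using bd[OF xy(1), of j] bd[OF xy(2), of j] h by auto
        have "idx x j = idx y j" using \<open>x \<in> cell q\<close> \<open>y \<in> cell q\<close> that by (auto simp: cell_def)
        then have "\<lfloor>(x $ j - p $ j + r) / h\<rfloor> = \<lfloor>(y $ j - p $ j + r) / h\<rfloor>"
          using pos by (simp add: idx_def nat_eq_iff)
        then have "\<bar>(x $ j - p $ j + r) / h - (y $ j - p $ j + r) / h\<bar> \<le> 1" by linarith
        also have "(x $ j - p $ j + r) / h - (y $ j - p $ j + r) / h = (x $ j - y $ j) / h"
          by (simp add: diff_divide_distrib[symmetric])
        finally show ?thesis using h by (simp add: abs_divide)
      qed
      have "norm (x - y) \<le> (\<Sum>j\<in>UNIV. \<bar>(x - y) $ j\<bar>)" by (rule norm_le_l1_cart)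
      also have "\<dots> = \<bar>x $ i - y $ i\<bar> + (\<Sum>j\<in>UNIV - {i}. \<bar>x $ j - y $ j\<bar>)"
        using sum_abs_split_coordinate[of "x - y" i] by simp
      also have "\<dots> \<le> (1 + L) * (\<Sum>j\<in>UNIV - {i}. \<bar>x $ j - y $ j\<bar>)"
        using lip[OF xy] by (simp add: algebra_simps)
      also have "\<dots> \<le> (1 + L) * (\<Sum>j\<in>UNIV - {i}. h)"
        using j assms by (intro mult_left_mono sum_mono) auto
      also have "\<dots> \<le> (1 + L) * (CARD('n) * h)"
        using assms h by (intro mult_left_mono) (auto simp: card_Diff_singleton)
      finally show ?thesis by (simp add: D_def)
    qed
    have idx_le: "idx x j \<le> n" if "x \<in> S" for x j
    proof -
      have "x $ j - p $ j + r \<le> 2 * r" using bd[OF that, of j] by auto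
      then have "(x $ j - p $ j + r) / h \<le> 2 * r / h" using h by (intro divide_right_mono) auto
      also have "2 * r / h = n" using n assms by (simp add: h_def)
      finally have "(x $ j - p $ j + r) / h \<le> n" .
      then have "\<lfloor>(x $ j - p $ j + r) / h\<rfloor> \<le> int n" by linarith
      then show ?thesis by (simp add: idx_def)
    qed
    have cov: "S \<subseteq> \<Union>(cell ` P)"
    proof
      fix x assume "x \<in> S"
      then have "x \<in> cell (restrict (idx x) (UNIV - {i}))" "restrict (idx x) (UNIV - {i}) \<in> P"
        using idx_le by (auto simp: cell_def P_def)
      then show "x \<in> \<Union>(cell ` P)" by blast
    qed
    have diam: "diameter (cell q) \<le> D * h" for q
      using dist_le D h by (intro diameter_le) auto
    have bdd: "bounded (cell q)" for q
    proof (cases "cell q = {}")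
      case False
      then obtain y where "y \<in> cell q" by auto
      then show ?thesis using dist_le[of _ q y]
        by (auto simp: bounded_any_center[of _ y] dist_norm norm_minus_commute)
    qed simp
    define w where "w = unit_ball_vol (real m) * (D * h / 2) ^ m"
    have w: "hausdorff_weight m (cell q) \<le> ennreal w" for q
      unfolding hausdorff_weight_def w_def using diam[of q] diameter_ge_0[OF bdd[of q]]
      by (auto intro!: ennreal_leI mult_left_mono power_mono)
    have w0: "w \<ge> 0" using D h by (auto simp: w_def)
    have "(\<Sum>C\<in>cell ` P. hausdorff_weight m C) \<le> (\<Sum>C\<in>cell ` P. ennreal w)"
      using w by (intro sum_mono) auto
    also have "\<dots> = ennreal (real (card (cell ` P)) * w)"
      by (simp add: ennreal_mult' ennreal_of_nat_eq_real_of_nat)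
    also have "\<dots> \<le> ennreal (real (Suc n ^ m) * w)"
      using card_image_le[OF finP, of cell] w0 by (intro ennreal_leI mult_right_mono) (auto simp: cardP simp del: of_nat_power power_Suc)
    also have "real (Suc n ^ m) * w = unit_ball_vol (real m) * (real (Suc n) * (D * h / 2)) ^ m"
      by (simp only: w_def power_mult_distrib of_nat_power mult_ac)
    also have "\<dots> \<le> B"
      unfolding B_def
    proof (intro mult_left_mono power_mono)
      have "real (Suc n) * (D * h / 2) = D * r * (real (Suc n) / real n)" using n by (simp add: h_def)
      also have "\<dots> \<le> D * r * 2" using n D assms by (intro mult_left_mono) (auto simp: field_simps)
      finally show "real (Suc n) * (D * h / 2) \<le> 2 * D * r" by simp
    qed (use D h in auto)
    finally have "(\<Sum>C\<in>cell ` P. hausdorff_weight m C) \<le> ennreal B" using ennreal_leI by blast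
    then show "\<exists>\<C>. finite \<C> \<and> S \<subseteq> \<Union>\<C> \<and> (\<forall>C\<in>\<C>. bounded C \<and> diameter C \<le> \<delta>) \<and>
        (\<Sum>C\<in>\<C>. hausdorff_weight m C) \<le> ennreal B"
      using finP cov bdd diam Dh by (intro exI[of _ "cell ` P"]) (auto intro: order_trans)
  qed
  then show ?thesis using \<open>B \<ge> 0\<close> by (auto simp: m_def)
qed

section \<open>The boundary as a finite union of Lipschitz graphs\<close>

lemma Ck_on_UNIV: "Ck_on k UNIV g \<longleftrightarrow> Ck_open k UNIV g"
proof
  assume "Ck_on k UNIV g"
  then obtain V h where h: "UNIV \<subseteq> V" "Ck_open k V h" "\<forall>p. h p = g p" by (auto simp: Ck_on_def)
  then have "h = g" "V = UNIV" by auto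
  then show "Ck_open k UNIV g" using h by simp
qed (auto simp: Ck_on_def)

lemma Ck_open_Suc_Lipschitz:
  assumes "Ck_open (Suc k) UNIV g" "compact S" "convex S"
  shows "\<exists>L\<ge>0. \<forall>x\<in>S. \<forall>y\<in>S. norm (g x - g y) \<le> L * norm (x - y)"
proof -
  obtain g' where g': "\<And>p. (g has_derivative g' p) (at p)" "\<And>v. continuous_on UNIV (\<lambda>p. g' p v)"
    using assms(1) by (auto dest: Ck_open_imp_continuous_on)
  have "continuous_on S (\<lambda>p. \<Sum>b\<in>Basis. norm (g' p b))"
    by (intro continuous_intros continuous_on_subset[OF g'(2)]) auto
  then have "bounded ((\<lambda>p. \<Sum>b\<in>Basis. norm (g' p b)) ` S)"
    using assms(2) compact_continuous_image compact_imp_bounded by blast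
  then obtain L where L: "L > 0" "\<And>p. p \<in> S \<Longrightarrow> (\<Sum>b\<in>Basis. norm (g' p b)) \<le> L"
    unfolding bounded_pos by (auto intro: order_trans[OF abs_ge_self])
  have "onorm (g' p) \<le> L" if "p \<in> S" for p
    using onorm_componentwise[OF has_derivative_bounded_linear[OF g'(1)], of p] L(2)[OF that] by linarith
  then have "norm (g x - g y) \<le> L * norm (x - y)" if "x \<in> S" "y \<in> S" for x y
    using differentiable_bound[OF assms(3), of g g' L x y] g'(1) that
    by (auto intro: has_derivative_at_withinI)
  then show ?thesis using L(1) by (intro exI[of _ L]) auto
qed

text \<open>Off the graph there are two cases. Above it the point lies in the open set \<Omega>
  itself; below it a whole neighbourhood misses \<Omega>, so the point is not in the closure.
  Neither can happen on the frontier.\<close>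

lemma frontier_subset_graph:
  fixes \<gamma> :: "real^'n \<Rightarrow> real"
  assumes "open \<Omega>" "\<Omega> \<inter> ball p r = {x \<in> ball p r. s * x $ i > \<gamma> x}" "continuous_on UNIV \<gamma>"
    "x \<in> frontier \<Omega>" "x \<in> ball p r"
  shows "s * x $ i = \<gamma> x"
proof (rule ccontr)
  assume ne: "s * x $ i \<noteq> \<gamma> x"
  have "x \<notin> \<Omega>" using assms(1,4) by (simp add: frontier_def interior_open)
  then have less: "s * x $ i < \<gamma> x" using assms(2,5) ne by fastforce
  have "open {y. s * y $ i < \<gamma> y}"
    by (intro open_Collect_less continuous_intros assms(3))
  then have "open ({y. s * y $ i < \<gamma> y} \<inter> ball p r)" by auto
  moreover have "y \<notin> \<Omega>" if "s * y $ i < \<gamma> y" "y \<in> ball p r" for y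
    using that assms(2) by (metis (mono_tags, lifting) IntI less_asym mem_Collect_eq)
  then have "({y. s * y $ i < \<gamma> y} \<inter> ball p r) \<inter> \<Omega> = {}" by blast
  ultimately have "({y. s * y $ i < \<gamma> y} \<inter> ball p r) \<inter> closure \<Omega> = {}"
    using open_Int_closure_eq_empty by blast
  then show False using less assms(4,5) by (auto simp: frontier_def)
qed

lemma frontier_finitely_covered_locally:
  fixes \<Omega> :: "(real^'n) set"
  assumes "open \<Omega>" "smooth_boundary \<Omega>" "p \<in> frontier \<Omega>"
  shows "\<exists>r>0. \<exists>B\<ge>0. finitely_covered (CARD('n) - 1) B (frontier \<Omega> \<inter> ball p r)"
proof -
  obtain r i s \<gamma> where r: "r > 0" and s: "s \<in> {-1, 1::real}" and sm: "\<And>k. Ck_on k UNIV \<gamma>"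
    and ign: "\<And>x y. (\<forall>j. j \<noteq> i \<longrightarrow> x $ j = y $ j) \<Longrightarrow> \<gamma> x = \<gamma> y"
    and eq: "\<Omega> \<inter> ball p r = {x \<in> ball p r. s * x $ i > \<gamma> x}"
    using assms(2,3) unfolding smooth_boundary_def by meson
  have C1: "Ck_open (Suc 0) UNIV \<gamma>" using sm Ck_on_UNIV by blast
  \<comment> \<open>The enlarged radius accommodates points that mix coordinates of two points of
    the ball: these are only coordinatewise within \<open>r\<close> of \<open>p\<close>, hence
    within \<open>CARD('n') * r\<close> in norm.\<close>
  obtain L where L: "L \<ge> 0" "\<And>x y. x \<in> cball p (CARD('n) * r) \<Longrightarrow> y \<in> cball p (CARD('n) * r) \<Longrightarrow>
      norm (\<gamma> x - \<gamma> y) \<le> L * norm (x - y)"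
    using Ck_open_Suc_Lipschitz[OF C1 compact_cball convex_cball] by metis
  let ?S = "frontier \<Omega> \<inter> ball p r"
  have graph: "x $ i = s * \<gamma> x" if "x \<in> ?S" for x
    using frontier_subset_graph[OF assms(1) eq Ck_open_imp_continuous_on[OF C1], of x] that s by auto
  have bd: "\<bar>x $ j - p $ j\<bar> \<le> r" if "x \<in> ?S" for x j
    using component_le_norm_cart[of "x - p" j] that by (auto simp: dist_norm norm_minus_commute)
  have incball: "z \<in> cball p (CARD('n) * r)" if "\<And>j. \<bar>z $ j - p $ j\<bar> \<le> r" for z
  proof -
    have "norm (z - p) \<le> (\<Sum>j\<in>UNIV. \<bar>(z - p) $ j\<bar>)" by (rule norm_le_l1_cart)
    also have "\<dots> \<le> (\<Sum>j\<in>(UNIV::'n set). r)" using that by (intro sum_mono) auto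
    finally show ?thesis by (simp add: dist_norm norm_minus_commute)
  qed
  have "\<bar>x $ i - y $ i\<bar> \<le> L * (\<Sum>j\<in>UNIV - {i}. \<bar>x $ j - y $ j\<bar>)" if "x \<in> ?S" "y \<in> ?S" for x y
  proof -
    \<comment> \<open>As \<gamma> ignores the coordinate \<open>i\<close>, it takes the same value
      at \<open>y\<close> and \<open>z\<close>; but \<open>x - z\<close> has no component
      \<open>i\<close>, so that coordinate drops out of the Lipschitz estimate.\<close>
    define z where "z = (\<chi> j. if j = i then x $ i else y $ j)"
    have "\<bar>x $ i - y $ i\<bar> = \<bar>\<gamma> x - \<gamma> y\<bar>" using graph[OF that(1)] graph[OF that(2)] s by auto
    also have "\<gamma> y = \<gamma> z" by (rule ign) (auto simp: z_def)
    also have "\<bar>\<gamma> x - \<gamma> z\<bar> \<le> L * norm (x - z)"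
      using L(2)[of x z] incball[of x] incball[of z] bd that by (auto simp: z_def)
    also have "norm (x - z) \<le> (\<Sum>j\<in>UNIV. \<bar>(x - z) $ j\<bar>)" by (rule norm_le_l1_cart)
    also have "\<dots> = (\<Sum>j\<in>UNIV - {i}. \<bar>x $ j - y $ j\<bar>)"
      using sum_abs_split_coordinate[of "x - z" i] by (simp add: z_def)
    finally show ?thesis using L(1) by (simp add: mult_left_mono)
  qed
  from finitely_covered_Lipschitz_graph[OF bd r L(1) this] show ?thesis using r by blast
qed

lemma frontier_finitely_covered:
  fixes \<Omega> :: "(real^'n) set"
  assumes "open \<Omega>" "bounded \<Omega>" "smooth_boundary \<Omega>"
  shows "\<exists>B\<ge>0. finitely_covered (CARD('n) - 1) B (frontier \<Omega>)"
proof -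
  obtain r where r: "\<And>p. p \<in> frontier \<Omega> \<Longrightarrow> r p > 0 \<and>
      (\<exists>B\<ge>0. finitely_covered (CARD('n) - 1) B (frontier \<Omega> \<inter> ball p (r p)))"
    using frontier_finitely_covered_locally[OF assms(1,3)] by metis
  have "compact (frontier \<Omega>)" using assms(2) by (rule compact_frontier_bounded)
  then obtain P where P: "P \<subseteq> frontier \<Omega>" "finite P" "frontier \<Omega> \<subseteq> (\<Union>p\<in>P. ball p (r p))"
    by (rule compactE_image[of _ "frontier \<Omega>" "\<lambda>p. ball p (r p)"]) (use r in force)+
  have "\<exists>B\<ge>0. finitely_covered (CARD('n) - 1) B (\<Union>p\<in>P. frontier \<Omega> \<inter> ball p (r p))"
    using P r by (intro finitely_covered_UN) auto
  moreover have "frontier \<Omega> \<subseteq> (\<Union>p\<in>P. frontier \<Omega> \<inter> ball p (r p))" using P(3) by auto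
  ultimately show ?thesis using finitely_covered_subset by blast
qed

text \<open>No measurability theory for the outer measure is needed here: \<^const>\<open>measure_of\<close> is
  either the given set function or zero.\<close>

lemma finite_measure_surface_measure:
  fixes \<Omega> :: "(real^'n) set"
  assumes "open \<Omega>" "bounded \<Omega>" "smooth_boundary \<Omega>"
  shows "finite_measure (surface_measure \<Omega>)"
proof
  obtain B where "finitely_covered (CARD('n) - 1) B (frontier \<Omega>)"
    using frontier_finitely_covered[OF assms] by blast
  then have "hausdorff_outer (CARD('n) - 1) (frontier \<Omega>) < \<infinity>"
    using hausdorff_outer_le ennreal_less_top order_le_less_trans by (metis infinity_ennreal_def)
  moreover have "emeasure (hausdorff_measure (CARD('n) - 1)) (frontier \<Omega>) \<le> hausdorff_outer (CARD('n) - 1) (frontier \<Omega>)"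
    unfolding hausdorff_measure_def by (auto simp: emeasure_measure_of_conv)
  moreover have "frontier \<Omega> \<inter> space (hausdorff_measure (CARD('n) - 1)) \<in> sets (hausdorff_measure (CARD('n) - 1))"
    by (simp add: hausdorff_measure_def sigma_algebra.sigma_sets_eq[OF sets.sigma_algebra_axioms[of borel, simplified]])
  ultimately show "emeasure (surface_measure \<Omega>) (space (surface_measure \<Omega>)) \<noteq> \<infinity>"
    unfolding surface_measure_def
    by (simp add: emeasure_restrict_space space_restrict_space hausdorff_measure_def)
qed

lemma sets_surface_measure: "sets (surface_measure \<Omega>) = sets (restrict_space borel (frontier \<Omega>))"
  unfolding surface_measure_def hausdorff_measure_def
  by (rule sets_restrict_space_cong)
    (simp add: sigma_algebra.sigma_sets_eq[OF sets.sigma_algebra_axioms[of borel, simplified]])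

lemma finite_measure_lateral_measure:
  fixes \<Omega> :: "(real^'n) set"
  assumes "open \<Omega>" "bounded \<Omega>" "smooth_boundary \<Omega>"
  shows "finite_measure (lateral_measure T \<Omega>)"
proof -
  have "finite_measure (restrict_space lborel {0..T})"
    by (rule finite_measureI) (simp add: emeasure_restrict_space space_restrict_space emeasure_lborel_Icc_eq)
  then have *: "finite_measure (restrict_space lborel {0..T} \<Otimes>\<^sub>M surface_measure \<Omega>)"
    by (intro finite_measure_pair_measure finite_measure_surface_measure[OF assms])
  show ?thesis
    unfolding lateral_measure_def
    by (rule finite_measureI) (use finite_measure.emeasure_finite[OF *] in \<open>simp add: emeasure_completion\<close>)
qed

section \<open>The kinetic kernel\<close>

text \<open>On a complete measure space an integral is unchanged by almost everywhere modifications,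
  whether or not the integrand is measurable. This lets data be truncated inside the balances
  without any inspection of the integrands.\<close>

lemma complete_measure_lebesgue_on:
  assumes "S \<in> sets lebesgue"
  shows "complete_measure (lebesgue_on S)"
proof
  fix A B assume "B \<subseteq> A" "A \<in> null_sets (lebesgue_on S)"
  then have "A \<subseteq> S" "A \<in> null_sets lebesgue" using assms by (auto simp: null_sets_restrict_space)
  then have "B \<subseteq> S" "B \<in> null_sets lebesgue"
    using \<open>B \<subseteq> A\<close> completion.complete2 by auto
  then show "B \<in> sets (lebesgue_on S)"
    using assms by (auto simp: sets_restrict_space_iff)
qed

lemma (in complete_measure) borel_measurable_AE_cong:
  fixes f g :: "'a \<Rightarrow> 'b::topological_space"
  assumes "AE p in M. f p = g p" "f \<in> borel_measurable M"
  shows "g \<in> borel_measurable M"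
proof (rule measurableI)
  fix A :: "'b set" assume "A \<in> sets borel"
  then have "f -` A \<inter> space M \<in> sets M" using assms(2) by (rule measurable_sets[rotated])
  then show "g -` A \<inter> space M \<in> sets M"
    by (rule in_sets_AE[rotated]) (use assms(1) in \<open>auto elim!: eventually_mono\<close>)
qed simp

text \<open>If neither side is measurable, both integrals are zero.\<close>

lemma (in complete_measure) integral_cong_AE_complete:
  fixes f g :: "'a \<Rightarrow> 'b::{banach, second_countable_topology}"
  assumes "AE p in M. f p = g p"
  shows "integral\<^sup>L M f = integral\<^sup>L M g"
proof (cases "f \<in> borel_measurable M")
  case True
  then show ?thesis using assms borel_measurable_AE_cong integral_cong_AE by blast
next
  case False
  have "AE p in M. g p = f p" using assms by (auto elim!: eventually_mono)
  then have "g \<notin> borel_measurable M" using False borel_measurable_AE_cong by blast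
  then show ?thesis using False borel_measurable_integrable not_integrable_integral_eq by metis
qed

text \<open>The signed indicator of the oriented interval from \<open>k\<close> to \<open>z\<close>, as a function of \<open>c\<close>.\<close>

definition kernel :: "real \<Rightarrow> real \<Rightarrow> real \<Rightarrow> real" where
  "kernel k z c = (if c > k then sgn_plus (z - c) else sgn_minus (z - c))"

lemma abs_kernel_le: "\<bar>kernel k z c\<bar> \<le> 1"
  by (simp add: kernel_def sgn_plus_def sgn_minus_def)

text \<open>Parametrising the oriented segment from \<open>k\<close> to \<open>z\<close> by [0, 1]
  covers both orders of \<open>k\<close> and \<open>z\<close> at once and leaves the end points only
  in the integrand, where they can be differentiated.\<close>

lemma has_integral_segment_FTC:
  fixes G :: "real \<Rightarrow> 'b::banach"
  assumes "\<And>c. c \<in> {-R..R} \<Longrightarrow> (G has_vector_derivative g c) (at c within {-R..R})"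
    and "k \<in> {-R..R}" "z \<in> {-R..R}"
  shows "((\<lambda>r. (z - k) *\<^sub>R g (k + r * (z - k))) has_integral G z - G k) {0..1}"
proof -
  have conv: "k + r * (z - k) \<in> {-R..R}" if "r \<in> {0..1}" for r
  proof -
    have "(1 - r) *\<^sub>R k + r *\<^sub>R z \<in> {-R..R}"
      using assms(2,3) that by (intro convexD[OF convex_real_interval(5)]) auto
    then show ?thesis by (simp add: algebra_simps)
  qed
  have "((G \<circ> (\<lambda>r. k + r * (z - k))) has_vector_derivative (z - k) *\<^sub>R g (k + r * (z - k))) (at r within {0..1})"
    if "r \<in> {0..1}" for r
  proof (rule vector_diff_chain_within)
    show "((\<lambda>r. k + r * (z - k)) has_vector_derivative z - k) (at r within {0..1})"
      by (auto intro!: derivative_eq_intros simp: has_real_derivative_iff_has_vector_derivative[symmetric])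
    show "(G has_vector_derivative g (k + r * (z - k))) (at (k + r * (z - k)) within (\<lambda>r. k + r * (z - k)) ` {0..1})"
      by (rule has_vector_derivative_within_subset[OF assms(1)[OF conv[OF that]]]) (use conv in blast)
  qed
  from fundamental_theorem_of_calculus[OF _ this] show ?thesis by simp
qed

text \<open>Up to the two end points, a null set, the kernel is 1 on the interval from
  \<open>k\<close> to \<open>z\<close> if \<open>k <= z\<close> and -1 on the interval from
  \<open>z\<close> to \<open>k\<close> otherwise. Both cases are the fundamental theorem of
  calculus.\<close>

lemma kernel_integral_FTC:
  fixes R :: real and G g :: "real \<Rightarrow> real"
  defines "N \<equiv> restrict_space lborel {-R..R}"
  assumes der: "\<And>c. c \<in> {-R..R} \<Longrightarrow> (G has_real_derivative g c) (at c within {-R..R})"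
    and cont: "continuous_on {-R..R} g"
    and kz: "k \<in> {-R..R}" "z \<in> {-R..R}"
  shows "(LINT c|N. kernel k z c * g c) = G z - G k"
proof -
  have ind: "(\<lambda>c. indicator {-R..R} c * g c) \<in> borel_measurable borel"
    using borel_measurable_continuous_on_indicator[OF _ cont] by simp
  have sub: "{a..b} \<subseteq> {-R..R}" if "a \<in> {-R..R}" "b \<in> {-R..R}" for a b using that by auto
  have FTC: "(LINT c|lborel. indicator {a..b} c * g c) = G b - G a"
    if "a \<le> b" "a \<in> {-R..R}" "b \<in> {-R..R}" for a b
    using integral_FTC_Icc[of a b G g] that continuous_on_subset[OF cont sub[OF that(2,3)]]
      has_vector_derivative_within_subset[OF _ sub[OF that(2,3)], of G] der
    by (auto simp: has_real_derivative_iff_has_vector_derivative)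
  have meas: "(\<lambda>c. indicator {a..b} c * g c) \<in> borel_measurable borel"
    if "a \<in> {-R..R}" "b \<in> {-R..R}" for a b
    using borel_measurable_continuous_on_indicator[OF _ continuous_on_subset[OF cont sub[OF that]]] by simp
  have "(LINT c|N. kernel k z c * g c) = (LINT c|lborel. indicator {-R..R} c *\<^sub>R (kernel k z c * g c))"
    unfolding N_def by (rule integral_restrict_space) simp
  also have "\<dots> = (LINT c|lborel. kernel k z c * (indicator {-R..R} c * g c))"
    by (simp add: mult_ac)
  also have "\<dots> = G z - G k"
  proof (cases "k \<le> z")
    case True
    have "(LINT c|lborel. kernel k z c * (indicator {-R..R} c * g c)) = (LINT c|lborel. indicator {k..z} c * g c)"
    proof (rule integral_cong_AE)
      show "(\<lambda>c. kernel k z c * (indicator {-R..R} c * g c)) \<in> borel_measurable lborel"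
        using ind unfolding kernel_def sgn_plus_def sgn_minus_def by measurable
      show "(\<lambda>c. indicator {k..z} c * g c) \<in> borel_measurable lborel" using meas[OF kz] by simp
      show "AE c in lborel. kernel k z c * (indicator {-R..R} c * g c) = indicator {k..z} c * g c"
        using AE_lborel_singleton[of k] AE_lborel_singleton[of z]
        by eventually_elim (use True kz in \<open>auto simp: kernel_def sgn_plus_def sgn_minus_def indicator_def\<close>)
    qed
    then show ?thesis using FTC[OF True kz] by simp
  next
    case False
    have "(LINT c|lborel. kernel k z c * (indicator {-R..R} c * g c)) = (LINT c|lborel. - (indicator {z..k} c * g c))"
    proof (rule integral_cong_AE)
      show "(\<lambda>c. kernel k z c * (indicator {-R..R} c * g c)) \<in> borel_measurable lborel"
        using ind unfolding kernel_def sgn_plus_def sgn_minus_def by measurable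
      show "(\<lambda>c. - (indicator {z..k} c * g c)) \<in> borel_measurable lborel" using meas[OF kz(2,1)] by simp
      show "AE c in lborel. kernel k z c * (indicator {-R..R} c * g c) = - (indicator {z..k} c * g c)"
        using AE_lborel_singleton[of k] AE_lborel_singleton[of z]
        by eventually_elim (use False kz in \<open>auto simp: kernel_def sgn_plus_def sgn_minus_def indicator_def\<close>)
    qed
    then show ?thesis using FTC[of z k] kz False by simp
  qed
  finally show ?thesis .
qed

text \<open>The bridge between the Bochner integrals over levels that Fubini needs and the integrals
  over [0, 1] that can be differentiated in \<open>x\<close>: both are the increment of the same
  primitive.\<close>

lemma kernel_integral_segment:
  fixes R :: real and g :: "real \<Rightarrow> real"
  defines "N \<equiv> restrict_space lborel {-R..R}"
  assumes cont: "continuous_on {-R..R} g" and kz: "k \<in> {-R..R}" "z \<in> {-R..R}"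
  shows "(LINT c|N. kernel k z c * g c) = integral {0..1} (\<lambda>r. (z - k) * g (k + r * (z - k)))"
proof -
  obtain G where G: "\<And>c. c \<in> {-R..R} \<Longrightarrow> (G has_vector_derivative g c) (at c within {-R..R})"
    using antiderivative_continuous[OF cont] by metis
  have "(LINT c|N. kernel k z c * g c) = G z - G k"
    unfolding N_def
    by (rule kernel_integral_FTC) (use G cont kz in \<open>auto simp: has_real_derivative_iff_has_vector_derivative\<close>)
  moreover have "integral {0..1} (\<lambda>r. (z - k) * g (k + r * (z - k))) = G z - G k"
    using integral_unique[OF has_integral_segment_FTC[OF G kz]] by (simp only: real_scaleR_def)
  ultimately show ?thesis by simp
qed

lemma
  fixes R :: real and \<psi> :: "real \<Rightarrow> 'p \<Rightarrow> real" and z :: "'p \<Rightarrow> real"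
  defines "N \<equiv> restrict_space lborel {-R..R}"
  assumes M: "finite_measure M" and z: "z \<in> borel_measurable M"
    and meas: "case_prod \<psi> \<in> borel_measurable (N \<Otimes>\<^sub>M M)"
    and bound: "\<And>c p. c \<in> {-R..R} \<Longrightarrow> p \<in> space M \<Longrightarrow> \<bar>\<psi> c p\<bar> \<le> B"
    and a: "continuous_on {-R..R} a"
  shows integrable_kernel_integral:
      "integrable M (\<lambda>p. LINT c|N. a c * (kernel k (z p) c * \<psi> c p))"
    and integrable_integral_kernel:
      "integrable N (\<lambda>c. a c * (LINT p|M. kernel k (z p) c * \<psi> c p))"
    and integral_kernel_Fubini:
      "(LINT p|M. LINT c|N. a c * (kernel k (z p) c * \<psi> c p)) =
       (LINT c|N. a c * (LINT p|M. kernel k (z p) c * \<psi> c p))"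
proof -
  interpret M: finite_measure M by (rule M)
  interpret N: finite_measure N
    unfolding N_def by (rule finite_measureI) (simp add: emeasure_restrict_space space_restrict_space emeasure_lborel_Icc_eq)
  interpret pair_sigma_finite N M ..
  interpret NM: finite_measure "N \<Otimes>\<^sub>M M"
    by (rule finite_measure_pair_measure) unfold_locales
  have sN: "space N = {-R..R}" by (simp add: N_def space_restrict_space)
  have id: "(\<lambda>c. c) \<in> borel_measurable N"
    unfolding N_def by (rule measurable_restrict_space1) simp
  have aN: "a \<in> borel_measurable N"
    unfolding N_def using borel_measurable_continuous_on_restrict[OF a]
    by (simp add: measurable_def space_restrict_space sets_restrict_space)
  have "bounded (a ` {-R..R})"
    using a compact_continuous_image compact_imp_bounded by blast
  then obtain A where A: "A > 0" "\<And>c. c \<in> {-R..R} \<Longrightarrow> \<bar>a c\<bar> \<le> A"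
    unfolding bounded_pos by auto
  let ?f = "\<lambda>c p. a c * (kernel k (z p) c * \<psi> c p)"
  have "integrable (N \<Otimes>\<^sub>M M) (case_prod ?f)"
  proof (rule NM.integrable_const_bound[of _ "A * (1 * B)"])
    show "AE q in N \<Otimes>\<^sub>M M. norm (case_prod ?f q) \<le> A * (1 * B)"
    proof (rule AE_I2, clarify)
      fix c p assume "(c, p) \<in> space (N \<Otimes>\<^sub>M M)"
      then have "c \<in> {-R..R}" "p \<in> space M" using sN by (auto simp: space_pair_measure)
      then show "norm (?f c p) \<le> A * (1 * B)"
        unfolding real_norm_def abs_mult using A bound abs_kernel_le
        by (intro mult_mono) (auto intro: order_trans[OF abs_ge_zero])
    qed
    have [measurable]: "a \<in> borel_measurable N" "z \<in> borel_measurable M" "case_prod \<psi> \<in> borel_measurable (N \<Otimes>\<^sub>M M)"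
      "(\<lambda>c. c) \<in> borel_measurable N"
      using aN z meas id by auto
    have [measurable]: "(\<lambda>q. fst q) \<in> borel_measurable (N \<Otimes>\<^sub>M M)"
      by (rule measurable_compose[OF measurable_fst id])
    have "(\<lambda>q. a (fst q) * (kernel k (z (snd q)) (fst q) * case_prod \<psi> q)) \<in> borel_measurable (N \<Otimes>\<^sub>M M)"
      unfolding kernel_def sgn_plus_def sgn_minus_def by measurable
    then show "case_prod ?f \<in> borel_measurable (N \<Otimes>\<^sub>M M)"
      by (simp add: case_prod_unfold)
  qed
  from integrable_fst'[OF this] integrable_snd[OF this] Fubini_integral[OF this]
  show "integrable M (\<lambda>p. LINT c|N. ?f c p)"
    "integrable N (\<lambda>c. a c * (LINT p|M. kernel k (z p) c * \<psi> c p))"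
    "(LINT p|M. LINT c|N. ?f c p) = (LINT c|N. a c * (LINT p|M. kernel k (z p) c * \<psi> c p))"
    by simp_all
qed

text \<open>Dominated convergence with a constant majorant on a finite measure. The levels stay
  strictly on the side that matches the sign; otherwise the limit would be wrong on the set where
  \<open>z p = k\<close>.\<close>

lemma kernel_integral_tendsto:
  fixes R :: real and \<psi> :: "real \<Rightarrow> 'p \<Rightarrow> real" and z :: "'p \<Rightarrow> real"
  defines "N \<equiv> restrict_space lborel {-R..R}"
  assumes M: "finite_measure M" and z: "z \<in> borel_measurable M"
    and meas: "case_prod \<psi> \<in> borel_measurable (N \<Otimes>\<^sub>M M)"
    and bound: "\<And>c p. c \<in> {-R..R} \<Longrightarrow> p \<in> space M \<Longrightarrow> \<bar>\<psi> c p\<bar> \<le> B"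
    and cont: "\<And>p. p \<in> space M \<Longrightarrow> continuous_on {-R..R} (\<lambda>c. \<psi> c p)"
    and X: "X \<longlonglongrightarrow> k" "\<And>n. X n \<in> {-R..R}" "k \<in> {-R..R}"
    and side: "sg = sgn_plus \<and> (\<forall>n. X n > k) \<or> sg = sgn_minus \<and> (\<forall>n. X n < k)"
  shows "(\<lambda>n. LINT p|M. kernel k (z p) (X n) * \<psi> (X n) p) \<longlonglongrightarrow> (LINT p|M. sg (z p - k) * \<psi> k p)"
proof (rule integral_dominated_convergence[where w = "\<lambda>_. B"])
  interpret M: finite_measure M by (rule M)
  have sN: "space N = {-R..R}" by (simp add: N_def space_restrict_space)
  have [measurable]: "\<psi> c \<in> borel_measurable M" if "c \<in> {-R..R}" for c
    using measurable_Pair2[OF meas, of c] that sN by simp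
  note [measurable] = z
  show "(\<lambda>p. sg (z p - k) * \<psi> k p) \<in> borel_measurable M"
    using side X by (elim disjE conjE) (simp_all add: sgn_plus_def sgn_minus_def)
  show "(\<lambda>p. kernel k (z p) (X n) * \<psi> (X n) p) \<in> borel_measurable M" for n
    using X unfolding kernel_def sgn_plus_def sgn_minus_def by simp
  show "integrable M (\<lambda>_. B)" by simp
  show "AE p in M. norm (kernel k (z p) (X n) * \<psi> (X n) p) \<le> B" for n
  proof (rule AE_I2)
    fix p assume "p \<in> space M"
    then have "norm (kernel k (z p) (X n) * \<psi> (X n) p) \<le> 1 * B"
      unfolding real_norm_def abs_mult using X bound abs_kernel_le by (intro mult_mono) auto
    then show "norm (kernel k (z p) (X n) * \<psi> (X n) p) \<le> B" by simp
  qed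
  show "AE p in M. (\<lambda>n. kernel k (z p) (X n) * \<psi> (X n) p) \<longlonglongrightarrow> sg (z p - k) * \<psi> k p"
  proof (intro AE_I2 tendsto_mult)
    fix p assume p: "p \<in> space M"
    show "(\<lambda>n. \<psi> (X n) p) \<longlonglongrightarrow> \<psi> k p"
      using continuous_on_tendsto_compose[OF cont[OF p] X(1) X(3)] X(2) by auto
    \<comment> \<open>The kernel is eventually constant. If \<open>z p = k\<close>, it is 0 on the
      chosen side; otherwise \<open>z p - X n\<close> has the sign of \<open>z p - k\<close> as soon
      as \<open>X n\<close> is closer to \<open>k\<close> than \<open>z p\<close> is.\<close>
    have "\<forall>\<^sub>F n in sequentially. kernel k (z p) (X n) = sg (z p - k)"
    proof (cases "z p = k")
      case True
      then show ?thesis using side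
        by (auto simp: kernel_def sgn_plus_def sgn_minus_def less_imp_not_less intro!: always_eventually)
    next
      case False
      then have "\<forall>\<^sub>F n in sequentially. dist (X n) k < \<bar>z p - k\<bar>"
        using X(1) by (intro tendstoD) auto
      then show ?thesis
      proof eventually_elim
        case (elim n)
        have "sg = sgn_plus \<and> X n > k \<or> sg = sgn_minus \<and> X n < k" using side by blast
        then show ?case using elim
          by (auto simp: kernel_def sgn_plus_def sgn_minus_def dist_real_def abs_if split: if_splits)
      qed
    qed
    then show "(\<lambda>n. kernel k (z p) (X n)) \<longlonglongrightarrow> sg (z p - k)" by (rule tendsto_eventually)
  qed
qed

section \<open>Admissible integrands\<close>

lemma Ck_on_SucE:
  assumes "Ck_on (Suc k) S g"
  obtains V h h' where "open V" "S \<subseteq> V" "\<And>q. q \<in> S \<Longrightarrow> h q = g q"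
    "\<And>q. q \<in> V \<Longrightarrow> (h has_derivative h' q) (at q)" "\<And>v. Ck_open k V (\<lambda>q. h' q v)"
proof -
  obtain V h g' where *: "open V" "S \<subseteq> V" "\<forall>q\<in>S. h q = g q"
    "\<forall>q\<in>V. (h has_derivative g' q) (at q)" "\<forall>v. Ck_open k V (\<lambda>q. g' q v)"
    using assms unfolding Ck_on_def by auto
  show thesis by (rule that[of V h g']) (use * in auto)
qed

text \<open>Joint measurability and the uniform bound are for Fubini, continuity in the level
  \<open>c\<close> is for the passage to the limit \<open>c -> k\<close>. The class is closed under
  the operations that build the MV-integrands.\<close>

definition admissible :: "real \<Rightarrow> 'p measure \<Rightarrow> (real \<Rightarrow> 'p \<Rightarrow> 'b::euclidean_space) \<Rightarrow> bool" where
  "admissible R M \<psi> \<longleftrightarrow>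
     case_prod \<psi> \<in> borel_measurable (restrict_space lborel {-R..R} \<Otimes>\<^sub>M M) \<and>
     (\<exists>B. \<forall>c\<in>{-R..R}. \<forall>p\<in>space M. norm (\<psi> c p) \<le> B) \<and>
     (\<forall>p\<in>space M. continuous_on {-R..R} (\<lambda>c. \<psi> c p))"

lemma admissible_parameter: "admissible R M (\<lambda>c p. c)"
proof -
  have "(\<lambda>q. fst q) \<in> borel_measurable (restrict_space lborel {-R..R} \<Otimes>\<^sub>M M)"
    by (rule measurable_compose[OF measurable_fst measurable_restrict_space1]) simp
  then show ?thesis
    unfolding admissible_def by (auto simp: case_prod_unfold intro!: exI[of _ "\<bar>R\<bar>"])
qed

lemma admissible_state:
  assumes "g \<in> borel_measurable M" "\<And>p. p \<in> space M \<Longrightarrow> norm (g p) \<le> B"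
  shows "admissible R M (\<lambda>c. g)"
  unfolding admissible_def using assms
  by (auto simp: case_prod_unfold intro!: measurable_compose[OF measurable_snd])

lemma admissible_diff:
  assumes "admissible R M \<psi>" "admissible R M \<eta>"
  shows "admissible R M (\<lambda>c p. \<psi> c p - \<eta> c p)"
proof -
  obtain B B' where "\<And>c p. c \<in> {-R..R} \<Longrightarrow> p \<in> space M \<Longrightarrow> norm (\<psi> c p) \<le> B"
      "\<And>c p. c \<in> {-R..R} \<Longrightarrow> p \<in> space M \<Longrightarrow> norm (\<eta> c p) \<le> B'"
    using assms unfolding admissible_def by metis
  then have "norm (\<psi> c p - \<eta> c p) \<le> B + B'" if "c \<in> {-R..R}" "p \<in> space M" for c p
    using that norm_triangle_ineq4[of "\<psi> c p" "\<eta> c p"] by (meson add_mono order_trans)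
  with assms show ?thesis unfolding admissible_def
    by (intro conjI exI[of _ "B + B'"])
      (auto simp: case_prod_unfold intro!: borel_measurable_diff continuous_on_diff)
qed

lemma admissible_inner:
  assumes "admissible R M \<psi>" "admissible R M \<eta>"
  shows "admissible R M (\<lambda>c p. \<psi> c p \<bullet> \<eta> c p)"
proof -
  obtain B B' where B: "\<And>c p. c \<in> {-R..R} \<Longrightarrow> p \<in> space M \<Longrightarrow> norm (\<psi> c p) \<le> B"
      "\<And>c p. c \<in> {-R..R} \<Longrightarrow> p \<in> space M \<Longrightarrow> norm (\<eta> c p) \<le> B'"
    using assms unfolding admissible_def by metis
  have "norm (\<psi> c p \<bullet> \<eta> c p) \<le> B * B'" if "c \<in> {-R..R}" "p \<in> space M" for c p
  proof -
    have "norm (\<psi> c p \<bullet> \<eta> c p) \<le> norm (\<psi> c p) * norm (\<eta> c p)"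
      using Cauchy_Schwarz_ineq2 by simp
    also have "\<dots> \<le> B * B'"
      using B[OF that] by (intro mult_mono) (auto intro: order_trans[OF norm_ge_zero])
    finally show ?thesis .
  qed
  with assms show ?thesis unfolding admissible_def
    by (intro conjI exI[of _ "B * B'"])
      (auto simp: case_prod_unfold intro!: borel_measurable_inner continuous_on_inner)
qed

lemma admissible_mult:
  fixes \<psi> :: "real \<Rightarrow> 'p \<Rightarrow> real"
  shows "admissible R M \<psi> \<Longrightarrow> admissible R M \<eta> \<Longrightarrow> admissible R M (\<lambda>c p. \<psi> c p * \<eta> c p)"
  using admissible_inner[of R M \<psi> \<eta>] by simp

text \<open>Quantities such as the divergence of \<open>f\<close> are determined by the data only at
  interior points, since a Frechet derivative at the boundary would see arbitrary outside values.
  Boundedness, however, comes from compactness of the closure; hence agreement on \<Omega> but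
  continuity up to the boundary.\<close>

definition extends_continuously ::
  "real \<Rightarrow> (real^'n) set \<Rightarrow> (real \<Rightarrow> real^'n \<Rightarrow> real \<Rightarrow> 'b::euclidean_space) \<Rightarrow> bool" where
  "extends_continuously T \<Omega> q \<longleftrightarrow> (\<exists>h. continuous_on ({0..T} \<times> closure \<Omega> \<times> UNIV) h \<and>
     (\<forall>t\<in>{0..T}. \<forall>x\<in>\<Omega>. \<forall>v. h (t, x, v) = q t x v))"

lemma extends_continuously_measurable:
  assumes "extends_continuously T \<Omega> q"
    and \<pi>: "\<pi> \<in> borel_measurable P" "\<And>p. p \<in> space P \<Longrightarrow> \<pi> p \<in> {0..T} \<times> \<Omega>"
    and w: "w \<in> borel_measurable P"
  shows "(\<lambda>p. q (fst (\<pi> p)) (snd (\<pi> p)) (w p)) \<in> borel_measurable P"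
proof -
  let ?S = "{0..T} \<times> closure \<Omega> \<times> (UNIV::real set)"
  obtain h where h: "continuous_on ?S h" "\<And>t x v. t \<in> {0..T} \<Longrightarrow> x \<in> \<Omega> \<Longrightarrow> h (t, x, v) = q t x v"
    using assms(1) unfolding extends_continuously_def by blast
  have "closed ?S" by (intro closed_Times) auto
  \<comment> \<open>Cutting off by the closed set \<open>?S\<close> yields a Borel function on the
    whole space; the cutoff is invisible because \<open>\<pi>\<close> takes values in
    \<open>{0..T} \<times> \<Omega>\<close>.\<close>
  then have "(\<lambda>y. indicator ?S y *\<^sub>R h y) \<in> borel_measurable borel"
    using h(1) by (intro borel_measurable_continuous_on_indicator borel_closed)
  moreover have "(\<lambda>p. (fst (\<pi> p), snd (\<pi> p), w p)) \<in> borel_measurable P"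
    using \<pi>(1) w
    by (intro borel_measurable_Pair measurable_compose[OF \<pi>(1)]) (auto simp: borel_prod[symmetric])
  ultimately have "(\<lambda>p. indicator ?S (fst (\<pi> p), snd (\<pi> p), w p) *\<^sub>R h (fst (\<pi> p), snd (\<pi> p), w p)) \<in> borel_measurable P"
    by (rule measurable_compose[rotated])
  moreover have "indicator ?S (fst (\<pi> p), snd (\<pi> p), w p) *\<^sub>R h (fst (\<pi> p), snd (\<pi> p), w p) =
      q (fst (\<pi> p)) (snd (\<pi> p)) (w p)" if "p \<in> space P" for p
  proof -
    have "snd (\<pi> p) \<in> closure \<Omega>" using \<pi>(2)[OF that] closure_subset[of \<Omega>] by (auto simp: mem_Times_iff)
    then show ?thesis using \<pi>(2)[OF that] h(2) by (auto simp: indicator_def mem_Times_iff)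
  qed
  ultimately show ?thesis by (subst measurable_cong) auto
qed

lemma extends_continuously_bounded:
  assumes "extends_continuously T \<Omega> q" "bounded \<Omega>"
  obtains B where "\<And>t x v. t \<in> {0..T} \<Longrightarrow> x \<in> \<Omega> \<Longrightarrow> v \<in> {-R..R} \<Longrightarrow> norm (q t x v) \<le> B"
proof -
  obtain h where h: "continuous_on ({0..T} \<times> closure \<Omega> \<times> UNIV) h"
      "\<And>t x v. t \<in> {0..T} \<Longrightarrow> x \<in> \<Omega> \<Longrightarrow> h (t, x, v) = q t x v"
    using assms(1) unfolding extends_continuously_def by blast
  have "compact ({0..T} \<times> closure \<Omega> \<times> {-R..R})"
    using assms(2) by (intro compact_Times) (auto simp: compact_closure)
  then have "bounded (h ` ({0..T} \<times> closure \<Omega> \<times> {-R..R}))"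
    by (intro compact_imp_bounded compact_continuous_image continuous_on_subset[OF h(1)]) auto
  then obtain B where B: "\<And>y. y \<in> {0..T} \<times> closure \<Omega> \<times> {-R..R} \<Longrightarrow> norm (h y) \<le> B"
    unfolding bounded_iff by blast
  show ?thesis
  proof (rule that)
    fix t x v assume *: "t \<in> {0..T}" "x \<in> \<Omega>" "v \<in> {-R..R}"
    then show "norm (q t x v) \<le> B"
      using B[of "(t, x, v)"] h(2)[of t x v] closure_subset by auto
  qed
qed

lemma extends_continuously_section:
  assumes "extends_continuously T \<Omega> q" "t \<in> {0..T}" "x \<in> \<Omega>"
  shows "continuous_on A (q t x)"
proof -
  obtain h where h: "continuous_on ({0..T} \<times> closure \<Omega> \<times> UNIV) h"
      "\<And>t x v. t \<in> {0..T} \<Longrightarrow> x \<in> \<Omega> \<Longrightarrow> h (t, x, v) = q t x v"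
    using assms(1) unfolding extends_continuously_def by blast
  have "continuous_on A (\<lambda>v. h (t, x, v))"
    by (rule continuous_on_compose2[OF h(1)])
      (use assms(2,3) closure_subset in \<open>auto intro!: continuous_intros\<close>)
  then show ?thesis using h(2)[OF assms(2,3)] by simp
qed

lemma borel_measurable_id_interior: "(\<lambda>p. p) \<in> borel_measurable (interior_measure T \<Omega>)"
  by (rule measurable_restrict_space1) (rule measurable_completion, simp)

text \<open>For the terms of the MV-inequality that are frozen at the level, namely \<open>f\<close>
  and its divergence at state \<open>c\<close>: here the level is itself a variable of the product
  space.\<close>

lemma admissible_extends_parameter:
  fixes \<Omega> :: "(real^'n) set"
  assumes "extends_continuously T \<Omega> q" "bounded \<Omega>"
  shows "admissible R (interior_measure T \<Omega>) (\<lambda>c p. q (fst p) (snd p) c)"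
proof -
  let ?P = "restrict_space lborel {-R..R} \<Otimes>\<^sub>M interior_measure T \<Omega>"
  have 1: "(\<lambda>y. fst y) \<in> borel_measurable ?P"
    by (rule measurable_compose[OF measurable_fst measurable_restrict_space1]) simp
  have 2: "(\<lambda>y. snd y) \<in> borel_measurable ?P"
    by (rule measurable_compose[OF measurable_snd borel_measurable_id_interior])
  have "(\<lambda>y. q (fst (snd y)) (snd (snd y)) (fst y)) \<in> borel_measurable ?P"
    by (rule extends_continuously_measurable[OF assms(1) 2 _ 1])
      (auto simp: space_pair_measure space_restrict_space)
  moreover obtain B where "\<And>t x v. t \<in> {0..T} \<Longrightarrow> x \<in> \<Omega> \<Longrightarrow> v \<in> {-R..R} \<Longrightarrow> norm (q t x v) \<le> B"
    using extends_continuously_bounded[OF assms] by metis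
  ultimately show ?thesis
    unfolding admissible_def using extends_continuously_section[OF assms(1)]
    by (intro conjI exI[of _ B]) (auto simp: case_prod_unfold space_restrict_space)
qed

lemma admissible_extends_state:
  fixes \<Omega> :: "(real^'n) set"
  assumes "extends_continuously T \<Omega> q" "bounded \<Omega>"
    and "w \<in> borel_measurable (interior_measure T \<Omega>)" "\<And>p. w p \<in> {-R..R}"
  shows "admissible R' (interior_measure T \<Omega>) (\<lambda>c p. q (fst p) (snd p) (w p))"
proof -
  obtain B where B: "\<And>t x v. t \<in> {0..T} \<Longrightarrow> x \<in> \<Omega> \<Longrightarrow> v \<in> {-R..R} \<Longrightarrow> norm (q t x v) \<le> B"
    using extends_continuously_bounded[OF assms(1,2)] by metis
  show ?thesis
  proof (rule admissible_state)
    show "(\<lambda>p. q (fst p) (snd p) (w p)) \<in> borel_measurable (interior_measure T \<Omega>)"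
      by (rule extends_continuously_measurable[OF assms(1) borel_measurable_id_interior _ assms(3)])
        (auto simp: space_restrict_space)
    show "norm (q (fst p) (snd p) (w p)) \<le> B" if "p \<in> space (interior_measure T \<Omega>)" for p
      using B assms(4) that by (auto simp: space_restrict_space)
  qed
qed

lemma extends_continuously_Ck_on:
  assumes "Ck_on k ({0..T} \<times> closure \<Omega> \<times> UNIV) (\<lambda>(t, x, v). g t x v)"
  shows "extends_continuously T \<Omega> g"
proof -
  obtain V h where *: "{0..T} \<times> closure \<Omega> \<times> UNIV \<subseteq> V" "Ck_open k V h"
      "\<forall>p\<in>{0..T} \<times> closure \<Omega> \<times> UNIV. h p = (\<lambda>(t, x, v). g t x v) p"
    using assms unfolding Ck_on_def by blast
  then show ?thesis unfolding extends_continuously_def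
    using continuous_on_subset[OF Ck_open_imp_continuous_on[OF *(2)] *(1)] closure_subset[of \<Omega>]
    by (intro exI[of _ h]) auto
qed

section \<open>Derivatives of the flux and of test functions\<close>

lemma divergence_eq_sum:
  fixes g :: "real^'n \<Rightarrow> real^'n"
  assumes "(g has_derivative D) (at x)"
  shows "divergence g x = (\<Sum>i\<in>UNIV. D (axis i 1) $ i)"
  using frechet_derivative_at[OF assms] by (simp add: divergence_def)

lemma has_derivative_space_section:
  fixes g :: "real \<Rightarrow> real^'n \<Rightarrow> real \<Rightarrow> 'b::real_normed_vector"
  assumes h: "(h has_derivative D) (at (t, x, v))" "\<And>y. y \<in> \<Omega> \<Longrightarrow> h (t, y, v) = g t y v"
    and "open \<Omega>" "x \<in> \<Omega>"
  shows "((\<lambda>y. g t y v) has_derivative (\<lambda>w. D (0, w, 0))) (at x)"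
proof -
  have "((\<lambda>y. (t, y, v)) has_derivative (\<lambda>w. (0, w, 0))) (at x)"
    by (intro has_derivative_Pair has_derivative_ident has_derivative_const)
  from has_derivative_compose[OF this, of h D] h(1)
  have "((\<lambda>y. h (t, y, v)) has_derivative (\<lambda>w. D (0, w, 0))) (at x)" by simp
  then show ?thesis
    by (rule has_derivative_transform_within_open[OF _ assms(3,4)]) (use h(2) in auto)
qed

text \<open>In \<Omega> the \<open>x\<close>-derivative of \<open>f\<close> is that of its extension
  \<open>h\<close>, and the directional derivatives of \<open>h\<close> are continuous up to the
  boundary.\<close>

lemma extends_continuously_divergence:
  fixes f :: "real \<Rightarrow> real^'n \<Rightarrow> real \<Rightarrow> real^'n"
  assumes "Ck_on (Suc k) ({0..T} \<times> closure \<Omega> \<times> UNIV) (\<lambda>(t, x, v). f t x v)" "open \<Omega>"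
  shows "extends_continuously T \<Omega> (\<lambda>t x v. divergence (\<lambda>y. f t y v) x)"
proof -
  let ?S = "{0..T} \<times> closure \<Omega> \<times> (UNIV::real set)"
  obtain V h h' where h: "open V" "?S \<subseteq> V" "\<And>q. q \<in> ?S \<Longrightarrow> h q = (\<lambda>(t, x, v). f t x v) q"
    "\<And>q. q \<in> V \<Longrightarrow> (h has_derivative h' q) (at q)" "\<And>v. Ck_open k V (\<lambda>q. h' q v)"
    using assms(1) by (rule Ck_on_SucE) blast
  have "divergence (\<lambda>y. f t y v) x = (\<Sum>i\<in>UNIV. h' (t, x, v) (0, axis i 1, 0) $ i)"
    if "t \<in> {0..T}" "x \<in> \<Omega>" for t x v
  proof (rule divergence_eq_sum, rule has_derivative_space_section)
    have "(t, x, v) \<in> ?S" using that closure_subset by auto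
    then show "(h has_derivative h' (t, x, v)) (at (t, x, v))" using h(2,4) by blast
    show "h (t, y, v) = f t y v" if "y \<in> \<Omega>" for y
      using h(3)[of "(t, y, v)"] \<open>t \<in> {0..T}\<close> that closure_subset by auto
  qed (use assms that in auto)
  moreover have "continuous_on ?S (\<lambda>q. \<Sum>i\<in>UNIV. h' q (0, axis i 1, 0) $ i)"
    by (intro continuous_intros continuous_on_subset[OF Ck_open_imp_continuous_on[OF h(5)] h(2)])
  ultimately show ?thesis unfolding extends_continuously_def
    by (intro exI[of _ "\<lambda>q. \<Sum>i\<in>UNIV. h' q (0, axis i 1, 0) $ i"]) auto
qed

text \<open>Valid also for boundary points \<open>x\<close> and for \<open>t\<close> equal to 0 or
  \<open>T\<close>: only the state varies, it ranges over the whole line, and along that line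
  \<open>g\<close> coincides with its extension.\<close>

lemma has_vector_derivative_state_section:
  fixes g :: "real \<Rightarrow> real^'n \<Rightarrow> real \<Rightarrow> 'b::real_normed_vector"
  assumes "Ck_on (Suc k) ({0..T} \<times> closure \<Omega> \<times> UNIV) (\<lambda>(t, x, v). g t x v)" "t \<in> {0..T}" "x \<in> closure \<Omega>"
  shows "(g t x has_vector_derivative d3 g t x v) (at v)"
proof -
  let ?S = "{0..T} \<times> closure \<Omega> \<times> (UNIV::real set)"
  obtain V h h' where h: "?S \<subseteq> V" "\<And>q. q \<in> ?S \<Longrightarrow> h q = (\<lambda>(t, x, v). g t x v) q"
    "\<And>q. q \<in> V \<Longrightarrow> (h has_derivative h' q) (at q)"
    using assms(1) by (rule Ck_on_SucE) blast
  have "((\<lambda>v. (t, x, v)) has_derivative (\<lambda>w. (0, 0, w))) (at v)"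
    by (intro has_derivative_Pair has_derivative_ident has_derivative_const)
  from has_derivative_compose[OF this, of h "h' (t, x, v)"] h(1,3) assms(2,3)
  have "((\<lambda>v. h (t, x, v)) has_derivative (\<lambda>w. h' (t, x, v) (0, 0, w))) (at v)" by blast
  moreover have "(\<lambda>v. h (t, x, v)) = g t x" using h(2) assms(2,3) by auto
  ultimately have "g t x differentiable at v" by (auto intro: differentiableI)
  then show ?thesis unfolding d3_def by (simp add: vector_derivative_works)
qed

text \<open>The function is C^1 on the open set of times below \<open>T\<close> and zero on the open
  complement of \<open>K\<close>. Since \<open>K\<close> lies strictly below \<open>T\<close>, these
  two sets cover the whole space, so \<phi> is globally C^1.\<close>

lemma test_function_derivative:
  assumes "test_function T \<phi>"
  obtains \<phi>' where "\<And>p. (\<phi> has_derivative \<phi>' p) (at p)" "\<And>v. continuous_on UNIV (\<lambda>p. \<phi>' p v)"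
proof -
  obtain K where K: "compact K" "K \<subseteq> {..<T} \<times> UNIV" "\<And>p. p \<notin> K \<Longrightarrow> \<phi> p = 0"
    and C1: "Ck_on 1 ({..<T} \<times> UNIV) \<phi>"
    using assms unfolding test_function_def by blast
  let ?A = "{..<T} \<times> (UNIV :: (real^'n) set)"
  have opA: "open ?A" by (intro open_Times) auto
  have opK: "open (- K)" using K(1) by (simp add: compact_imp_closed open_Compl)
  obtain V h where h: "?A \<subseteq> V" "Ck_open 1 V h" "\<And>p. p \<in> ?A \<Longrightarrow> h p = \<phi> p"
    using C1 unfolding Ck_on_def by blast
  have "Ck_open 1 ?A \<phi>" by (rule Ck_open_cong[OF opA h(3) Ck_open_subset[OF h(2,1)]])
  then obtain D where D: "\<And>p. p \<in> ?A \<Longrightarrow> (\<phi> has_derivative D p) (at p)" "\<And>v. continuous_on ?A (\<lambda>p. D p v)"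
    by auto
  define \<phi>' where "\<phi>' p = (if p \<in> K then D p else (\<lambda>v. 0))" for p
  have out: "(\<phi> has_derivative (\<lambda>v. 0)) (at p)" if "p \<notin> K" for p
    by (rule has_derivative_transform_within_open[OF has_derivative_const opK, of _ 0]) (use that K(3) in auto)
  have der: "(\<phi> has_derivative \<phi>' p) (at p)" for p
    using D(1)[of p] K(2) out[of p] by (auto simp: \<phi>'_def)
  have eqA: "\<phi>' p = D p" if "p \<in> ?A" for p
    using has_derivative_unique[OF der D(1)[OF that]] .
  have "continuous_on (?A \<union> - K) (\<lambda>p. \<phi>' p v)" for v
  proof (rule continuous_on_open_Un[OF opA opK])
    show "continuous_on ?A (\<lambda>p. \<phi>' p v)" using D(2)[of v] by (rule continuous_on_eq) (use eqA in auto)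
    show "continuous_on (- K) (\<lambda>p. \<phi>' p v)"
      by (rule continuous_on_eq[of _ "\<lambda>_. 0"]) (auto simp: \<phi>'_def)
  qed
  moreover have "?A \<union> - K = UNIV" using K(2) by auto
  ultimately show ?thesis using der that by metis
qed

lemma test_function_bounded:
  assumes "test_function T \<phi>"
  obtains B where "\<And>p. \<bar>\<phi> p\<bar> \<le> B"
proof -
  obtain K where K: "compact K" "\<And>p. p \<notin> K \<Longrightarrow> \<phi> p = 0"
    using assms unfolding test_function_def by blast
  obtain \<phi>' where "\<And>p. (\<phi> has_derivative \<phi>' p) (at p)" using test_function_derivative[OF assms] by metis
  then have "continuous_on K \<phi>"
    by (intro has_derivative_continuous_on[where f' = \<phi>']) (simp add: has_derivative_at_withinI)
  then have "bounded (\<phi> ` K)" using K(1) compact_continuous_image compact_imp_bounded by blast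
  then obtain B where "B > 0" "\<And>p. p \<in> K \<Longrightarrow> \<bar>\<phi> p\<bar> \<le> B" unfolding bounded_pos by auto
  then have "\<bar>\<phi> p\<bar> \<le> B" for p using K(2)[of p] by (cases "p \<in> K") auto
  then show ?thesis using that by blast
qed

lemma test_function_continuous: "test_function T \<phi> \<Longrightarrow> continuous_on UNIV \<phi>"
proof -
  assume "test_function T \<phi>"
  then obtain \<phi>' where "\<And>p. (\<phi> has_derivative \<phi>' p) (at p)" using test_function_derivative by metis
  then show ?thesis
    by (intro has_derivative_continuous_on[where f' = \<phi>']) (simp add: has_derivative_at_withinI)
qed

lemma extends_continuously_test_function:
  assumes "test_function T \<phi>"
  shows "extends_continuously T \<Omega> (\<lambda>t x v. \<phi> (t, x))"
    and "extends_continuously T \<Omega> (\<lambda>t x v. deriv (\<lambda>s. \<phi> (s, x)) t)"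
    and "extends_continuously T \<Omega> (\<lambda>t x v. grad (\<lambda>y. \<phi> (t, y)) x)"
proof -
  obtain \<phi>' where \<phi>': "\<And>p. (\<phi> has_derivative \<phi>' p) (at p)" "\<And>v. continuous_on UNIV (\<lambda>p. \<phi>' p v)"
    using test_function_derivative[OF assms] by metis
  have c: "continuous_on ({0..T} \<times> closure \<Omega> \<times> UNIV) (\<lambda>q. g (fst q, fst (snd q)))"
    if "continuous_on UNIV g" for g :: "real \<times> (real^'a) \<Rightarrow> 'c::real_normed_vector"
    by (rule continuous_on_compose2[OF that]) (auto intro!: continuous_intros)
  have cg: "continuous_on UNIV (\<lambda>p. \<chi> i. \<phi>' p (0, axis i 1))"
    by (intro continuous_on_vec_lambda \<phi>'(2))
  have *: "((\<lambda>s. \<phi> (s, x)) has_derivative (\<lambda>w. \<phi>' (t, x) (w, 0))) (at t)" for t x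
    by (rule has_derivative_compose[OF _ \<phi>'(1), of "\<lambda>s. (s, x)"])
      (intro has_derivative_Pair has_derivative_ident has_derivative_const)
  have "((\<lambda>s. \<phi> (s, x)) has_vector_derivative \<phi>' (t, x) (1, 0)) (at t)" for t x
  proof -
    have "(\<lambda>w. \<phi>' (t, x) (w, 0)) = (\<lambda>w. w *\<^sub>R \<phi>' (t, x) (1, 0))"
    proof
      show "\<phi>' (t, x) (w, 0) = w *\<^sub>R \<phi>' (t, x) (1, 0)" for w
        using linear_scale[OF has_derivative_linear[OF \<phi>'(1)], of "(t, x)" w "(1, 0)"] by simp
    qed
    with *[of x t] show ?thesis by (simp only: has_vector_derivative_def)
  qed
  then have t: "deriv (\<lambda>s. \<phi> (s, x)) t = \<phi>' (t, x) (1, 0)" for t x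
    by (intro DERIV_imp_deriv) (simp add: has_real_derivative_iff_has_vector_derivative)
  have "((\<lambda>y. \<phi> (t, y)) has_derivative (\<lambda>w. \<phi>' (t, x) (0, w))) (at x)" for t x
    by (rule has_derivative_compose[OF _ \<phi>'(1), of "\<lambda>y. (t, y)"])
      (intro has_derivative_Pair has_derivative_ident has_derivative_const)
  then have x: "grad (\<lambda>y. \<phi> (t, y)) x = (\<chi> i. \<phi>' (t, x) (0, axis i 1))" for t x
    unfolding grad_def using frechet_derivative_at by (metis (no_types, lifting))
  show "extends_continuously T \<Omega> (\<lambda>t x v. \<phi> (t, x))"
    using c[OF test_function_continuous[OF assms]] unfolding extends_continuously_def by fastforce
  show "extends_continuously T \<Omega> (\<lambda>t x v. deriv (\<lambda>s. \<phi> (s, x)) t)"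
    using c[OF \<phi>'(2)[of "(1, 0)"]] unfolding extends_continuously_def t by fastforce
  show "extends_continuously T \<Omega> (\<lambda>t x v. grad (\<lambda>y. \<phi> (t, y)) x)"
    using c[OF cg] unfolding extends_continuously_def x by fastforce
qed

section \<open>Entropies as superpositions of semi-Kruzkov entropies\<close>

lemma admissible_kernel_Fubini:
  fixes R :: real and \<psi> :: "real \<Rightarrow> 'p \<Rightarrow> real" and z :: "'p \<Rightarrow> real"
  defines "N \<equiv> restrict_space lborel {-R..R}"
  assumes "admissible R M \<psi>" "finite_measure M" "z \<in> borel_measurable M" "continuous_on {-R..R} a"
  shows "integrable M (\<lambda>p. LINT c|N. a c * (kernel k (z p) c * \<psi> c p))"
    and "integrable N (\<lambda>c. a c * (LINT p|M. kernel k (z p) c * \<psi> c p))"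
    and "(LINT p|M. LINT c|N. a c * (kernel k (z p) c * \<psi> c p)) =
       (LINT c|N. a c * (LINT p|M. kernel k (z p) c * \<psi> c p))"
proof -
  obtain B where "\<And>c p. c \<in> {-R..R} \<Longrightarrow> p \<in> space M \<Longrightarrow> \<bar>\<psi> c p\<bar> \<le> B"
    and "case_prod \<psi> \<in> borel_measurable (N \<Otimes>\<^sub>M M)"
    using assms(2) unfolding admissible_def N_def real_norm_def by metis
  note * = assms(3,4) this(2,1) assms(5)
  show "integrable M (\<lambda>p. LINT c|N. a c * (kernel k (z p) c * \<psi> c p))"
    using integrable_kernel_integral[of M z \<psi> R B a k] * unfolding N_def by blast
  show "integrable N (\<lambda>c. a c * (LINT p|M. kernel k (z p) c * \<psi> c p))"
    using integrable_integral_kernel[of M z \<psi> R B a k] * unfolding N_def by blast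
  show "(LINT p|M. LINT c|N. a c * (kernel k (z p) c * \<psi> c p)) =
       (LINT c|N. a c * (LINT p|M. kernel k (z p) c * \<psi> c p))"
    using integral_kernel_Fubini[of M z \<psi> R B a k] * unfolding N_def by blast
qed

lemma admissible_kernel_tendsto:
  fixes z :: "'p \<Rightarrow> real"
  assumes "admissible R M \<psi>" "finite_measure M" "z \<in> borel_measurable M"
    and "X \<longlonglongrightarrow> k" "\<And>n. X n \<in> {-R..R}" "k \<in> {-R..R}"
    and "sg = sgn_plus \<and> (\<forall>n. X n > k) \<or> sg = sgn_minus \<and> (\<forall>n. X n < k)"
  shows "(\<lambda>n. LINT p|M. kernel k (z p) (X n) * \<psi> (X n) p) \<longlonglongrightarrow> (LINT p|M. sg (z p - k) * \<psi> k p)"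
proof -
  obtain B where B: "\<And>c p. c \<in> {-R..R} \<Longrightarrow> p \<in> space M \<Longrightarrow> \<bar>\<psi> c p\<bar> \<le> B"
    and meas: "case_prod \<psi> \<in> borel_measurable (restrict_space lborel {-R..R} \<Otimes>\<^sub>M M)"
    and cont: "\<And>p. p \<in> space M \<Longrightarrow> continuous_on {-R..R} (\<lambda>c. \<psi> c p)"
    using assms(1) unfolding admissible_def real_norm_def by metis
  show ?thesis
    by (rule kernel_integral_tendsto[OF assms(2,3) meas B cont assms(4-7)])
qed

lemma kernel_integral_FTC_weighted:
  fixes R :: real and G a g :: "real \<Rightarrow> real"
  defines "N \<equiv> restrict_space lborel {-R..R}"
  assumes "\<And>c. (G has_real_derivative a c * g c) (at c)"
    and "continuous_on UNIV a" "continuous_on UNIV g" "k \<in> {-R..R}" "z \<in> {-R..R}"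
  shows "(LINT c|N. a c * (kernel k z c * g c)) = G z - G k"
proof -
  have "(LINT c|N. a c * (kernel k z c * g c)) = (LINT c|N. kernel k z c * (a c * g c))"
    by (simp add: mult_ac)
  also have "\<dots> = G z - G k"
    unfolding N_def
    by (rule kernel_integral_FTC[OF has_field_derivative_at_within[OF assms(2)] _ assms(5,6)])
      (rule continuous_on_mult[OF continuous_on_subset[OF assms(3)] continuous_on_subset[OF assms(4)]], simp_all)
  finally show ?thesis .
qed

lemma entropy_second_derivative:
  fixes H :: "real \<Rightarrow> real \<Rightarrow> real" and k :: real
  assumes "Ck_on 2 UNIV (\<lambda>(z, w). H z w)"
  obtains a where "continuous_on UNIV a"
    "\<And>z. ((\<lambda>s. H s k) has_real_derivative deriv (\<lambda>s. H s k) z) (at z)"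
    "\<And>z. (deriv (\<lambda>s. H s k) has_real_derivative a z) (at z)"
proof -
  let ?H = "\<lambda>(z, w). H z w"
  have "Ck_open (Suc (Suc 0)) UNIV ?H" using assms by (simp add: Ck_on_UNIV numeral_2_eq_2 del: Ck_open.simps)
  then obtain h' where h': "\<And>q. (?H has_derivative h' q) (at q)" "\<And>v. Ck_open (Suc 0) UNIV (\<lambda>q. h' q v)"
    by (subst (asm) Ck_open.simps(2)) blast
  obtain h'' where h'': "\<And>q. ((\<lambda>q. h' q (1, 0)) has_derivative h'' q) (at q)" "\<And>v. continuous_on UNIV (\<lambda>q. h'' q v)"
    using h'(2)[of "(1, 0)"] by auto
  have sec: "((\<lambda>s. g (s, k)) has_real_derivative g' (1, 0)) (at z)"
    if "(g has_derivative g') (at (z, k))" for g :: "real \<times> real \<Rightarrow> real" and g' z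
  proof -
    have "((\<lambda>s. (s, k)) has_derivative (\<lambda>w. (w, 0))) (at z)"
      by (intro has_derivative_Pair has_derivative_ident has_derivative_const)
    from has_derivative_compose[OF this, of g g'] that
    have "((\<lambda>s. g (s, k)) has_derivative (\<lambda>w. g' (w, 0))) (at z)" by simp
    moreover have "(\<lambda>w. g' (w, 0)) = (\<lambda>w. g' (1, 0) * w)"
    proof
      show "g' (w, 0) = g' (1, 0) * w" for w
        using linear_scale[OF has_derivative_linear[OF that], of w "(1, 0)"] by simp
    qed
    ultimately show ?thesis by (simp only: has_field_derivative_def)
  qed
  have d: "((\<lambda>s. H s k) has_real_derivative h' (z, k) (1, 0)) (at z)" for z
    using sec[OF h'(1)] by simp
  then have eq: "deriv (\<lambda>s. H s k) = (\<lambda>z. h' (z, k) (1, 0))"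
    using DERIV_imp_deriv by blast
  show ?thesis
  proof (rule that)
    show "continuous_on UNIV (\<lambda>z. h'' (z, k) (1, 0))"
      by (rule continuous_on_compose2[OF h''(2)]) (auto intro!: continuous_intros)
    show "((\<lambda>s. H s k) has_real_derivative deriv (\<lambda>s. H s k) z) (at z)" for z using d eq by simp
    show "(deriv (\<lambda>s. H s k) has_real_derivative h'' (z, k) (1, 0)) (at z)" for z
      unfolding eq using sec[OF h''(1)] by simp
  qed
qed

text \<open>Adding the tangent inequalities of \<open>g\<close> at two points shows that
  \<open>g'\<close> is nondecreasing.\<close>

lemma entropy_second_derivative_nonneg:
  fixes g g' :: "real \<Rightarrow> real"
  assumes "convex_on UNIV g" "\<And>z. (g has_real_derivative g' z) (at z)" "(g' has_real_derivative a) (at z)"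
  shows "0 \<le> a"
proof -
  have "mono_on UNIV g'"
  proof (rule mono_onI)
    fix x y :: real assume "x \<le> y"
    have "g' x * (y - x) \<le> g y - g x" "g' y * (x - y) \<le> g x - g y"
      using convex_on_imp_above_tangent[OF assms(1), of _ _ "g' _"] assms(2)
      by (auto simp: has_field_derivative_at_within)
    then have "0 \<le> (g' y - g' x) * (y - x)" by (simp add: algebra_simps)
    then show "g' x \<le> g' y" using \<open>x \<le> y\<close>
      by (cases "x = y") (auto simp: zero_le_mult_iff)
  qed
  then show ?thesis using mono_on_imp_deriv_nonneg[OF _ assms(3)] by simp
qed

text \<open>The level \<open>k\<close> is fixed and \<open>a\<close> is the second derivative of
  \<open>H\<close> at that level. Nonemptiness is required because the diagonal conditions, also
  those on \<open>H\<close> alone, are quantified over \<open>t\<close> and \<open>x\<close>: a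
  point is needed to extract them.\<close>

locale entropy_pair =
  fixes T :: real and \<Omega> :: "(real^'n) set"
    and f :: "real \<Rightarrow> real^'n \<Rightarrow> real \<Rightarrow> real^'n" and H Q k a
  assumes open_domain: "open \<Omega>" and nonempty: "\<Omega> \<noteq> {}" "0 < T"
    and flux: "Ck_on 2 ({0..T} \<times> closure \<Omega> \<times> UNIV) (\<lambda>(t, x, v). f t x v)"
    and pair: "boundary_entropy_pair T \<Omega> f H Q"
    and cont_a: "continuous_on UNIV a"
    and deriv_H: "\<And>z. ((\<lambda>s. H s k) has_real_derivative deriv (\<lambda>s. H s k) z) (at z)"
    and deriv2_H: "\<And>z. (deriv (\<lambda>s. H s k) has_real_derivative a z) (at z)"
begin

abbreviation H1 where "H1 \<equiv> deriv (\<lambda>s. H s k)"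

lemma Ck_flux: "Ck_on (Suc (Suc 0)) ({0..T} \<times> closure \<Omega> \<times> UNIV) (\<lambda>(t, x, v). f t x v)"
  using flux by (simp add: numeral_2_eq_2)

lemma at_diagonal: "H k k = 0" "H1 k = 0"
proof -
  obtain x where "x \<in> closure \<Omega>" "0 \<in> {0..T}" using nonempty by fastforce
  then have "H k k = 0 \<and> H1 k = 0" using pair unfolding boundary_entropy_pair_def by blast
  then show "H k k = 0" "H1 k = 0" by blast+
qed

lemma flux_at_diagonal: "t \<in> {0..T} \<Longrightarrow> x \<in> \<Omega> \<Longrightarrow> Q t x k k = 0"
  using pair closure_subset[of \<Omega>] unfolding boundary_entropy_pair_def by blast

text \<open>The compatibility condition prescribes a \<open>vector_derivative\<close>, which is
  informative only where the function is differentiable. Differentiability is read off from the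
  smooth extension of \<open>Q\<close>.\<close>

lemma deriv_Q:
  assumes "t \<in> {0..T}" "x \<in> \<Omega>"
  shows "((\<lambda>s. Q t x s k) has_vector_derivative H1 z *\<^sub>R d3 f t x z) (at z)"
proof -
  let ?S = "{0..T} \<times> closure \<Omega> \<times> (UNIV::real set) \<times> (UNIV::real set)"
  have x: "x \<in> closure \<Omega>" using assms closure_subset by blast
  have "Ck_on (Suc 1) ?S (\<lambda>(t, x, z, w). Q t x z w)"
    using pair unfolding boundary_entropy_pair_def by (simp add: numeral_2_eq_2)
  then obtain V h h' where h: "?S \<subseteq> V" "\<And>q. q \<in> ?S \<Longrightarrow> h q = (\<lambda>(t, x, z, w). Q t x z w) q"
    "\<And>q. q \<in> V \<Longrightarrow> (h has_derivative h' q) (at q)"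
    by (rule Ck_on_SucE) blast
  have "((\<lambda>s. (t, x, s, k)) has_derivative (\<lambda>w. (0, 0, w, 0))) (at z)"
    by (intro has_derivative_Pair has_derivative_ident has_derivative_const)
  from has_derivative_compose[OF this, of h "h' (t, x, z, k)"] h(1,3) assms x
  have "((\<lambda>s. h (t, x, s, k)) has_derivative (\<lambda>w. h' (t, x, z, k) (0, 0, w, 0))) (at z)" by blast
  moreover have "(\<lambda>s. h (t, x, s, k)) = (\<lambda>s. Q t x s k)" using h(2) assms x by auto
  ultimately have "(\<lambda>s. Q t x s k) differentiable at z" by (auto intro: differentiableI)
  then have "((\<lambda>s. Q t x s k) has_vector_derivative vector_derivative (\<lambda>s. Q t x s k) (at z)) (at z)"
    by (simp add: vector_derivative_works)
  then show ?thesis using pair assms x unfolding boundary_entropy_pair_def by simp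
qed

lemma deriv_flux:
  assumes "t \<in> {0..T}" "x \<in> \<Omega>"
  shows "(f t x has_vector_derivative d3 f t x z) (at z)"
  using has_vector_derivative_state_section[OF Ck_flux] assms closure_subset by blast

lemma cont_flux:
  assumes "t \<in> {0..T}" "x \<in> \<Omega>"
  shows "continuous_on A (f t x)"
  using extends_continuously_section[OF extends_continuously_Ck_on[OF flux] assms] .

lemma deriv_H1: "(H1 has_vector_derivative a z) (at z)"
  using deriv2_H by (simp add: has_real_derivative_iff_has_vector_derivative)

text \<open>Taylor's formula with integral remainder at \<open>k\<close>, where \<open>H\<close> and
  \<open>H1\<close> vanish. The primitive in \<open>c\<close> is
  \<open>H1 c * (z - c) + H c k\<close>, times \<open>w\<close>.\<close>

lemma kernel_integral_entropy:
  assumes "k \<in> {-R..R}" "z \<in> {-R..R}"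
  shows "(LINT c|restrict_space lborel {-R..R}. a c * (kernel k z c * ((z - c) * w))) = H z k * w"
proof -
  have "(LINT c|restrict_space lborel {-R..R}. a c * (kernel k z c * ((z - c) * w))) =
      (H1 z * (z - z) + H z k) * w - (H1 k * (z - k) + H k k) * w"
    by (rule kernel_integral_FTC_weighted[where G = "\<lambda>c. (H1 c * (z - c) + H c k) * w"])
      (use assms cont_a in \<open>auto intro!: derivative_eq_intros deriv_H deriv2_H continuous_intros\<close>)
  then show ?thesis using at_diagonal by simp
qed

lemma kernel_integral_deriv_entropy:
  assumes "k \<in> {-R..R}" "z \<in> {-R..R}"
  shows "(LINT c|restrict_space lborel {-R..R}. a c * (kernel k z c * w)) = H1 z * w"
proof -
  have "(LINT c|restrict_space lborel {-R..R}. a c * (kernel k z c * w)) = H1 z * w - H1 k * w"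
    by (rule kernel_integral_FTC_weighted[where G = "\<lambda>c. H1 c * w"])
      (use assms cont_a in \<open>auto intro!: derivative_eq_intros deriv2_H\<close>)
  then show ?thesis using at_diagonal by simp
qed

text \<open>In the derivative of the primitive \<open>?G\<close> the terms with \<open>d3 f\<close>
  cancel by the compatibility of \<open>Q\<close> with \<open>H\<close>. At \<open>c = z\<close>
  only \<open>Q\<close> remains, at \<open>c = k\<close> nothing.\<close>

lemma kernel_integral_entropy_flux:
  assumes "t \<in> {0..T}" "x \<in> \<Omega>" "k \<in> {-R..R}" "z \<in> {-R..R}"
  shows "(LINT c|restrict_space lborel {-R..R}. a c * (kernel k z c * ((f t x z - f t x c) \<bullet> w))) = Q t x z k \<bullet> w"
proof -
  let ?G = "\<lambda>c. H1 c *\<^sub>R (f t x z - f t x c) + Q t x c k"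
  have "(LINT c|restrict_space lborel {-R..R}. a c * (kernel k z c * ((f t x z - f t x c) \<bullet> w))) = ?G z \<bullet> w - ?G k \<bullet> w"
  proof (rule kernel_integral_FTC_weighted[where G = "\<lambda>c. ?G c \<bullet> w"])
    fix c
    have "((\<lambda>c. f t x z - f t x c) has_vector_derivative - d3 f t x c) (at c)"
      using has_vector_derivative_diff[OF has_vector_derivative_const deriv_flux[OF assms(1,2)]] by simp
    from has_vector_derivative_add[OF has_vector_derivative_scaleR[OF deriv2_H this] deriv_Q[OF assms(1,2)]]
    have "(?G has_vector_derivative a c *\<^sub>R (f t x z - f t x c)) (at c)" by simp
    then have "((\<lambda>c. ?G c \<bullet> w) has_vector_derivative (a c *\<^sub>R (f t x z - f t x c)) \<bullet> w) (at c)"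
      by (rule bounded_linear.has_vector_derivative[OF bounded_linear_inner_left])
    then show "((\<lambda>c. ?G c \<bullet> w) has_real_derivative a c * ((f t x z - f t x c) \<bullet> w)) (at c)"
      by (simp add: has_real_derivative_iff_has_vector_derivative)
    show "continuous_on UNIV (\<lambda>c. (f t x z - f t x c) \<bullet> w)"
      by (intro continuous_intros cont_flux assms)
  qed (use assms cont_a in auto)
  then show ?thesis using at_diagonal flux_at_diagonal[OF assms(1,2)] by simp
qed

text \<open>Integration by parts puts \<open>Q\<close> into a form in which \<open>x\<close> enters
  through \<open>f\<close> alone. This is what relates the \<open>x\<close>-derivatives of
  \<open>Q\<close> to those of \<open>f\<close>.\<close>

lemma entropy_flux_eq:
  assumes "t \<in> {0..T}" "x \<in> \<Omega>" 
  shows "Q t x z k = H1 z *\<^sub>R f t x z - integral {0..1} (\<lambda>r. ((z - k) * a (k + r * (z - k))) *\<^sub>R f t x (k + r * (z - k)))"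
proof -
  define R where "R = max \<bar>z\<bar> \<bar>k\<bar>"
  have R: "k \<in> {-R..R}" "z \<in> {-R..R}" by (auto simp: R_def)
  have "((\<lambda>c. H1 c *\<^sub>R f t x c - Q t x c k) has_vector_derivative a c *\<^sub>R f t x c) (at c)" for c
    using has_vector_derivative_diff[OF has_vector_derivative_scaleR[OF deriv2_H deriv_flux[OF assms]] deriv_Q[OF assms]]
    by simp
  from integral_unique[OF has_integral_segment_FTC[OF has_vector_derivative_at_within[OF this] R]]
  have "integral {0..1} (\<lambda>r. (z - k) *\<^sub>R a (k + r * (z - k)) *\<^sub>R f t x (k + r * (z - k))) =
      (H1 z *\<^sub>R f t x z - Q t x z k) - (H1 k *\<^sub>R f t x k - Q t x k k)" .
  then show ?thesis using at_diagonal flux_at_diagonal[OF assms] by simp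
qed

text \<open>Differentiate \<open>entropy_flux_eq\<close> in \<open>x\<close> under the integral
  sign, which is legitimate since it holds on all of the open set \<Omega>, and exchange the finite
  sum over coordinates with the integral.\<close>

lemma divergence_entropy_flux:
  assumes "t \<in> {0..T}" "x \<in> \<Omega>"
  shows "divergence (\<lambda>y. Q t y z k) x = H1 z * divergence (\<lambda>y. f t y z) x -
    integral {0..1} (\<lambda>r. (z - k) * (a (k + r * (z - k)) * divergence (\<lambda>y. f t y (k + r * (z - k))) x))"
proof -
  let ?S = "{0..T} \<times> closure \<Omega> \<times> (UNIV::real set)"
  let ?s = "\<lambda>r. k + r * (z - k)"
  obtain V h h' where h: "?S \<subseteq> V" "\<And>q. q \<in> ?S \<Longrightarrow> h q = (\<lambda>(t, x, v). f t x v) q"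
    "\<And>q. q \<in> V \<Longrightarrow> (h has_derivative h' q) (at q)" "\<And>v. Ck_open (Suc 0) V (\<lambda>q. h' q v)"
    using Ck_flux by (rule Ck_on_SucE) blast
  have inS: "(t, y, v) \<in> ?S" if "y \<in> \<Omega>" for y v using assms that closure_subset by auto
  have df: "((\<lambda>y. f t y v) has_derivative (\<lambda>w. h' (t, y, v) (0, w, 0))) (at y)" if "y \<in> \<Omega>" for y v
  proof (rule has_derivative_space_section[OF _ _ open_domain that])
    show "(h has_derivative h' (t, y, v)) (at (t, y, v))" using h(1,3) inS[OF that] by blast
    show "h (t, y, v) = f t y v" if "y \<in> \<Omega>" for y using h(2)[OF inS[OF that]] by simp
  qed
  have divf: "divergence (\<lambda>y. f t y v) x = (\<Sum>i\<in>UNIV. h' (t, x, v) (0, axis i 1, 0) $ i)" for v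
    by (rule divergence_eq_sum[OF df[OF assms(2)]])
  have cont_h': "continuous_on (\<Omega> \<times> {0..1}) (\<lambda>(y, r). h' (t, y, ?s r) v)" for v
    unfolding case_prod_unfold
    by (rule continuous_on_compose2[OF Ck_open_imp_continuous_on[OF h(4)]])
      (use h(1) inS in \<open>auto intro!: continuous_intros\<close>)
  have cont_h'_x: "continuous_on {0..1} (\<lambda>r. h' (t, x, ?s r) v)" for v
    by (rule continuous_on_compose2[OF Ck_open_imp_continuous_on[OF h(4)]])
      (use h(1) inS[OF assms(2)] in \<open>auto intro!: continuous_intros\<close>)
  have cont_a_seg: "continuous_on A (\<lambda>r. a (?s r))" for A
    by (rule continuous_on_compose2[OF cont_a]) (auto intro!: continuous_intros)
  have cont_f_seg: "continuous_on A (\<lambda>r. f t y (?s r))" if "y \<in> \<Omega>" for y A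
    by (rule continuous_on_compose2[OF cont_flux[OF assms(1) that, of UNIV]]) (auto intro!: continuous_intros)
  let ?D = "\<lambda>w. integral {0..1} (\<lambda>r. ((z - k) * a (?s r)) *\<^sub>R h' (t, x, ?s r) (0, w, 0))"
  have "((\<lambda>y. integral {0..1} (\<lambda>r. ((z - k) * a (?s r)) *\<^sub>R f t y (?s r))) has_derivative ?D) (at x)"
  proof (rule has_derivative_param_integral[OF _ _ _ open_domain assms(2)])
    show "((\<lambda>y. ((z - k) * a (?s r)) *\<^sub>R f t y (?s r)) has_derivative
        (\<lambda>w. ((z - k) * a (?s r)) *\<^sub>R h' (t, y, ?s r) (0, w, 0))) (at y)" if "y \<in> \<Omega>" for y r
      by (intro has_derivative_scaleR_right df that)
    have "continuous_on (\<Omega> \<times> {0..1}) (\<lambda>q. a (?s (snd q)))"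
      by (rule continuous_on_compose2[OF cont_a]) (auto intro!: continuous_intros)
    then show "continuous_on (\<Omega> \<times> {0..1}) (\<lambda>(y, r). ((z - k) * a (?s r)) *\<^sub>R h' (t, y, ?s r) (0, w, 0))" for w
      using cont_h'[of "(0, w, 0)"] unfolding case_prod_unfold by (intro continuous_intros)
    show "continuous_on {0..1} (\<lambda>r. ((z - k) * a (?s r)) *\<^sub>R f t y (?s r))" if "y \<in> \<Omega>" for y
      using cont_a_seg cont_f_seg[OF that] by (intro continuous_intros)
  qed
  from has_derivative_diff[OF has_derivative_scaleR_right[OF df[OF assms(2)]] this]
  have "((\<lambda>y. H1 z *\<^sub>R f t y z - integral {0..1} (\<lambda>r. ((z - k) * a (?s r)) *\<^sub>R f t y (?s r))) has_derivative
      (\<lambda>w. H1 z *\<^sub>R h' (t, x, z) (0, w, 0) - ?D w)) (at x)" .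
  then have "((\<lambda>y. Q t y z k) has_derivative (\<lambda>w. H1 z *\<^sub>R h' (t, x, z) (0, w, 0) - ?D w)) (at x)"
    by (rule has_derivative_transform_within_open[OF _ open_domain assms(2)])
      (use entropy_flux_eq[OF assms(1)] in simp)
  then have "divergence (\<lambda>y. Q t y z k) x =
      (\<Sum>i\<in>UNIV. H1 z * h' (t, x, z) (0, axis i 1, 0) $ i - ?D (axis i 1) $ i)"
    by (subst divergence_eq_sum) auto
  also have "\<dots> = H1 z * divergence (\<lambda>y. f t y z) x - (\<Sum>i\<in>UNIV. ?D (axis i 1) $ i)"
    by (simp add: sum_subtractf divf sum_distrib_left)
  also have "(\<Sum>i\<in>UNIV. ?D (axis i 1) $ i) =
      (\<Sum>i\<in>UNIV. integral {0..1} (\<lambda>r. (z - k) * (a (?s r) * h' (t, x, ?s r) (0, axis i 1, 0) $ i)))"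
  proof (rule sum.cong[OF refl])
    fix i :: 'n
    have "(\<lambda>r. ((z - k) * a (?s r)) *\<^sub>R h' (t, x, ?s r) (0, axis i 1, 0)) integrable_on {0..1}"
      by (intro integrable_continuous_real continuous_intros cont_a_seg cont_h'_x)
    from integral_component_eq_cart[OF this, of i]
    show "?D (axis i 1) $ i = integral {0..1} (\<lambda>r. (z - k) * (a (?s r) * h' (t, x, ?s r) (0, axis i 1, 0) $ i))"
      by (simp add: mult.assoc)
  qed
  also have "\<dots> = integral {0..1} (\<lambda>r. \<Sum>i\<in>UNIV. (z - k) * (a (?s r) * h' (t, x, ?s r) (0, axis i 1, 0) $ i))"
  proof (rule integral_sum[symmetric])
    fix i :: 'n
    show "(\<lambda>r. (z - k) * (a (?s r) * h' (t, x, ?s r) (0, axis i 1, 0) $ i)) integrable_on {0..1}"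
      by (intro integrable_continuous_real continuous_intros cont_a_seg cont_h'_x)
  qed simp
  finally show ?thesis by (simp add: divf sum_distrib_left)
qed

lemma kernel_integral_source:
  assumes "t \<in> {0..T}" "x \<in> \<Omega>" "k \<in> {-R..R}" "z \<in> {-R..R}"
  shows "(LINT c|restrict_space lborel {-R..R}. a c * (kernel k z c * ((b - divergence (\<lambda>y. f t y c) x) * w))) =
    (H1 z * (b - divergence (\<lambda>y. f t y z) x) + divergence (\<lambda>y. Q t y z k) x) * w"
proof -
  let ?d = "\<lambda>c. divergence (\<lambda>y. f t y c) x"
  let ?s = "\<lambda>r. k + r * (z - k)"
  have cd: "continuous_on A ?d" for A
    using extends_continuously_section[OF extends_continuously_divergence[OF Ck_flux open_domain] assms(1,2)] .
  have ca: "continuous_on A a" for A using cont_a continuous_on_subset by blast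
  have cont_seg: "continuous_on A (\<lambda>r. a (?s r))" "continuous_on A (\<lambda>r. ?d (?s r))" for A
    by (rule continuous_on_compose2[OF ca[of UNIV]] continuous_on_compose2[OF cd[of UNIV]];
        auto intro!: continuous_intros)+
  have "(LINT c|restrict_space lborel {-R..R}. a c * (kernel k z c * ((b - ?d c) * w))) =
      (LINT c|restrict_space lborel {-R..R}. kernel k z c * (a c * ((b - ?d c) * w)))"
    by (simp add: mult_ac)
  also have "\<dots> = integral {0..1} (\<lambda>r. (z - k) * (a (?s r) * ((b - ?d (?s r)) * w)))"
    by (rule kernel_integral_segment[OF _ assms(3,4)]) (intro continuous_intros ca cd)
  also have "\<dots> = integral {0..1} (\<lambda>r. ((z - k) * a (?s r)) * (b * w) - ((z - k) * (a (?s r) * ?d (?s r))) * w)"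
    by (simp add: algebra_simps)
  also have "\<dots> = integral {0..1} (\<lambda>r. ((z - k) * a (?s r)) * (b * w)) -
      integral {0..1} (\<lambda>r. ((z - k) * (a (?s r) * ?d (?s r))) * w)"
    by (intro integral_diff integrable_continuous_real continuous_intros cont_seg)
  also have "\<dots> = integral {0..1} (\<lambda>r. (z - k) * a (?s r)) * (b * w) -
      integral {0..1} (\<lambda>r. (z - k) * (a (?s r) * ?d (?s r))) * w"
    by simp
  also have "integral {0..1} (\<lambda>r. (z - k) * a (?s r)) = H1 z"
    using integral_unique[OF has_integral_segment_FTC[of R H1 a k z, OF _ assms(3,4)]] deriv_H1
      at_diagonal by (simp add: has_vector_derivative_at_within)
  also have "integral {0..1} (\<lambda>r. (z - k) * (a (?s r) * ?d (?s r))) = H1 z * ?d z - divergence (\<lambda>y. Q t y z k) x"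
    using divergence_entropy_flux[OF assms(1,2), of z] by simp
  finally show ?thesis by (simp add: algebra_simps)
qed

end

section \<open>The two balances\<close>

text \<open>The left-hand side of the RE-inequality, with \<open>L\<close> as a separate argument
  instead of being computed from \<open>u\<close>: truncating \<open>u\<close> then leaves the
  coefficient of the boundary term untouched.\<close>

definition entropy_balance ::
  "real \<Rightarrow> (real^'n) set \<Rightarrow> (real \<Rightarrow> real^'n \<Rightarrow> real \<Rightarrow> real^'n) \<Rightarrow> (real \<Rightarrow> real^'n \<Rightarrow> real \<Rightarrow> real) \<Rightarrow>
   (real^'n \<Rightarrow> real) \<Rightarrow> (real \<times> (real^'n) \<Rightarrow> real) \<Rightarrow> (real \<times> (real^'n) \<Rightarrow> real) \<Rightarrow> real \<Rightarrow>
   (real \<times> (real^'n) \<Rightarrow> real) \<Rightarrow> (real \<Rightarrow> real \<Rightarrow> real) \<Rightarrow> (real \<Rightarrow> real^'n \<Rightarrow> real \<Rightarrow> real \<Rightarrow> real^'n) \<Rightarrow>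
   real \<Rightarrow> real" where
  "entropy_balance T \<Omega> f F uo ub u L \<phi> H Q k =
     (LINT (t, x)|interior_measure T \<Omega>.
            H (u (t, x)) k * deriv (\<lambda>s. \<phi> (s, x)) t
          + Q t x (u (t, x)) k \<bullet> grad (\<lambda>y. \<phi> (t, y)) x)
      + (LINT (t, x)|interior_measure T \<Omega>.
            deriv (\<lambda>s. H s k) (u (t, x))
          * (F t x (u (t, x)) - divergence (\<lambda>y. f t y (u (t, x))) x) * \<phi> (t, x))
      + (LINT (t, x)|interior_measure T \<Omega>.
            divergence (\<lambda>y. Q t y (u (t, x)) k) x * \<phi> (t, x))
      + (LINT x|lebesgue_on \<Omega>. H (uo x) k * \<phi> (0, x))
      + L * (LINT (t, \<xi>)|lateral_measure T \<Omega>. H (ub (t, \<xi>)) k * \<phi> (t, \<xi>))"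

definition kruzkov_balance ::
  "real \<Rightarrow> (real^'n) set \<Rightarrow> (real \<Rightarrow> real^'n \<Rightarrow> real \<Rightarrow> real^'n) \<Rightarrow> (real \<Rightarrow> real^'n \<Rightarrow> real \<Rightarrow> real) \<Rightarrow>
   (real^'n \<Rightarrow> real) \<Rightarrow> (real \<times> (real^'n) \<Rightarrow> real) \<Rightarrow> (real \<times> (real^'n) \<Rightarrow> real) \<Rightarrow> real \<Rightarrow>
   (real \<times> (real^'n) \<Rightarrow> real) \<Rightarrow> (real \<Rightarrow> real) \<Rightarrow> (real \<Rightarrow> real) \<Rightarrow> real \<Rightarrow> real" where
  "kruzkov_balance T \<Omega> f F uo ub u L \<phi> \<theta> sg k =
     (LINT (t, x)|interior_measure T \<Omega>. \<theta> (u (t, x) - k) * deriv (\<lambda>s. \<phi> (s, x)) t)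
      + (LINT (t, x)|interior_measure T \<Omega>.
            sg (u (t, x) - k) * ((f t x (u (t, x)) - f t x k) \<bullet> grad (\<lambda>y. \<phi> (t, y)) x))
      + (LINT (t, x)|interior_measure T \<Omega>.
            sg (u (t, x) - k) * (F t x (u (t, x)) - divergence (\<lambda>y. f t y k) x) * \<phi> (t, x))
      + (LINT x|lebesgue_on \<Omega>. \<theta> (uo x - k) * \<phi> (0, x))
      + L * (LINT (t, \<xi>)|lateral_measure T \<Omega>. \<theta> (ub (t, \<xi>) - k) * \<phi> (t, \<xi>))"

lemma RE_solution_iff:
  "RE_solution T \<Omega> f F uo ub u \<longleftrightarrow> in_Linf (interior_measure T \<Omega>) u \<and>
     (\<forall>H Q k \<phi>. boundary_entropy_pair T \<Omega> f H Q \<longrightarrow> test_function T \<phi> \<longrightarrow>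
        0 \<le> entropy_balance T \<Omega> f F uo ub u (lip_const T \<Omega> f u) \<phi> H Q k)"
  unfolding RE_solution_def entropy_balance_def by (rule refl)

lemma MV_solution_iff:
  "MV_solution T \<Omega> f F uo ub u \<longleftrightarrow> in_Linf (interior_measure T \<Omega>) u \<and>
     (\<forall>k \<phi>. test_function T \<phi> \<longrightarrow>
        0 \<le> kruzkov_balance T \<Omega> f F uo ub u (lip_const T \<Omega> f u) \<phi> pos_part sgn_plus k \<and>
        0 \<le> kruzkov_balance T \<Omega> f F uo ub u (lip_const T \<Omega> f u) \<phi> neg_part sgn_minus k)"
  unfolding MV_solution_def kruzkov_balance_def by simp

lemma interior_lmeasurable:
  fixes T :: real and \<Omega> :: "(real^'n) set"
  assumes "open \<Omega>" "bounded \<Omega>"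
  shows "{0..T} \<times> \<Omega> \<in> lmeasurable"
proof (rule bounded_set_imp_lmeasurable)
  show "bounded ({0..T} \<times> \<Omega>)" by (intro bounded_Times bounded_closed_interval assms(2))
  have "{0..T} \<times> \<Omega> \<in> sets borel" using assms by (intro borel_Times) auto
  then show "{0..T} \<times> \<Omega> \<in> sets lebesgue" by simp
qed

lemma open_lmeasurable: "open \<Omega> \<Longrightarrow> bounded \<Omega> \<Longrightarrow> \<Omega> \<in> lmeasurable"
  by (rule bounded_set_imp_lmeasurable) auto

lemma integral_cong_AE_interior:
  fixes \<Omega> :: "(real^'n) set" and g h :: "real \<times> (real^'n) \<Rightarrow> real"
  assumes "open \<Omega>" "bounded \<Omega>" "AE p in interior_measure T \<Omega>. g p = h p"
  shows "integral\<^sup>L (interior_measure T \<Omega>) g = integral\<^sup>L (interior_measure T \<Omega>) h"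
  using complete_measure.integral_cong_AE_complete[OF complete_measure_lebesgue_on assms(3)]
    interior_lmeasurable[OF assms(1,2)] by blast

lemma integral_cong_AE_initial:
  fixes \<Omega> :: "(real^'n) set" and g h :: "real^'n \<Rightarrow> real"
  assumes "open \<Omega>" "AE p in lebesgue_on \<Omega>. g p = h p"
  shows "integral\<^sup>L (lebesgue_on \<Omega>) g = integral\<^sup>L (lebesgue_on \<Omega>) h"
  using complete_measure.integral_cong_AE_complete[OF complete_measure_lebesgue_on assms(2)]
    assms(1) by simp

lemma integral_cong_AE_lateral:
  fixes g h :: "real \<times> (real^'n) \<Rightarrow> real"
  assumes "AE p in lateral_measure T \<Omega>. g p = h p"
  shows "integral\<^sup>L (lateral_measure T \<Omega>) g = integral\<^sup>L (lateral_measure T \<Omega>) h"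
  using assms unfolding lateral_measure_def by (rule completion.integral_cong_AE_complete)

text \<open>Each integrand depends on the data only through their value at the point of integration,
  and all three measures are complete. Nothing has to be known about \<open>H\<close>,
  \<open>Q\<close>, \<open>f\<close> or \<open>F\<close>.\<close>

lemma balance_cong_AE:
  fixes \<Omega> :: "(real^'n) set"
  assumes "open \<Omega>" "bounded \<Omega>"
    and u: "AE p in interior_measure T \<Omega>. u p = u' p"
    and uo: "AE x in lebesgue_on \<Omega>. uo x = uo' x"
    and ub: "AE p in lateral_measure T \<Omega>. ub p = ub' p"
  shows "entropy_balance T \<Omega> f F uo ub u L \<phi> H Q k = entropy_balance T \<Omega> f F uo' ub' u' L \<phi> H Q k"
    and "kruzkov_balance T \<Omega> f F uo ub u L \<phi> \<theta> sg k = kruzkov_balance T \<Omega> f F uo' ub' u' L \<phi> \<theta> sg k"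
proof -
  have interior: "(LINT (t, x)|interior_measure T \<Omega>. g t x (u (t, x))) = (LINT (t, x)|interior_measure T \<Omega>. g t x (u' (t, x)))"
    for g :: "real \<Rightarrow> real^'n \<Rightarrow> real \<Rightarrow> real"
    by (rule integral_cong_AE_interior[OF assms(1,2)], rule eventually_mono[OF u]) auto
  have initial: "(LINT x|lebesgue_on \<Omega>. g x (uo x)) = (LINT x|lebesgue_on \<Omega>. g x (uo' x))"
    for g :: "real^'n \<Rightarrow> real \<Rightarrow> real"
    by (rule integral_cong_AE_initial[OF assms(1)], rule eventually_mono[OF uo]) auto
  have lateral: "(LINT (t, x)|lateral_measure T \<Omega>. g t x (ub (t, x))) = (LINT (t, x)|lateral_measure T \<Omega>. g t x (ub' (t, x)))"
    for g :: "real \<Rightarrow> real^'n \<Rightarrow> real \<Rightarrow> real"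
    by (rule integral_cong_AE_lateral, rule eventually_mono[OF ub]) auto
  show "entropy_balance T \<Omega> f F uo ub u L \<phi> H Q k = entropy_balance T \<Omega> f F uo' ub' u' L \<phi> H Q k"
    unfolding entropy_balance_def
      interior[of "\<lambda>t x v. H v k * deriv (\<lambda>s. \<phi> (s, x)) t + Q t x v k \<bullet> grad (\<lambda>y. \<phi> (t, y)) x"]
      interior[of "\<lambda>t x v. deriv (\<lambda>s. H s k) v * (F t x v - divergence (\<lambda>y. f t y v) x) * \<phi> (t, x)"]
      interior[of "\<lambda>t x v. divergence (\<lambda>y. Q t y v k) x * \<phi> (t, x)"]
      initial[of "\<lambda>x v. H v k * \<phi> (0, x)"] lateral[of "\<lambda>t x v. H v k * \<phi> (t, x)"]
    by (rule refl)
  show "kruzkov_balance T \<Omega> f F uo ub u L \<phi> \<theta> sg k = kruzkov_balance T \<Omega> f F uo' ub' u' L \<phi> \<theta> sg k"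
    unfolding kruzkov_balance_def
      interior[of "\<lambda>t x v. \<theta> (v - k) * deriv (\<lambda>s. \<phi> (s, x)) t"]
      interior[of "\<lambda>t x v. sg (v - k) * ((f t x v - f t x k) \<bullet> grad (\<lambda>y. \<phi> (t, y)) x)"]
      interior[of "\<lambda>t x v. sg (v - k) * (F t x v - divergence (\<lambda>y. f t y k) x) * \<phi> (t, x)"]
      initial[of "\<lambda>x v. \<theta> (v - k) * \<phi> (0, x)"] lateral[of "\<lambda>t x v. \<theta> (v - k) * \<phi> (t, x)"]
    by (rule refl)
qed

lemma borel_measurable_id_lateral: "(\<lambda>p. p) \<in> borel_measurable (lateral_measure T \<Omega>)"
  for \<Omega> :: "(real^'n) set"
proof -
  let ?M = "restrict_space lborel {0..T} \<Otimes>\<^sub>M surface_measure \<Omega>"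
  have 1: "(\<lambda>p. fst p) \<in> borel_measurable ?M"
    by (rule measurable_compose[OF measurable_fst measurable_restrict_space1]) simp
  have "(\<lambda>\<xi>. \<xi>) \<in> borel_measurable (surface_measure \<Omega>)"
    by (simp add: measurable_cong_sets[OF sets_surface_measure refl] measurable_restrict_space1)
  then have 2: "(\<lambda>p. snd p) \<in> borel_measurable ?M"
    by (rule measurable_compose[OF measurable_snd])
  have "(\<lambda>p. (fst p, snd p)) \<in> borel_measurable ?M" using 1 2 by (rule borel_measurable_Pair)
  then show ?thesis unfolding lateral_measure_def by (intro measurable_completion) simp
qed

text \<open>The data after truncation: the bound \<open>R\<close> holds at every point and not just
  almost everywhere, so the kernel identities apply pointwise under the integrals.\<close>

locale bounded_data =
  fixes T :: real and \<Omega> :: "(real^'n) set"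
    and f :: "real \<Rightarrow> real^'n \<Rightarrow> real \<Rightarrow> real^'n" and F :: "real \<Rightarrow> real^'n \<Rightarrow> real \<Rightarrow> real"
    and uo :: "real^'n \<Rightarrow> real" and ub u \<phi> :: "real \<times> (real^'n) \<Rightarrow> real" and L R :: real
  assumes domain: "open \<Omega>" "bounded \<Omega>" "smooth_boundary \<Omega>"
    and Ck_flux: "Ck_on 2 ({0..T} \<times> closure \<Omega> \<times> UNIV) (\<lambda>(t, x, v). f t x v)"
    and Ck_source: "Ck_on 2 ({0..T} \<times> closure \<Omega> \<times> UNIV) (\<lambda>(t, x, v). F t x v)"
    and meas: "uo \<in> borel_measurable (lebesgue_on \<Omega>)" "ub \<in> borel_measurable (lateral_measure T \<Omega>)"
      "u \<in> borel_measurable (interior_measure T \<Omega>)"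
    and range: "uo x \<in> {-R..R}" "ub p \<in> {-R..R}" "u p \<in> {-R..R}"
    and test: "test_function T \<phi>"
begin

abbreviation N where "N \<equiv> restrict_space lborel {-R..R}"

text \<open>The MV-integrands at level \<open>c\<close> without their sign factor; as both
  semi-entropies have the form \<open>sg s * s\<close>, the time, initial and boundary terms fit
  this pattern too. \<open>\<psi>_reaction\<close> is no MV-term: it does not depend on
  \<open>c\<close> and serves to separate two RE-integrals.\<close>

abbreviation \<psi>_time where "\<psi>_time \<equiv> \<lambda>c p. (u p - c) * deriv (\<lambda>s. \<phi> (s, snd p)) (fst p)"
abbreviation \<psi>_flux where "\<psi>_flux \<equiv> \<lambda>c p. (f (fst p) (snd p) (u p) - f (fst p) (snd p) c) \<bullet> grad (\<lambda>y. \<phi> (fst p, y)) (snd p)"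
abbreviation \<psi>_source where "\<psi>_source \<equiv> \<lambda>c p. (F (fst p) (snd p) (u p) - divergence (\<lambda>y. f (fst p) y c) (snd p)) * \<phi> p"
abbreviation \<psi>_reaction where "\<psi>_reaction \<equiv> \<lambda>c::real. \<lambda>p. (F (fst p) (snd p) (u p) - divergence (\<lambda>y. f (fst p) y (u p)) (snd p)) * \<phi> p"
abbreviation \<psi>_initial where "\<psi>_initial \<equiv> \<lambda>c x. (uo x - c) * \<phi> (0, x)"
abbreviation \<psi>_boundary where "\<psi>_boundary \<equiv> \<lambda>c p. (ub p - c) * \<phi> p"

lemma norm_range: "norm (uo x) \<le> R" "norm (ub p) \<le> R" "norm (u p) \<le> R"
  using range(1)[of x] range(2)[of p] range(3)[of p] by (auto simp: abs_real_def)

lemma finite_measures: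
  "finite_measure (interior_measure T \<Omega>)" "finite_measure (lebesgue_on \<Omega>)" "finite_measure (lateral_measure T \<Omega>)"
  by (rule finite_measure_lebesgue_on[OF interior_lmeasurable[OF domain(1,2)]]
      finite_measure_lebesgue_on[OF open_lmeasurable[OF domain(1,2)]]
      finite_measure_lateral_measure[OF domain])+

lemma divergence_extends: "extends_continuously T \<Omega> (\<lambda>t x v. divergence (\<lambda>y. f t y v) x)"
  using extends_continuously_divergence[of 1 T \<Omega> f] Ck_flux domain by (simp add: numeral_2_eq_2)

lemma admissible_test: "admissible R (interior_measure T \<Omega>) (\<lambda>c. \<phi>)"
  using admissible_extends_state[OF extends_continuously_test_function(1)[OF test] domain(2) meas(3) range(3)] by simp

lemma admissible_u: "admissible R (interior_measure T \<Omega>) (\<lambda>c. u)"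
  by (rule admissible_state[OF meas(3) norm_range(3)])

lemma admissible_interior:
  "admissible R (interior_measure T \<Omega>) \<psi>_time"
  "admissible R (interior_measure T \<Omega>) \<psi>_flux"
  "admissible R (interior_measure T \<Omega>) \<psi>_source"
  "admissible R (interior_measure T \<Omega>) \<psi>_reaction"
proof -
  note state = admissible_extends_state[OF _ domain(2) meas(3) range(3), of _ R]
  note param = admissible_extends_parameter[OF _ domain(2), of T _ R]
  note ext = extends_continuously_Ck_on[OF Ck_flux] extends_continuously_Ck_on[OF Ck_source]
    divergence_extends extends_continuously_test_function[OF test]
  show "admissible R (interior_measure T \<Omega>) \<psi>_time"
    by (rule admissible_mult[OF admissible_diff[OF admissible_u admissible_parameter] state[OF ext(5)]])
  show "admissible R (interior_measure T \<Omega>) \<psi>_flux"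
    by (rule admissible_inner[OF admissible_diff[OF state[OF ext(1)] param[OF ext(1)]] state[OF ext(6)]])
  show "admissible R (interior_measure T \<Omega>) \<psi>_source"
    by (rule admissible_mult[OF admissible_diff[OF state[OF ext(2)] param[OF ext(3)]] admissible_test])
  show "admissible R (interior_measure T \<Omega>) \<psi>_reaction"
    by (rule admissible_mult[OF admissible_diff[OF state[OF ext(2)] state[OF ext(3)]] admissible_test])
qed

lemma admissible_initial: "admissible R (lebesgue_on \<Omega>) \<psi>_initial"
proof -
  obtain B where B: "\<And>p. \<bar>\<phi> p\<bar> \<le> B" using test_function_bounded[OF test] by blast
  have "continuous_on UNIV (\<lambda>x. \<phi> (0, x))"
    by (rule continuous_on_compose2[OF test_function_continuous[OF test]]) (auto intro!: continuous_intros)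
  then have "(\<lambda>x. \<phi> (0, x)) \<in> borel_measurable (lebesgue_on \<Omega>)"
    by (intro measurable_restrict_space1 measurable_completion) (simp add: borel_measurable_continuous_onI)
  then have 1: "admissible R (lebesgue_on \<Omega>) (\<lambda>c x. \<phi> (0, x))"
    using B by (intro admissible_state[of _ _ B]) auto
  have 2: "admissible R (lebesgue_on \<Omega>) (\<lambda>c. uo)"
    by (rule admissible_state[OF meas(1) norm_range(1)])
  show ?thesis by (rule admissible_mult[OF admissible_diff[OF 2 admissible_parameter] 1])
qed

lemma admissible_boundary: "admissible R (lateral_measure T \<Omega>) \<psi>_boundary"
proof -
  obtain B where B: "\<And>p. \<bar>\<phi> p\<bar> \<le> B" using test_function_bounded[OF test] by blast
  have "\<phi> \<in> borel_measurable (lateral_measure T \<Omega>)"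
    using measurable_compose[OF borel_measurable_id_lateral
        borel_measurable_continuous_onI[OF test_function_continuous[OF test]]] by simp
  then have 1: "admissible R (lateral_measure T \<Omega>) (\<lambda>c. \<phi>)"
    using B by (intro admissible_state[of _ _ B]) auto
  have 2: "admissible R (lateral_measure T \<Omega>) (\<lambda>c. ub)"
    by (rule admissible_state[OF meas(2) norm_range(2)])
  show ?thesis by (rule admissible_mult[OF admissible_diff[OF 2 admissible_parameter] 1])
qed

text \<open>Glues the plus balances above \<open>k\<close> and the minus balances below into one
  function of the level, so that a single density can be integrated against it.\<close>

definition kinetic_balance :: "real \<Rightarrow> real \<Rightarrow> real" where
  "kinetic_balance k c =
     (LINT p|interior_measure T \<Omega>. kernel k (u p) c * \<psi>_time c p)
   + (LINT p|interior_measure T \<Omega>. kernel k (u p) c * \<psi>_flux c p)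
   + (LINT p|interior_measure T \<Omega>. kernel k (u p) c * \<psi>_source c p)
   + (LINT x|lebesgue_on \<Omega>. kernel k (uo x) c * \<psi>_initial c x)
   + L * (LINT p|lateral_measure T \<Omega>. kernel k (ub p) c * \<psi>_boundary c p)"

lemma kruzkov_balance_eq:
  assumes "\<And>s. \<theta> s = sg s * s"
  shows "kruzkov_balance T \<Omega> f F uo ub u L \<phi> \<theta> sg c =
     (LINT p|interior_measure T \<Omega>. sg (u p - c) * \<psi>_time c p)
   + (LINT p|interior_measure T \<Omega>. sg (u p - c) * \<psi>_flux c p)
   + (LINT p|interior_measure T \<Omega>. sg (u p - c) * \<psi>_source c p)
   + (LINT x|lebesgue_on \<Omega>. sg (uo x - c) * \<psi>_initial c x)
   + L * (LINT p|lateral_measure T \<Omega>. sg (ub p - c) * \<psi>_boundary c p)"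
  by (simp add: kruzkov_balance_def assms case_prod_unfold mult.assoc)

lemma part_eq_sgn: "pos_part s = sgn_plus s * s" "neg_part s = sgn_minus s * s"
  by (auto simp: pos_part_def neg_part_def sgn_plus_def sgn_minus_def)

lemma kinetic_balance_eq_kruzkov:
  "k < c \<Longrightarrow> kinetic_balance k c = kruzkov_balance T \<Omega> f F uo ub u L \<phi> pos_part sgn_plus c"
  "c \<le> k \<Longrightarrow> kinetic_balance k c = kruzkov_balance T \<Omega> f F uo ub u L \<phi> neg_part sgn_minus c"
  by (simp_all add: kruzkov_balance_eq part_eq_sgn kinetic_balance_def kernel_def)

lemma kinetic_balance_tendsto:
  assumes "X \<longlonglongrightarrow> k" "\<And>n. X n \<in> {-R..R}" "k \<in> {-R..R}"
    and "sg = sgn_plus \<and> (\<forall>n. X n > k) \<or> sg = sgn_minus \<and> (\<forall>n. X n < k)"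
    and "\<And>s. \<theta> s = sg s * s"
  shows "(\<lambda>n. kinetic_balance k (X n)) \<longlonglongrightarrow> kruzkov_balance T \<Omega> f F uo ub u L \<phi> \<theta> sg k"
  unfolding kruzkov_balance_eq[OF assms(5)] kinetic_balance_def
  by (rule tendsto_add tendsto_mult tendsto_const
      admissible_kernel_tendsto[OF admissible_interior(1) finite_measures(1) meas(3) assms(1-4)]
      admissible_kernel_tendsto[OF admissible_interior(2) finite_measures(1) meas(3) assms(1-4)]
      admissible_kernel_tendsto[OF admissible_interior(3) finite_measures(1) meas(3) assms(1-4)]
      admissible_kernel_tendsto[OF admissible_initial finite_measures(2) meas(1) assms(1-4)]
      admissible_kernel_tendsto[OF admissible_boundary finite_measures(3) meas(2) assms(1-4)])+

lemma entropy_balance_eq: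
  assumes ep: "entropy_pair T \<Omega> f H Q k a" and k: "k \<in> {-R..R}"
  shows "integrable N (\<lambda>c. a c * kinetic_balance k c)"
    and "entropy_balance T \<Omega> f F uo ub u L \<phi> H Q k = (LINT c|N. a c * kinetic_balance k c)"
proof -
  interpret entropy_pair T \<Omega> f H Q k a by (rule ep)
  have ca: "continuous_on {-R..R} a" using cont_a continuous_on_subset by blast
  note time = admissible_kernel_Fubini[OF admissible_interior(1) finite_measures(1) meas(3) ca, of k]
  note flux = admissible_kernel_Fubini[OF admissible_interior(2) finite_measures(1) meas(3) ca, of k]
  note source = admissible_kernel_Fubini[OF admissible_interior(3) finite_measures(1) meas(3) ca, of k]
  note reaction = admissible_kernel_Fubini[OF admissible_interior(4) finite_measures(1) meas(3) ca, of k]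
  note initial = admissible_kernel_Fubini[OF admissible_initial finite_measures(2) meas(1) ca, of k]
  note boundary = admissible_kernel_Fubini[OF admissible_boundary finite_measures(3) meas(2) ca, of k]
  let ?A = "\<lambda>\<psi> p. LINT c|N. a c * (kernel k (u p) c * \<psi> c p)"
  have inter: "fst p \<in> {0..T}" "snd p \<in> \<Omega>" if "p \<in> space (interior_measure T \<Omega>)" for p
    using that by (auto simp: space_restrict_space)
  \<comment> \<open>The RE-notion joins the time and flux terms in one integral, the MV-notion
    separates them; integrability of both superpositions permits the split.\<close>
  have J1: "(LINT (t, x)|interior_measure T \<Omega>. H (u (t, x)) k * deriv (\<lambda>s. \<phi> (s, x)) t
        + Q t x (u (t, x)) k \<bullet> grad (\<lambda>y. \<phi> (t, y)) x) =
      (LINT p|interior_measure T \<Omega>. ?A \<psi>_time p) + (LINT p|interior_measure T \<Omega>. ?A \<psi>_flux p)"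
    unfolding Bochner_Integration.integral_add[OF time(1) flux(1), symmetric]
  proof (rule Bochner_Integration.integral_cong[OF refl])
    fix p assume p: "p \<in> space (interior_measure T \<Omega>)"
    show "(case p of (t, x) \<Rightarrow> H (u (t, x)) k * deriv (\<lambda>s. \<phi> (s, x)) t
        + Q t x (u (t, x)) k \<bullet> grad (\<lambda>y. \<phi> (t, y)) x) = ?A \<psi>_time p + ?A \<psi>_flux p"
      unfolding kernel_integral_entropy[OF k range(3)]
        kernel_integral_entropy_flux[OF inter[OF p] k range(3)] by (simp add: case_prod_unfold)
  qed
  have J2: "(LINT (t, x)|interior_measure T \<Omega>. deriv (\<lambda>s. H s k) (u (t, x))
          * (F t x (u (t, x)) - divergence (\<lambda>y. f t y (u (t, x))) x) * \<phi> (t, x)) =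
      (LINT p|interior_measure T \<Omega>. ?A \<psi>_reaction p)"
  proof (rule Bochner_Integration.integral_cong[OF refl])
    fix p assume p: "p \<in> space (interior_measure T \<Omega>)"
    show "(case p of (t, x) \<Rightarrow> deriv (\<lambda>s. H s k) (u (t, x))
          * (F t x (u (t, x)) - divergence (\<lambda>y. f t y (u (t, x))) x) * \<phi> (t, x)) = ?A \<psi>_reaction p"
      unfolding kernel_integral_deriv_entropy[OF k range(3)] by (simp add: case_prod_unfold)
  qed
  \<comment> \<open>\<open>kernel_integral_source\<close> yields only the sum of the reaction term
    and the divergence of \<open>Q\<close>, whereas these are two separate integrals here.
    Subtracting the integrable reaction term isolates the divergence of \<open>Q\<close>.\<close>
  have J3: "(LINT (t, x)|interior_measure T \<Omega>. divergence (\<lambda>y. Q t y (u (t, x)) k) x * \<phi> (t, x)) =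
      (LINT p|interior_measure T \<Omega>. ?A \<psi>_source p) - (LINT p|interior_measure T \<Omega>. ?A \<psi>_reaction p)"
    unfolding Bochner_Integration.integral_diff[OF source(1) reaction(1), symmetric]
  proof (rule Bochner_Integration.integral_cong[OF refl])
    fix p assume p: "p \<in> space (interior_measure T \<Omega>)"
    show "(case p of (t, x) \<Rightarrow> divergence (\<lambda>y. Q t y (u (t, x)) k) x * \<phi> (t, x)) = ?A \<psi>_source p - ?A \<psi>_reaction p"
      unfolding kernel_integral_deriv_entropy[OF k range(3)]
        kernel_integral_source[OF inter[OF p] k range(3)] by (simp add: case_prod_unfold algebra_simps)
  qed
  have J4: "(LINT x|lebesgue_on \<Omega>. H (uo x) k * \<phi> (0, x)) =
      (LINT x|lebesgue_on \<Omega>. LINT c|N. a c * (kernel k (uo x) c * \<psi>_initial c x))"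
    by (simp add: kernel_integral_entropy[OF k range(1)])
  have J5: "(LINT (t, \<xi>)|lateral_measure T \<Omega>. H (ub (t, \<xi>)) k * \<phi> (t, \<xi>)) =
      (LINT p|lateral_measure T \<Omega>. LINT c|N. a c * (kernel k (ub p) c * \<psi>_boundary c p))"
    by (simp add: kernel_integral_entropy[OF k range(2)] case_prod_unfold)
  let ?I = "\<lambda>c. a c * (LINT p|interior_measure T \<Omega>. kernel k (u p) c * \<psi>_time c p)
      + a c * (LINT p|interior_measure T \<Omega>. kernel k (u p) c * \<psi>_flux c p)
      + a c * (LINT p|interior_measure T \<Omega>. kernel k (u p) c * \<psi>_source c p)
      + a c * (LINT x|lebesgue_on \<Omega>. kernel k (uo x) c * \<psi>_initial c x)
      + L * (a c * (LINT p|lateral_measure T \<Omega>. kernel k (ub p) c * \<psi>_boundary c p))"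
  have eq: "a c * kinetic_balance k c = ?I c" for c
    by (simp add: kinetic_balance_def algebra_simps)
  note int = time(2) flux(2) source(2) initial(2) boundary(2)
  show "integrable N (\<lambda>c. a c * kinetic_balance k c)"
    unfolding eq by (intro Bochner_Integration.integrable_add integrable_mult_right int)
  have "(LINT c|N. ?I c) = (LINT c|N. a c * (LINT p|interior_measure T \<Omega>. kernel k (u p) c * \<psi>_time c p))
      + (LINT c|N. a c * (LINT p|interior_measure T \<Omega>. kernel k (u p) c * \<psi>_flux c p))
      + (LINT c|N. a c * (LINT p|interior_measure T \<Omega>. kernel k (u p) c * \<psi>_source c p))
      + (LINT c|N. a c * (LINT x|lebesgue_on \<Omega>. kernel k (uo x) c * \<psi>_initial c x))
      + L * (LINT c|N. a c * (LINT p|lateral_measure T \<Omega>. kernel k (ub p) c * \<psi>_boundary c p))"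
    by (subst Bochner_Integration.integral_add, (intro Bochner_Integration.integrable_add integrable_mult_right int)+)+
      simp
  then show "entropy_balance T \<Omega> f F uo ub u L \<phi> H Q k = (LINT c|N. a c * kinetic_balance k c)"
    unfolding eq entropy_balance_def J1 J2 J3 J4 J5 time(3) flux(3) source(3) initial(3) boundary(3)
    by simp
qed

end

section \<open>Entropy pairs with prescribed second derivative\<close>

lemma Ck_open_fst: "Ck_open k V g \<Longrightarrow> Ck_open k V (\<lambda>p. fst (g p))"
  by (rule Ck_open_linear_compose[OF bounded_linear_fst])

lemma Ck_open_snd: "Ck_open k V g \<Longrightarrow> Ck_open k V (\<lambda>p. snd (g p))"
  by (rule Ck_open_linear_compose[OF bounded_linear_snd])

lemma Ck_open_ident: "Ck_open k V (\<lambda>p. p)"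
  by (rule Ck_open_bounded_linear[OF bounded_linear_ident])

text \<open>Primitives are at hand on bounded intervals only. The explicit formula for
  \<open>G\<close> does not mention the interval and agrees there with the local primitive
  \<open>P\<close> up to \<open>P 0\<close>.\<close>

lemma antiderivative_on_UNIV:
  fixes g :: "real \<Rightarrow> 'b::banach"
  assumes "continuous_on UNIV g"
  obtains G where "\<And>s. (G has_vector_derivative g s) (at s)" "G 0 = 0"
proof -
  define G where "G s = integral {0..1} (\<lambda>r. s *\<^sub>R g (r * s))" for s
  have "(G has_vector_derivative g s) (at s)" for s
  proof -
  define R where "R = \<bar>s\<bar> + 1"
  obtain P where P: "\<And>c. c \<in> {-R..R} \<Longrightarrow> (P has_vector_derivative g c) (at c within {-R..R})"
    using antiderivative_continuous[OF continuous_on_subset[OF assms]] by (metis subset_UNIV)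
  have eq: "G y = P y - P 0" if "y \<in> {-R<..<R}" for y
    unfolding G_def using integral_unique[OF has_integral_segment_FTC[OF P, of 0 y]] that by auto
  have s: "s \<in> {-R<..<R}" by (auto simp: R_def)
  have "(P has_vector_derivative g s) (at s within {-R<..<R})"
    by (rule has_vector_derivative_within_subset[OF P]) (use s in auto)
  then have "(P has_vector_derivative g s) (at s)"
    using at_within_open[OF s] by simp
  from has_vector_derivative_diff[OF this has_vector_derivative_const[of "P 0"]]
  have "((\<lambda>y. P y - P 0) has_vector_derivative g s) (at s)" by simp
  then show ?thesis
    by (rule has_vector_derivative_transform_within_open[OF _ open_greaterThanLessThan s]) (use eq in simp)
  qed
  then show thesis by (rule that[of G]) (simp add: G_def)
qed

text \<open>For a density \<open>c\<close> this is \<open>\<integral> c (s - w) (g z - g s) ds\<close> over the oriented segment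
  from \<open>w\<close> to \<open>z\<close>, written over a fixed interval so that smoothness in all variables is visible.
  With \<open>g s = s\<close> it is an entropy with second derivative \<open>c (z - w)\<close>, and with \<open>g = f t x\<close> the
  corresponding flux.\<close>

definition segment_transform :: "(real \<Rightarrow> real) \<Rightarrow> (real \<Rightarrow> 'b::euclidean_space) \<Rightarrow> real \<Rightarrow> real \<Rightarrow> 'b" where
  "segment_transform c g z w =
     integral {0..1} (\<lambda>r. ((z - w) * c (r * (z - w))) *\<^sub>R (g z - g (w + r * (z - w))))"

lemma segment_transform_diagonal: "segment_transform c g w w = 0"
  by (simp add: segment_transform_def)

text \<open>The variable \<open>z\<close> occurs both as an end point and inside the integrand. With
  \<open>P\<close> a primitive of \<open>c (s - w) *\<^sub>R g s\<close>, integration by parts gives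
  \<open>C (z - w) *\<^sub>R g z - P z + P w\<close>, and on differentiating the terms with
  \<open>c\<close> cancel.\<close>

lemma segment_transform_derivative:
  fixes g :: "real \<Rightarrow> 'b::euclidean_space"
  assumes c: "continuous_on UNIV c" and C: "\<And>s. (C has_real_derivative c s) (at s)" "C 0 = 0"
    and g: "\<And>s. (g has_vector_derivative g' s) (at s)"
  shows "((\<lambda>z. segment_transform c g z w) has_vector_derivative C (z - w) *\<^sub>R g' z) (at z)"
proof -
  have contg: "continuous_on UNIV g"
    using g by (auto intro!: continuous_at_imp_continuous_on has_vector_derivative_continuous)
  have "continuous_on UNIV (\<lambda>s. c (s - w) *\<^sub>R g s)"
    by (intro continuous_intros contg continuous_on_compose2[OF c]) auto
  then obtain P where P: "\<And>s. (P has_vector_derivative c (s - w) *\<^sub>R g s) (at s)"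
    by (rule antiderivative_on_UNIV) blast
  have Cw: "((\<lambda>s. C (s - w)) has_real_derivative c (s - w)) (at s)" for s
    using DERIV_shift[THEN iffD1, of C "c (s - w)" s "- w"] C(1)[of "s - w"] by simp
  have eq: "segment_transform c g y w = C (y - w) *\<^sub>R g y - P y + P w" for y
  proof -
    define R where "R = max \<bar>y\<bar> \<bar>w\<bar>"
    have R: "w \<in> {-R..R}" "y \<in> {-R..R}" by (auto simp: R_def)
    have "((\<lambda>s. C (s - w) *\<^sub>R g y - P s) has_vector_derivative c (s - w) *\<^sub>R (g y - g s)) (at s)" for s
      using has_vector_derivative_diff[OF has_vector_derivative_scaleR[OF Cw has_vector_derivative_const[of "g y"]] P[of s]]
      by (simp add: algebra_simps)
    from integral_unique[OF has_integral_segment_FTC[OF has_vector_derivative_at_within[OF this] R]]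
    show ?thesis by (simp add: segment_transform_def C(2) algebra_simps)
  qed
  have "((\<lambda>y. C (y - w) *\<^sub>R g y - P y) has_vector_derivative C (z - w) *\<^sub>R g' z) (at z)"
    using has_vector_derivative_diff[OF has_vector_derivative_scaleR[OF Cw g] P[of z]] by simp
  from has_vector_derivative_add[OF this has_vector_derivative_const[of "P w"]]
  show ?thesis unfolding eq by simp
qed

text \<open>The points whose whole state segment stays in the domain \<open>V\<close> of the
  extended flux; on this set an extended \<open>Q\<close> makes sense. Openness is the tube lemma
  for the compact parameter interval.\<close>

lemma open_segment_condition:
  fixes V :: "(real \<times> (real^'n) \<times> real) set"
  assumes "open V"
  shows "open {(t, x, z, w). \<forall>r\<in>{0..1}. (t, x, w + r * (z - w)) \<in> V}"
    (is "open ?W")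
proof (subst open_subopen, intro ballI)
  fix q assume q: "q \<in> ?W"
  let ?m = "\<lambda>(q :: real \<times> (real^'n) \<times> real \<times> real, r :: real). (fst q, fst (snd q), snd (snd (snd q)) + r * (fst (snd (snd q)) - snd (snd (snd q))))"
  have "continuous_on UNIV ?m" unfolding case_prod_unfold by (intro continuous_intros)
  then have op: "open (?m -` V)" using assms by (simp add: open_vimage)
  have "{q} \<times> {0..1} \<subseteq> ?m -` V" using q by auto
  from Elementary_Topology.tube_lemma[OF compact_Icc op this]
  obtain X where X: "q \<in> X" "open X" "X \<times> {0..1} \<subseteq> ?m -` V" by blast
  have "X \<subseteq> ?W"
  proof
    fix y assume "y \<in> X"
    obtain t x z w where y: "y = (t, x, z, w)" by (cases y)
    have "(y, r) \<in> ?m -` V" if "r \<in> {0..1}" for r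
      using X(3) \<open>y \<in> X\<close> that by blast
    then show "y \<in> ?W" by (simp add: y)
  qed
  then show "\<exists>X. open X \<and> q \<in> X \<and> X \<subseteq> ?W" using X(1,2) by blast
qed

text \<open>The same transform is applied to the identity for \<open>H\<close> and to
  \<open>f t x\<close> for \<open>Q\<close>. Both state derivatives carry the factor
  \<open>C (z - w)\<close>, which is the compatibility condition; convexity holds because
  \<open>C\<close> is nondecreasing.\<close>

lemma entropy_pair_of_density:
  fixes f :: "real \<Rightarrow> real^'n \<Rightarrow> real \<Rightarrow> real^'n"
  assumes c: "Ck_open 2 UNIV c" "\<And>s. 0 \<le> c s"
    and flux: "Ck_on 2 ({0..T} \<times> closure \<Omega> \<times> UNIV) (\<lambda>(t, x, v). f t x v)"
  obtains H Q where "boundary_entropy_pair T \<Omega> f H Q"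
    "\<And>k z. ((\<lambda>s. H s k) has_real_derivative deriv (\<lambda>s. H s k) z) (at z)"
    "\<And>k z. (deriv (\<lambda>s. H s k) has_real_derivative c (z - k)) (at z)"
proof -
  have cc: "continuous_on UNIV c" using c(1) by (rule Ck_open_imp_continuous_on)
  obtain C where C: "\<And>s. (C has_real_derivative c s) (at s)" "C 0 = 0"
    using antiderivative_on_UNIV[OF cc] by (metis has_real_derivative_iff_has_vector_derivative)
  define H where "H = segment_transform c (\<lambda>s. s)"
  let ?S = "{0..T} \<times> closure \<Omega> \<times> (UNIV::real set)"
  obtain V h where V: "open V" "?S \<subseteq> V" "Ck_open 2 V h" "\<And>q. q \<in> ?S \<Longrightarrow> h q = (\<lambda>(t, x, v). f t x v) q"
    using flux unfolding Ck_on_def by metis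
  define Q where "Q t x = segment_transform c (f t x)" for t x
  \<comment> \<open>Smoothness of \<open>Q\<close> has to hold on an open neighbourhood, where
    \<open>f\<close> is replaced by its extension \<open>h\<close>. Over
    \<open>{0..T} \<times> closure \<Omega>\<close> the set contains all pairs of states, since
    \<open>V\<close> contains the full state line there.\<close>
  define W where "W = {(t, x, z, w). \<forall>r\<in>{0..1}. (t, x, w + r * (z - w)) \<in> V}"
  have W: "open W" unfolding W_def by (rule open_segment_condition[OF V(1)])
  have f_der: "(f t x has_vector_derivative d3 f t x s) (at s)" if "t \<in> {0..T}" "x \<in> closure \<Omega>" for t x s
    by (rule has_vector_derivative_state_section[of 1]) (use flux that in \<open>auto simp: numeral_2_eq_2\<close>)
  have dH: "((\<lambda>s. H s k) has_real_derivative C (z - k)) (at z)" for k z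
    unfolding H_def has_real_derivative_iff_has_vector_derivative
    using segment_transform_derivative[OF cc C, of "\<lambda>s. s" "\<lambda>s. 1" k z] by (simp add: has_vector_derivative_id)
  then have derivH: "deriv (\<lambda>s. H s k) = (\<lambda>z. C (z - k))" for k
    using DERIV_imp_deriv by blast
  have dC: "((\<lambda>z. C (z - k)) has_real_derivative c (z - k)) (at z)" for k z
    using DERIV_shift[THEN iffD1, of C "c (z - k)" z "- k"] C(1)[of "z - k"] by simp
  have C_mono: "C x \<le> C y" if "x \<le> y" for x y
    using DERIV_nonneg_imp_nondecreasing[OF that] C(1) c(2) by blast
  have "boundary_entropy_pair T \<Omega> f H Q"
    unfolding boundary_entropy_pair_def
  proof (intro conjI allI ballI)
    let ?G = "\<lambda>(q, r). ((fst q - snd q) * c (r * (fst q - snd q))) *\<^sub>R (fst q - (snd q + r * (fst q - snd q)))"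
    have "Ck_open 2 UNIV ?G"
      unfolding case_prod_unfold
      by (intro Ck_open_scaleR Ck_open_mult Ck_open_diff Ck_open_add Ck_open_fst Ck_open_snd Ck_open_ident
          Ck_open_compose[OF c(1)]) auto
    then have "Ck_open 2 UNIV (\<lambda>q. integral {0..1} (\<lambda>r. ?G (q, r)))"
      by (rule Ck_open_param_integral) auto
    then show "Ck_on 2 UNIV (\<lambda>(z, w). H z w)"
      unfolding Ck_on_UNIV H_def segment_transform_def by (simp add: case_prod_unfold)
    let ?m = "\<lambda>q r. (fst q, fst (snd q), snd (snd (snd q)) + r * (fst (snd (snd q)) - snd (snd (snd q))))"
    let ?g = "\<lambda>q r. ((fst (snd (snd q)) - snd (snd (snd q))) * c (r * (fst (snd (snd q)) - snd (snd (snd q))))) *\<^sub>R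
        (h (fst q, fst (snd q), fst (snd (snd q))) - h (?m q r))"
    let ?D = "{y. ?m (fst y) (snd y) \<in> V \<and> (fst (fst y), fst (snd (fst y)), fst (snd (snd (fst y)))) \<in> V}"
    have "Ck_open 2 ?D (\<lambda>y. ?g (fst y) (snd y))"
      by (intro Ck_open_scaleR Ck_open_mult Ck_open_diff Ck_open_add Ck_open_fst Ck_open_snd Ck_open_ident
          Ck_open_Pair Ck_open_compose[OF c(1)] Ck_open_compose[OF V(3)]) auto
    moreover have "W \<times> {0..1} \<subseteq> ?D"
    proof
      fix y assume y: "y \<in> W \<times> {0..1::real}"
      obtain q r where qr: "y = (q, r)" by (cases y)
      obtain t x z w where q: "q = (t, x, z, w)" by (cases q)
      have "\<forall>r\<in>{0..1}. (t, x, w + r * (z - w)) \<in> V" "r \<in> {0..1}" using y by (auto simp: W_def q qr)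
      \<comment> \<open>The parameter value 1 gives the end point \<open>z\<close>, where
        \<open>h\<close> is evaluated as well.\<close>
      from bspec[OF this] bspec[OF this(1), of 1] show "y \<in> ?D" by (simp add: q qr)
    qed
    ultimately have "Ck_open 2 W (\<lambda>q. integral {0..1} (\<lambda>r. ?g q r))"
      using Ck_open_param_integral[of 2 ?D "\<lambda>y. ?g (fst y) (snd y)" W] W by simp
    moreover have "{0..T} \<times> closure \<Omega> \<times> UNIV \<times> UNIV \<subseteq> W" using V(2) by (auto simp: W_def)
    moreover have "integral {0..1} (\<lambda>r. ?g q r) = (\<lambda>(t, x, z, w). Q t x z w) q"
      if "q \<in> {0..T} \<times> closure \<Omega> \<times> UNIV \<times> UNIV" for q
      using that V(4) by (auto simp: Q_def segment_transform_def)
    ultimately show "Ck_on 2 ({0..T} \<times> closure \<Omega> \<times> UNIV \<times> UNIV) (\<lambda>(t, x, z, w). Q t x z w)"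
      unfolding Ck_on_def using W by (intro exI[of _ W] exI[of _ "\<lambda>q. integral {0..1} (\<lambda>r. ?g q r)"]) blast
  next
    fix w
    show "convex_on UNIV (\<lambda>z. H z w)"
      by (rule convex_on_realI[where f' = "\<lambda>z. C (z - w)"]) (use dH C_mono in auto)
  next
    fix t x z w assume "t \<in> {0..T}" "x \<in> closure \<Omega>"
    then show "vector_derivative (\<lambda>s. Q t x s w) (at z) = deriv (\<lambda>s. H s w) z *\<^sub>R d3 f t x z"
      unfolding Q_def derivH
      by (intro vector_derivative_at segment_transform_derivative[OF cc C f_der])
  next
    fix t x w
    show "H w w = 0" "Q t x w w = 0" "deriv (\<lambda>s. H s w) w = 0"
      by (simp_all add: H_def[symmetric] derivH C(2)) (simp_all add: H_def Q_def segment_transform_diagonal)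
  qed
  then show ?thesis using that dH dC unfolding derivH[symmetric] by (metis derivH)
qed

section \<open>Equivalence of the two notions of solution\<close>

text \<open>Positive exactly for \<open>0 < \<sigma> * s < \<delta>\<close> and zero elsewhere, with
  \<sigma> choosing the side. Cubes are the lowest powers for which the truncation is C^2, as a
  density has to be.\<close>

lemma Ck_open_bump: "Ck_open 2 UNIV (\<lambda>s::real. max 0 (\<sigma> * s) ^ 3 * max 0 (\<delta> - \<sigma> * s) ^ 3)"
proof -
  have cube: "Ck_open 2 UNIV (\<lambda>s::real. max 0 s ^ 3)"
    using Ck_open_max_power[of 2] by (simp only: eval_nat_numeral)
  show ?thesis
    by (intro Ck_open_mult Ck_open_compose[OF cube] Ck_open_diff Ck_open_const Ck_open_ident) auto
qed

lemma integral_empty_space: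
  fixes g :: "'a \<Rightarrow> real"
  assumes "space M = {}"
  shows "integral\<^sup>L M g = 0"
  using Bochner_Integration.integral_cong[of M M g "\<lambda>_. 0"] assms by simp

context bounded_data
begin

lemma entropy_balance_nonneg:
  assumes pair: "boundary_entropy_pair T \<Omega> f H Q" and k: "k \<in> {-R..R}" and ne: "\<Omega> \<noteq> {}" "0 < T"
    and pos: "\<And>c. 0 \<le> kruzkov_balance T \<Omega> f F uo ub u L \<phi> pos_part sgn_plus c"
    and neg: "\<And>c. 0 \<le> kruzkov_balance T \<Omega> f F uo ub u L \<phi> neg_part sgn_minus c"
  shows "0 \<le> entropy_balance T \<Omega> f F uo ub u L \<phi> H Q k"
proof -
  have "Ck_on 2 UNIV (\<lambda>(z, w). H z w)" and conv: "convex_on UNIV (\<lambda>z. H z k)"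
    using pair unfolding boundary_entropy_pair_def by blast+
  then obtain a where a: "continuous_on UNIV a"
    "\<And>z. ((\<lambda>s. H s k) has_real_derivative deriv (\<lambda>s. H s k) z) (at z)"
    "\<And>z. (deriv (\<lambda>s. H s k) has_real_derivative a z) (at z)"
    using entropy_second_derivative by metis
  have "0 \<le> a c * kinetic_balance k c" for c
    using entropy_second_derivative_nonneg[OF conv a(2,3)] pos[of c] neg[of c]
      kinetic_balance_eq_kruzkov[of k c] kinetic_balance_eq_kruzkov(2)[of c k]
    by (cases "k < c") auto
  then have "0 \<le> (LINT c|N. a c * kinetic_balance k c)" by simp
  moreover have "entropy_pair T \<Omega> f H Q k a"
    using domain(1) ne Ck_flux pair a by unfold_locales
  ultimately show ?thesis using entropy_balance_eq(2)[OF _ k] by simp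
qed

text \<open>Otherwise the bump supported on this window turns the integrand of the entropy balance
  into a nonpositive function that is strictly negative on an interval of length \<delta>, which
  contradicts the RE-inequality.\<close>

lemma kinetic_balance_nonneg_near:
  assumes RE: "\<And>H Q. boundary_entropy_pair T \<Omega> f H Q \<Longrightarrow> 0 \<le> entropy_balance T \<Omega> f F uo ub u L \<phi> H Q k"
    and k: "\<bar>k\<bar> + 1 \<le> R" and ne: "\<Omega> \<noteq> {}" "0 < T" and \<sigma>: "\<sigma> \<in> {-1, 1}" and \<delta>: "0 < \<delta>" "\<delta> \<le> 1"
  shows "\<exists>c. 0 < \<sigma> * (c - k) \<and> \<sigma> * (c - k) < \<delta> \<and> 0 \<le> kinetic_balance k c"
proof (rule ccontr)
  assume "\<not> ?thesis"
  then have neg: "kinetic_balance k c < 0" if "0 < \<sigma> * (c - k)" "\<sigma> * (c - k) < \<delta>" for c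
    using that by force
  define b where "b s = max 0 (\<sigma> * s) ^ 3 * max 0 (\<delta> - \<sigma> * s) ^ 3" for s
  have b0: "0 \<le> b s" for s by (simp add: b_def)
  have "0 < max 0 x ^ 3 * max 0 y ^ 3 \<longleftrightarrow> 0 < x \<and> 0 < y" for x y :: real
    by (cases "0 < x"; cases "0 < y") (auto simp: max_def)
  then have b_pos: "0 < b s \<longleftrightarrow> 0 < \<sigma> * s \<and> \<sigma> * s < \<delta>" for s
    by (simp add: b_def)
  obtain H Q where HQ: "boundary_entropy_pair T \<Omega> f H Q"
    "\<And>k z. ((\<lambda>s. H s k) has_real_derivative deriv (\<lambda>s. H s k) z) (at z)"
    "\<And>k z. (deriv (\<lambda>s. H s k) has_real_derivative b (z - k)) (at z)"
    using entropy_pair_of_density[OF Ck_open_bump[of \<sigma> \<delta>] _ Ck_flux] b0 unfolding b_def by blast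
  have "continuous_on UNIV b" unfolding b_def by (intro continuous_intros)
  then have "continuous_on UNIV (\<lambda>c. b (c - k))"
    by (rule continuous_on_compose2) (auto intro!: continuous_intros)
  then have ep: "entropy_pair T \<Omega> f H Q k (\<lambda>c. b (c - k))"
    using domain(1) ne Ck_flux HQ by unfold_locales
  have kR: "k \<in> {-R..R}" using k by auto
  note eq = entropy_balance_eq[OF ep kR]
  have le: "b (c - k) * kinetic_balance k c \<le> 0" for c
    using neg[of c] b_pos[of "c - k"] b0[of "c - k"] by (cases "b (c - k) = 0") (auto simp: mult_le_0_iff)
  have "0 \<le> (LINT c|N. b (c - k) * kinetic_balance k c)" using RE[OF HQ(1)] eq(2) by simp
  moreover have "(LINT c|N. - (b (c - k) * kinetic_balance k c)) \<ge> 0"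
    by (intro integral_nonneg_AE AE_I2) (use le in simp)
  ultimately have "(LINT c|N. - (b (c - k) * kinetic_balance k c)) = 0" by simp
  then have "AE c in N. b (c - k) * kinetic_balance k c = 0"
    using integral_nonneg_eq_0_iff_AE[of N "\<lambda>c. - (b (c - k) * kinetic_balance k c)"] eq(1) le by simp
  then have ae: "AE c in lborel. c \<in> {-R..R} \<longrightarrow> b (c - k) * kinetic_balance k c = 0"
    by (subst (asm) AE_restrict_space_iff) auto
  \<comment> \<open>The left end of the window, which is (k, k + \<delta>) or (k - \<delta>, k). It
    stays inside \<open>{-R..R}\<close> because \<delta> is at most 1 and \<open>R\<close> at least
    \<open>\<bar>k\<bar> + 1\<close>.\<close>
  define l where "l = (if \<sigma> = 1 then k else k - \<delta>)"
  have in_I: "c \<in> {-R..R} \<and> 0 < \<sigma> * (c - k) \<and> \<sigma> * (c - k) < \<delta>" if "c \<in> {l<..<l + \<delta>}" for c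
    using that \<sigma> k \<delta> by (auto simp: l_def split: if_splits)
  have "AE c in lborel. c \<notin> {l<..<l + \<delta>}"
  proof (rule eventually_mono[OF ae], intro notI)
    fix c assume *: "c \<in> {-R..R} \<longrightarrow> b (c - k) * kinetic_balance k c = 0" "c \<in> {l<..<l + \<delta>}"
    have "0 < b (c - k)" "kinetic_balance k c < 0" using in_I[OF *(2)] b_pos neg by auto
    then show False using * in_I[OF *(2)] by auto
  qed
  then have "{l<..<l + \<delta>} \<in> null_sets lborel"
    by (subst (asm) AE_iff_null_sets[symmetric]) auto
  then show False using \<delta> by (simp add: null_sets_def)
qed

text \<open>One good level in each window of width 1 / (n + 1) suffices: these levels tend to
  \<open>k\<close> strictly from the right for the plus sign and from the left for the minus sign,
  as the limit of the balances requires.\<close>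

lemma kruzkov_balance_nonneg:
  assumes RE: "\<And>H Q. boundary_entropy_pair T \<Omega> f H Q \<Longrightarrow> 0 \<le> entropy_balance T \<Omega> f F uo ub u L \<phi> H Q k"
    and k: "\<bar>k\<bar> + 1 \<le> R" and ne: "\<Omega> \<noteq> {}" "0 < T"
  shows "0 \<le> kruzkov_balance T \<Omega> f F uo ub u L \<phi> pos_part sgn_plus k"
    and "0 \<le> kruzkov_balance T \<Omega> f F uo ub u L \<phi> neg_part sgn_minus k"
proof -
  have seq: "\<exists>X. X \<longlonglongrightarrow> k \<and> (\<forall>n. X n \<in> {-R..R} \<and> 0 < \<sigma> * (X n - k) \<and> 0 \<le> kinetic_balance k (X n))"
    if \<sigma>: "\<sigma> \<in> {-1, 1}" for \<sigma>
  proof -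
    have "\<exists>c. 0 < \<sigma> * (c - k) \<and> \<sigma> * (c - k) < 1 / real (Suc n) \<and> 0 \<le> kinetic_balance k c" for n
      by (rule kinetic_balance_nonneg_near[OF RE k ne \<sigma>]) auto
    then obtain X where X: "\<And>n. 0 < \<sigma> * (X n - k)" "\<And>n. \<sigma> * (X n - k) < 1 / real (Suc n)"
      "\<And>n. 0 \<le> kinetic_balance k (X n)" by metis
    have abs: "\<bar>X n - k\<bar> < 1 / real (Suc n)" for n using X(1,2)[of n] \<sigma> by auto
    have "(\<lambda>n. X n - k) \<longlonglongrightarrow> 0"
      by (rule LIMSEQ_norm_0) (use abs in simp)
    then have "X \<longlonglongrightarrow> k" by (simp add: LIM_zero_iff)
    moreover have "X n \<in> {-R..R}" for n
    proof -
      have "\<bar>X n - k\<bar> < 1" using abs[of n] by (rule less_le_trans) simp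
      then show ?thesis using k by auto
    qed
    ultimately show ?thesis using X by blast
  qed
  have kR: "k \<in> {-R..R}" using k by auto
  obtain X where X: "X \<longlonglongrightarrow> k" "\<And>n. X n \<in> {-R..R}" "\<And>n. 0 < 1 * (X n - k)" "\<And>n. 0 \<le> kinetic_balance k (X n)"
    using seq[of 1] by auto
  have "(\<lambda>n. kinetic_balance k (X n)) \<longlonglongrightarrow> kruzkov_balance T \<Omega> f F uo ub u L \<phi> pos_part sgn_plus k"
    by (rule kinetic_balance_tendsto[OF X(1,2) kR _ part_eq_sgn(1)]) (use X(3) in auto)
  then show "0 \<le> kruzkov_balance T \<Omega> f F uo ub u L \<phi> pos_part sgn_plus k"
    by (rule LIMSEQ_le_const) (use X(4) in auto)
  obtain Y where Y: "Y \<longlonglongrightarrow> k" "\<And>n. Y n \<in> {-R..R}" "\<And>n. 0 < -1 * (Y n - k)" "\<And>n. 0 \<le> kinetic_balance k (Y n)"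
    using seq[of "-1"] by auto
  have "(\<lambda>n. kinetic_balance k (Y n)) \<longlonglongrightarrow> kruzkov_balance T \<Omega> f F uo ub u L \<phi> neg_part sgn_minus k"
    by (rule kinetic_balance_tendsto[OF Y(1,2) kR _ part_eq_sgn(2)]) (use Y(3) in auto)
  then show "0 \<le> kruzkov_balance T \<Omega> f F uo ub u L \<phi> neg_part sgn_minus k"
    by (rule LIMSEQ_le_const) (use Y(4) in auto)
qed

end

definition clamp_to :: "real \<Rightarrow> real \<Rightarrow> real" where
  "clamp_to R v = max (- R) (min R v)"

text \<open>The conclusion holds for every \<open>R\<close> beyond one threshold, so a common height
  can be chosen for the three data and the level.\<close>

lemma in_Linf_clamp:
  fixes g :: "'a \<Rightarrow> real"
  assumes "in_Linf M g"
  obtains C where "\<And>R. C \<le> R \<Longrightarrow> AE p in M. g p = clamp_to R (g p)"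
proof -
  obtain C where C: "AE p in M. norm (g p) \<le> C" using assms unfolding in_Linf_def by blast
  have "AE p in M. g p = clamp_to R (g p)" if "C \<le> R" for R
    using C by eventually_elim (use that in \<open>auto simp: clamp_to_def\<close>)
  then show ?thesis using that by blast
qed

lemma clamped_data:
  fixes \<Omega> :: "(real^'n) set"
  assumes "open \<Omega>" "bounded \<Omega>" "smooth_boundary \<Omega>"
    and uo: "in_Linf (lebesgue_on \<Omega>) uo" and ub: "in_Linf (lateral_measure T \<Omega>) ub"
    and u: "in_Linf (interior_measure T \<Omega>) u"
    and "Ck_on 2 ({0..T} \<times> closure \<Omega> \<times> UNIV) (\<lambda>(t, x, v). f t x v)"
    and "Ck_on 2 ({0..T} \<times> closure \<Omega> \<times> UNIV) (\<lambda>(t, x, v). F t x v)"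
    and "test_function T \<phi>"
  obtains R uo' ub' u' where "\<bar>k\<bar> + 1 \<le> R" "bounded_data T \<Omega> f F uo' ub' u' \<phi> R"
    "\<And>H Q k. entropy_balance T \<Omega> f F uo ub u L \<phi> H Q k = entropy_balance T \<Omega> f F uo' ub' u' L \<phi> H Q k"
    "\<And>\<theta> sg k. kruzkov_balance T \<Omega> f F uo ub u L \<phi> \<theta> sg k = kruzkov_balance T \<Omega> f F uo' ub' u' L \<phi> \<theta> sg k"
proof -
  obtain A where A: "\<And>R. A \<le> R \<Longrightarrow> AE x in lebesgue_on \<Omega>. uo x = clamp_to R (uo x)"
    using in_Linf_clamp[OF uo] by blast
  obtain B where B: "\<And>R. B \<le> R \<Longrightarrow> AE x in lateral_measure T \<Omega>. ub x = clamp_to R (ub x)"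
    using in_Linf_clamp[OF ub] by blast
  obtain C where C: "\<And>R. C \<le> R \<Longrightarrow> AE x in interior_measure T \<Omega>. u x = clamp_to R (u x)"
    using in_Linf_clamp[OF u] by blast
  \<comment> \<open>The first entry leaves room for windows of width 1 on either side of
    \<open>k\<close>; \<open>A\<close>, \<open>B\<close> and \<open>C\<close> make the truncation
    harmless.\<close>
  define R where "R = max (\<bar>k\<bar> + 1) (max A (max B C))"
  have "0 \<le> R" by (auto simp: R_def)
  then have range: "clamp_to R v \<in> {-R..R}" for v by (auto simp: clamp_to_def)
  have [measurable]: "clamp_to R \<in> borel_measurable borel" unfolding clamp_to_def by measurable
  have "bounded_data T \<Omega> f F (\<lambda>x. clamp_to R (uo x)) (\<lambda>p. clamp_to R (ub p)) (\<lambda>p. clamp_to R (u p)) \<phi> R"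
  proof
    show "(\<lambda>x. clamp_to R (uo x)) \<in> borel_measurable (lebesgue_on \<Omega>)"
      using uo unfolding in_Linf_def by (auto intro: measurable_compose)
    show "(\<lambda>x. clamp_to R (ub x)) \<in> borel_measurable (lateral_measure T \<Omega>)"
      using ub unfolding in_Linf_def by (auto intro: measurable_compose)
    show "(\<lambda>x. clamp_to R (u x)) \<in> borel_measurable (interior_measure T \<Omega>)"
      using u unfolding in_Linf_def by (auto intro: measurable_compose)
  qed (fact assms range)+
  moreover have "A \<le> R" "B \<le> R" "C \<le> R" "\<bar>k\<bar> + 1 \<le> R" by (auto simp: R_def)
  moreover note balance_cong_AE[OF assms(1,2) C[OF \<open>C \<le> R\<close>] A[OF \<open>A \<le> R\<close>] B[OF \<open>B \<le> R\<close>]]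
  ultimately show ?thesis by (intro that)
qed

text \<open>Interior, initial and lateral measure all live on the empty space, the frontier of the
  empty set being empty. This case stands apart because the diagonal conditions on \<open>H\<close>
  are vacuous there.\<close>

lemma balance_empty_domain:
  fixes T :: real
  shows "entropy_balance T {} f F uo ub u L \<phi> H Q k = 0"
    and "kruzkov_balance T {} f F uo ub u L \<phi> \<theta> sg k = 0"
proof -
  have i: "space (interior_measure T ({} :: (real^'n) set)) = {}" "space (lebesgue_on ({} :: (real^'n) set)) = {}"
    by (auto simp: space_restrict_space)
  have l: "space (lateral_measure T ({} :: (real^'n) set)) = {}"
    by (auto simp: lateral_measure_def surface_measure_def space_pair_measure space_restrict_space)
  show "entropy_balance T {} f F uo ub u L \<phi> H Q k = 0" "kruzkov_balance T {} f F uo ub u L \<phi> \<theta> sg k = 0"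
    unfolding entropy_balance_def kruzkov_balance_def
      integral_empty_space[OF i(1)] integral_empty_space[OF i(2)] integral_empty_space[OF l] by simp_all
qed

theorem theorem3p8:
  fixes T :: real
    and \<Omega> :: "(real^'n) set"
    and f :: "real \<Rightarrow> real^'n \<Rightarrow> real \<Rightarrow> real^'n"
    and F :: "real \<Rightarrow> real^'n \<Rightarrow> real \<Rightarrow> real"
    and uo :: "real^'n \<Rightarrow> real"
    and ub u :: "real \<times> (real^'n) \<Rightarrow> real"
  assumes "T > 0"
    and "open \<Omega>" and "bounded \<Omega>" and "smooth_boundary \<Omega>"
    and "in_Linf (lebesgue_on \<Omega>) uo"
    and "in_Linf (lateral_measure T \<Omega>) ub"
    and "Ck_on 2 ({0..T} \<times> closure \<Omega> \<times> UNIV) (\<lambda>(t, x, v). f t x v)"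
    and "\<And>K. compact K \<Longrightarrow> K \<subseteq> {0..T} \<times> \<Omega> \<times> UNIV \<Longrightarrow>
           in_Linf (lebesgue_on K) (\<lambda>(t, x, v). d3 f t x v)"
    and "in_Linf (lebesgue_on ({0..T} \<times> \<Omega> \<times> UNIV))
           (\<lambda>(t, x, v). jacobian (\<lambda>y. d3 f t y v) (at x))"
    and "Ck_on 2 ({0..T} \<times> closure \<Omega> \<times> UNIV) (\<lambda>(t, x, v). F t x v)"
    and "in_Linf (lebesgue_on ({0..T} \<times> \<Omega> \<times> UNIV)) (\<lambda>(t, x, v). d3 F t x v)"
    and "in_Linf (interior_measure T \<Omega>) u"
  shows "RE_solution T \<Omega> f F uo ub u \<longleftrightarrow> MV_solution T \<Omega> f F uo ub u"
proof (cases "\<Omega> = {}")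
  case True
  then show ?thesis unfolding RE_solution_iff MV_solution_iff by (simp add: balance_empty_domain)
next
  case False
  \<comment> \<open>Fixed from the original \<open>u\<close>; the truncation height, in contrast, is
    chosen anew for each level \<open>k\<close>.\<close>
  let ?L = "lip_const T \<Omega> f u"
  note clamped = clamped_data[OF assms(2,3,4,5,6,12,7,10), of _ _ ?L]
  show ?thesis
  proof
    assume RE: "RE_solution T \<Omega> f F uo ub u"
    show "MV_solution T \<Omega> f F uo ub u"
      unfolding MV_solution_iff
    proof (intro conjI allI impI)
      fix k and \<phi> :: "real \<times> (real^'n) \<Rightarrow> real" assume \<phi>: "test_function T \<phi>"
      obtain R uo' ub' u' where k: "\<bar>k\<bar> + 1 \<le> R" and bd: "bounded_data T \<Omega> f F uo' ub' u' \<phi> R"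
        and eq: "\<And>H Q k. entropy_balance T \<Omega> f F uo ub u ?L \<phi> H Q k = entropy_balance T \<Omega> f F uo' ub' u' ?L \<phi> H Q k"
          "\<And>\<theta> sg k. kruzkov_balance T \<Omega> f F uo ub u ?L \<phi> \<theta> sg k = kruzkov_balance T \<Omega> f F uo' ub' u' ?L \<phi> \<theta> sg k"
        using clamped[OF \<phi>, of k] by blast
      interpret bounded_data T \<Omega> f F uo' ub' u' \<phi> ?L R by (rule bd)
      have "0 \<le> entropy_balance T \<Omega> f F uo' ub' u' ?L \<phi> H Q k" if "boundary_entropy_pair T \<Omega> f H Q" for H Q
        using RE that \<phi> unfolding RE_solution_iff eq[symmetric] by blast
      from kruzkov_balance_nonneg[OF this k False assms(1)]
      show "0 \<le> kruzkov_balance T \<Omega> f F uo ub u ?L \<phi> pos_part sgn_plus k"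
        "0 \<le> kruzkov_balance T \<Omega> f F uo ub u ?L \<phi> neg_part sgn_minus k"
        unfolding eq by blast+
    qed (fact assms)
  next
    assume MV: "MV_solution T \<Omega> f F uo ub u"
    show "RE_solution T \<Omega> f F uo ub u"
      unfolding RE_solution_iff
    proof (intro conjI allI impI)
      fix H Q k and \<phi> :: "real \<times> (real^'n) \<Rightarrow> real"
      assume pair: "boundary_entropy_pair T \<Omega> f H Q" and \<phi>: "test_function T \<phi>"
      obtain R uo' ub' u' where k: "\<bar>k\<bar> + 1 \<le> R" and bd: "bounded_data T \<Omega> f F uo' ub' u' \<phi> R"
        and eq: "\<And>H Q k. entropy_balance T \<Omega> f F uo ub u ?L \<phi> H Q k = entropy_balance T \<Omega> f F uo' ub' u' ?L \<phi> H Q k"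
          "\<And>\<theta> sg k. kruzkov_balance T \<Omega> f F uo ub u ?L \<phi> \<theta> sg k = kruzkov_balance T \<Omega> f F uo' ub' u' ?L \<phi> \<theta> sg k"
        using clamped[OF \<phi>, of k] by blast
      interpret bounded_data T \<Omega> f F uo' ub' u' \<phi> ?L R by (rule bd)
      have "k \<in> {-R..R}" using k by auto
      moreover have "0 \<le> kruzkov_balance T \<Omega> f F uo' ub' u' ?L \<phi> pos_part sgn_plus c"
        "0 \<le> kruzkov_balance T \<Omega> f F uo' ub' u' ?L \<phi> neg_part sgn_minus c" for c
        using MV \<phi> unfolding MV_solution_iff eq[symmetric] by blast+
      ultimately show "0 \<le> entropy_balance T \<Omega> f F uo ub u ?L \<phi> H Q k"
        unfolding eq using entropy_balance_nonneg[OF pair _ False assms(1)] by blast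
    qed (fact assms)
  qed
qed

end
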